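(* There exists a transcendental number $\alpha_{KL}\approx 0.39433$ such that: (1) For every $\alpha\in(\alpha_{KL},1/2)$ there exists $n^*\in\mathbb{N}$ such that $$D_{\alpha}=\Big\{0,\ \frac{\log 2}{-\log \alpha}\Big\}\cup\Big\{\frac{\log 2}{\log\alpha}\sum_{i=1}^{n}\Big(\frac{-1}{2}\Big)^{i}: 1\leq n\leq n^*\Big\}.$$ (2) $$D_{\alpha_{KL}}=\Big\{0,\ \frac{\log 2}{-\log \alpha_{KL}},\ \frac{\log 2}{-3\log \alpha_{KL}}\Big\}\cup\Big\{\frac{\log 2}{\log\alpha_{KL}}\sum_{i=1}^{n}\Big(\frac{-1}{2}\Big)^{i}: 1\leq n<\infty\Big\}.$$ (3) For every $\alpha\in(1/3,\alpha_{KL})$ the set $D_{\alpha}$ contains an interval of positive length.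
   Context: For $\alpha\in(0,1/2)$ let $\Gamma_{\alpha}:=\{\sum_{i=1}^{\infty}\epsilon_i\alpha^i:\epsilon_i\in\{0,1\},\ i\geq 1\}$, and for $t\in\mathbb{R}$ let $\Gamma_\alpha+t:=\{x+t:x\in\Gamma_\alpha\}$. Let $\Gamma_\alpha-\Gamma_\alpha=\{\sum_{i=1}^{\infty}\epsilon_i\alpha^i:\epsilon_i\in\{-1,0,1\},\ i\ge 1\}$ be the difference set. An $\alpha$-expansion of $t$ with alphabet $\{-1,0,1\}$ is a sequence $(t_i)_{i\ge1}\in\{-1,0,1\}^{\mathbb{N}}$ with $t=\sum_{i=1}^\infty t_i\alpha^i$. Let $\mathcal{U}_\alpha$ be the set of $t\in\Gamma_\alpha-\Gamma_\alpha$ having exactly one $\alpha$-expansion with alphabet $\{-1,0,1\}$, and let $$D_\alpha:=\{\dim_H(\Gamma_\alpha\cap(\Gamma_\alpha+t)):t\in\mathcal{U}_\alpha\},$$ where $\dim_H$ denotes Hausdorff dimension. The number denoted $\alpha_{KL}$ in the paper is the unique $\alpha\in(1/3,1/2)$ with $\sum_{i=1}^\infty(1+\lambda_i)\alpha^i=1$, where $\lambda_i=\tau_i-\tau_{i-1}$ for $i\ge 1$ and $(\tau_i)_{i\geq 0}$ is the Thue-Morse sequence: $\tau_0=0$, $\tau_{2i}=\tau_i$, $\tau_{2i+1}=1-\tau_i$. In part (1), $n^*$ depends on $\alpha$ and $\mathbb{N}=\{0,1,2,\ldots\}$, so $n^*=0$ is allowed, in which case the second set in the union is empty. *)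

theory Defs
  imports "HOL-Analysis.Analysis" "HOL-Computational_Algebra.Polynomial"
begin

section \<open>Hausdorff dimension\<close>

text \<open>
  Boundedness has to be required explicitly: the diameter of an unbounded set is a supremum that
  does not exist in the reals, so its value carries no information.
\<close>

definition hausdorff_cover :: "real \<Rightarrow> 'a::metric_space set \<Rightarrow> (nat \<Rightarrow> 'a set) \<Rightarrow> bool" where
  "hausdorff_cover \<delta> E C \<longleftrightarrow>
     E \<subseteq> (\<Union>i. C i) \<and> (\<forall>i. bounded (C i) \<and> diameter (C i) \<le> \<delta>)"

definition hausdorff_premeasure :: "real \<Rightarrow> real \<Rightarrow> 'a::metric_space set \<Rightarrow> ennreal" where
  "hausdorff_premeasure s \<delta> E =
     (INF C \<in> {C. hausdorff_cover \<delta> E C}. \<Sum>i. ennreal (diameter (C i) powr s))"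

definition hausdorff_measure :: "real \<Rightarrow> 'a::metric_space set \<Rightarrow> ennreal" where
  "hausdorff_measure s E = (SUP \<delta> \<in> {0<..}. hausdorff_premeasure s \<delta> E)"

text \<open>
  Only exponents s > 0 are used, so the convention for 0 powr 0 plays no role and the infimum
  is the usual one.  It is taken over a nonempty set, since the s-dimensional measure
  vanishes whenever s exceeds the dimension of the Euclidean space.
\<close>

definition hausdorff_dim :: "'a::euclidean_space set \<Rightarrow> real" where
  "hausdorff_dim E = Inf {s. 0 < s \<and> hausdorff_measure s E = 0}"

section \<open>Expansions and the sets $\Gamma_\alpha$\<close>

text \<open>
  A sequence $(t_i)_{i \ge 1}$ is represented by a function on the naturals whose value at i
  is the digit $t_{i+1}$; there is thus no spurious digit to disturb uniqueness.
\<close>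

definition is_expansion :: "int set \<Rightarrow> real \<Rightarrow> real \<Rightarrow> (nat \<Rightarrow> int) \<Rightarrow> bool" where
  "is_expansion A \<alpha> x e \<longleftrightarrow>
     (\<forall>i. e i \<in> A) \<and> (\<lambda>i. of_int (e i) * \<alpha> ^ Suc i) sums x"

definition cantor_set :: "real \<Rightarrow> real set" where
  "cantor_set \<alpha> = {x. \<exists>e. is_expansion {0, 1} \<alpha> x e}"

definition difference_set :: "real set \<Rightarrow> real set" where
  "difference_set S = {x - y | x y. x \<in> S \<and> y \<in> S}"

definition unique_expansion_set :: "real \<Rightarrow> real set" where
  "unique_expansion_set \<alpha> =
     {t \<in> difference_set (cantor_set \<alpha>). \<exists>!e. is_expansion {-1, 0, 1} \<alpha> t e}"

definition dim_set :: "real \<Rightarrow> real set" where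
  "dim_set \<alpha> =
     (\<lambda>t. hausdorff_dim (cantor_set \<alpha> \<inter> (\<lambda>x. x + t) ` cantor_set \<alpha>))
       ` unique_expansion_set \<alpha>"

section \<open>The Thue-Morse sequence and the equation for $\alpha_{KL}$\<close>

fun thue_morse :: "nat \<Rightarrow> int" where
  "thue_morse n =
     (if n = 0 then 0
      else if even n then thue_morse (n div 2)
      else 1 - thue_morse (n div 2))"

declare thue_morse.simps [simp del]

text \<open>This is $\lambda_i$; it is used only for i at least 1.\<close>

definition tm_diff :: "nat \<Rightarrow> int" where
  "tm_diff i = thue_morse i - thue_morse (i - 1)"

definition KL_equation :: "real \<Rightarrow> bool" where
  "KL_equation \<alpha> \<longleftrightarrow> (\<lambda>i. of_int (1 + tm_diff (Suc i)) * \<alpha> ^ Suc i) sums 1"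

end

theory Submission
  imports Defs
begin


text \<open>
  Let M be the largest value \<alpha>/(1 - \<alpha>) of a digit string.  For \<alpha> at least 1/3 every number of modulus at
  most M has a signed expansion, so an expansion t is unique exactly if no digit can be moved by one
  and compensated by its tail; this bounds the tails (\<open>unique_expansion_iff\<close>).  If t is unique, then a point of
  the intersection has its digit forced wherever t has a nonzero digit and free where t has the digit 0
  (\<open>cantor_set_inter_translate\<close>).  Hence the dimension is the frequency of zeros in t times
  log 2/(-log \<alpha>), whenever that frequency exists (\<open>hausdorff_dim_digit_set\<close>).

  For \<alpha> above 0.382 the tail bounds force the nonzero digits to alternate in sign, except in trivial cases,
  so that t is eventually the difference sequence of a binary sequence s (\<open>tails_small_cases\<close>), and a zero of t is a
  repeated letter of s.  The tail bounds then say that every tail of s, complemented if necessary so that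
  it starts with 0, has a value below a number \<open>hole\<close>.  Since \<alpha> is below 1/2, values are ordered
  like words, and the condition becomes lexicographic.  The critical base is the one for which \<open>hole\<close> is the
  value of the Thue-Morse word; in terms of the product f(x) of the factors 1 - x^(2^k) this is
  the equation f(x) = (3x - 1)/(1 - x)^2, whose left side decreases and whose right side increases
  (\<open>KL_equation_iff\<close>, \<open>critical_base_exists\<close>).

  A sequence all of whose normalized tails lie below the Thue-Morse word is eventually constant or eventually the image
  of such a sequence under the substitution 0 -> 01, 1 -> 10 (\<open>tm_bounded_desubst\<close>).  Thus it is
  eventually an iterated image of a constant word, or it can be desubstituted forever
  (\<open>renormalize\<close>).  The substitution turns the frequency c of repeated letters into (1 - c)/2.  Starting from 1 this
  gives the frequencies 0, 1/2, 1/4, 3/8, ..., and unlimited desubstitution gives the fixed point 1/3.  Above the critical base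
  sequences that contain long Thue-Morse words are excluded, and finitely many levels remain
  (\<open>dim_set_finite\<close>).  At the critical base all levels and the Thue-Morse word itself occur
  (\<open>dim_set_critical\<close>).  Below it, the k-th images of all binary sequences are admitted for a large k, and their
  frequencies fill an interval (\<open>dim_set_interval\<close>).

  The critical base is transcendental by Mahler's method.  If \<alpha> is algebraic and solves the equation, then
  all the numbers f(\<alpha>^(2^k)) lie in the field of \<alpha>, because f(x) = (1 - x) f(x^2).  A polynomial in x and f(x)
  of degree N in each that vanishes to order N^2 at 0 takes values at \<alpha>^(2^k) that are too small for numbers of
  their degree and size (\<open>liouville\<close>), once N is large.
\<close>

section \<open>Binary words, the Thue-Morse substitution and renormalization\<close>

definition lex_less :: "(nat \<Rightarrow> bool) \<Rightarrow> (nat \<Rightarrow> bool) \<Rightarrow> bool" (infix "\<sqsubset>" 50) where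
  "x \<sqsubset> y \<longleftrightarrow> (\<exists>n. (\<forall>i<n. x i = y i) \<and> \<not> x n \<and> y n)"

definition lex_le :: "(nat \<Rightarrow> bool) \<Rightarrow> (nat \<Rightarrow> bool) \<Rightarrow> bool" (infix "\<sqsubseteq>" 50) where
  "x \<sqsubseteq> y \<longleftrightarrow> x = y \<or> x \<sqsubset> y"

lemma lex_lessI: "(\<And>i. i < n \<Longrightarrow> x i = y i) \<Longrightarrow> \<not> x n \<Longrightarrow> y n \<Longrightarrow> x \<sqsubset> y"
  unfolding lex_less_def by blast

lemma lex_less_total: "x \<noteq> y \<Longrightarrow> x \<sqsubset> y \<or> y \<sqsubset> x"
proof -
  assume "x \<noteq> y"
  then have "\<exists>n. x n \<noteq> y n" by auto
  define n where "n = (LEAST n. x n \<noteq> y n)"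
  have n: "x n \<noteq> y n" using \<open>\<exists>n. x n \<noteq> y n\<close> unfolding n_def by (rule LeastI_ex)
  have "\<forall>i<n. x i = y i" unfolding n_def using not_less_Least by blast
  with n show ?thesis unfolding lex_less_def by metis
qed

lemma lex_less_prefix:
  assumes "x \<sqsubset> y" "\<And>i. i < m \<Longrightarrow> x i = y i" "\<not> y m"
  shows "\<not> x m"
proof -
  obtain n where n: "\<forall>i<n. x i = y i" "\<not> x n" "y n" using assms(1) lex_less_def by auto
  show ?thesis
    using n assms(2)[of n] assms(3) by (cases m n rule: linorder_cases) auto
qed

definition tm_subst :: "(nat \<Rightarrow> bool) \<Rightarrow> nat \<Rightarrow> bool" where
  "tm_subst s n = (s (n div 2) \<noteq> odd n)"

lemma tm_subst_even [simp]: "tm_subst s (2 * n) = s n"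
  and tm_subst_odd [simp]: "tm_subst s (Suc (2 * n)) = (\<not> s n)"
  by (simp_all add: tm_subst_def)

lemma tm_subst_mono: "x \<sqsubset> y \<Longrightarrow> tm_subst x \<sqsubset> tm_subst y"
proof -
  assume "x \<sqsubset> y"
  then obtain n where n: "\<forall>i<n. x i = y i" "\<not> x n" "y n" unfolding lex_less_def by auto
  show ?thesis
  proof (rule lex_lessI[of "2 * n"])
    fix i assume "i < 2 * n"
    then have "i div 2 < n" by auto
    with n show "tm_subst x i = tm_subst y i" by (simp add: tm_subst_def)
  qed (use n in auto)
qed

lemma lex_less_asym: "x \<sqsubset> y \<Longrightarrow> \<not> y \<sqsubset> x"
  unfolding lex_less_def by (metis linorder_neqE_nat)

lemma lex_less_irrefl: "\<not> x \<sqsubset> x"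
  unfolding lex_less_def by auto

lemma tm_subst_mono_iff: "tm_subst x \<sqsubset> tm_subst y \<longleftrightarrow> x \<sqsubset> y"
  using tm_subst_mono lex_less_total lex_less_asym lex_less_irrefl by metis

lemma tm_subst_mono_le: "x \<sqsubseteq> y \<Longrightarrow> tm_subst x \<sqsubseteq> tm_subst y"
  unfolding lex_le_def using tm_subst_mono by blast

lemma tm_subst_pow_mono: "x \<sqsubset> y \<Longrightarrow> (tm_subst ^^ k) x \<sqsubset> (tm_subst ^^ k) y"
  by (induction k) (auto intro: tm_subst_mono)

definition tm :: "nat \<Rightarrow> bool" where "tm n \<longleftrightarrow> thue_morse n = 1"

lemma thue_morse_01: "thue_morse n \<in> {0, 1}"
proof (induction n rule: less_induct)
  case (less n)
  show ?case using less[of "n div 2"] by (subst thue_morse.simps) auto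
qed

lemma thue_morse_tm: "thue_morse n = of_bool (tm n)"
  using thue_morse_01[of n] by (auto simp: tm_def)

lemma tm_0 [simp]: "\<not> tm 0" by (simp add: tm_def thue_morse.simps)

lemma tm_rec: "tm n = (tm (n div 2) \<noteq> odd n)"
proof (cases "n = 0")
  case False
  have "thue_morse n = (if even n then thue_morse (n div 2) else 1 - thue_morse (n div 2))"
    using False by (subst thue_morse.simps) auto
  then show ?thesis using thue_morse_01[of "n div 2"] by (auto simp: tm_def)
qed simp

lemma tm_subst_tm: "tm_subst tm = tm"
  by (rule ext) (metis tm_subst_def tm_rec)

lemma tm_subst_pow_tm: "(tm_subst ^^ k) tm = tm"
  by (induction k) (auto simp: tm_subst_tm)

lemma tm_even [simp]: "tm (2 * n) = tm n"
  and tm_odd [simp]: "tm (Suc (2 * n)) = (\<not> tm n)"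
  by (metis tm_subst_tm tm_subst_even, metis tm_subst_tm tm_subst_odd)

lemma tm_values: "tm (Suc 0)" "tm 2" "\<not> tm 3" "tm 4" "\<not> tm 5" "\<not> tm 6"
  using tm_rec[of 1] tm_rec[of 2] tm_rec[of 3] tm_rec[of 4] tm_rec[of 5] tm_rec[of 6]
  by simp_all

text \<open>
  The k-th image consists of blocks of length 2^k, each of which is an initial block of the Thue-Morse word or its complement.
\<close>

lemma tm_subst_pow: "(tm_subst ^^ k) s i = (s (i div 2 ^ k) \<noteq> tm (i mod 2 ^ k))"
proof (induction k arbitrary: i)
  case (Suc k)
  have *: "(i mod 2 ^ Suc k) div 2 = (i div 2) mod 2 ^ k"
    by (simp add: mod_mult2_eq)
  have "odd (i mod 2 ^ Suc k) = odd i" by (simp add: mod_mult2_eq)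
  then have "tm (i mod 2 ^ Suc k) = (tm ((i div 2) mod 2 ^ k) \<noteq> odd i)"
    using tm_rec[of "i mod 2 ^ Suc k"] * by simp
  moreover have "i div 2 ^ Suc k = i div 2 div 2 ^ k" by (simp add: div_mult2_eq)
  ultimately show ?case using Suc[of "i div 2"] by (simp add: tm_subst_def) metis
qed simp

lemma tm_subst_pow_shift: "(tm_subst ^^ k) s (2 ^ k * N + i) = (tm_subst ^^ k) (\<lambda>i. s (N + i)) i"
  by (simp add: tm_subst_pow)

text \<open>
  The tail from position i, complemented if necessary so that its first letter is False.  With it one inequality
  covers both the tails that start with False and those that start with True.
\<close>

definition norm_shift :: "(nat \<Rightarrow> bool) \<Rightarrow> nat \<Rightarrow> nat \<Rightarrow> bool" where
  "norm_shift s i = (\<lambda>j. s (i + j) \<noteq> s i)"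

lemma norm_shift_add: "norm_shift (\<lambda>i. s (N + i)) i = norm_shift s (N + i)"
  by (simp add: norm_shift_def add.assoc)

lemma norm_shift_0 [simp]: "\<not> norm_shift s i 0" by (simp add: norm_shift_def)

lemma norm_shift_subst_even: "norm_shift (tm_subst s) (2 * n) = tm_subst (norm_shift s n)"
proof
  fix j
  have "(2 * n + j) div 2 = n + j div 2" "odd (2 * n + j) = odd j" by auto
  then show "norm_shift (tm_subst s) (2 * n) j = tm_subst (norm_shift s n) j"
    by (auto simp: norm_shift_def tm_subst_def)
qed

text \<open>
  An odd position of a substituted word lies in the middle of a block, and the next two letters
  already decide the comparison with any word that starts with 011.
\<close>

lemma norm_shift_subst_odd: "\<not> x 0 \<Longrightarrow> x 1 \<Longrightarrow> norm_shift (tm_subst s) (Suc (2 * n)) \<sqsubset> tm_subst x"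
proof -
  assume x: "\<not> x 0" "x 1"
  have e: "Suc (2 * n) + 1 = 2 * Suc n" "Suc (2 * n) + 2 = Suc (2 * Suc n)" by auto
  have 1: "norm_shift (tm_subst s) (Suc (2 * n)) 1 = (s (Suc n) = s n)"
    unfolding norm_shift_def e by (simp del: mult_Suc_right)
  have 2: "norm_shift (tm_subst s) (Suc (2 * n)) 2 = (s (Suc n) \<noteq> s n)"
    unfolding norm_shift_def e by (simp del: mult_Suc_right)
  have y: "\<not> tm_subst x 0" "tm_subst x 1" "tm_subst x 2"
    using x by (simp_all add: tm_subst_def)
  show ?thesis
  proof (cases "s (Suc n) = s n")
    case True
    show ?thesis
    proof (rule lex_lessI[of 2])
      fix i :: nat assume "i < 2"
      then have "i = 0 \<or> i = 1" by auto
      then show "norm_shift (tm_subst s) (Suc (2 * n)) i = tm_subst x i" using True 1 y by auto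
    qed (use True 2 y in auto)
  next
    case False
    show ?thesis
    proof (rule lex_lessI[of 1])
      fix i :: nat assume "i < 1"
      then show "norm_shift (tm_subst s) (Suc (2 * n)) i = tm_subst x i" using y by auto
    qed (use False 1 y in auto)
  qed
qed

text \<open>
  The substitution is increasing, which settles the tails that start at block boundaries.
\<close>

lemma norm_shift_subst_le:
  assumes "\<And>i. norm_shift s i \<sqsubseteq> x" "\<not> x 0" "x 1"
  shows "norm_shift (tm_subst s) i \<sqsubseteq> tm_subst x"
proof (cases "even i")
  case True
  then obtain n where "i = 2 * n" by blast
  then show ?thesis using tm_subst_mono_le[OF assms(1)] by (simp add: norm_shift_subst_even)
next
  case False
  then obtain n where "i = Suc (2 * n)" using oddE by fastforce
  then show ?thesis using norm_shift_subst_odd[OF assms(2,3)] by (simp add: lex_le_def)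
qed

text \<open>
  The period doubling words: constant, then of period 01, 0110, 01101001, and so on.
\<close>

definition per :: "nat \<Rightarrow> nat \<Rightarrow> bool" where
  "per k = (tm_subst ^^ k) (\<lambda>_. False)"

text \<open>
  The largest word that starts with False.
\<close>

definition word01 :: "nat \<Rightarrow> bool" where "word01 i \<longleftrightarrow> 0 < i"

lemma tm_subst_pow_01: "\<not> x 0 \<Longrightarrow> x 1 \<Longrightarrow> \<not> (tm_subst ^^ k) x 0 \<and> (tm_subst ^^ k) x 1"
proof (cases k)
  case (Suc m)
  have less: "(1 :: nat) < 2 ^ k" by (rule one_less_power) (use Suc in auto)
  have "1 div 2 ^ k = (0 :: nat)" "1 mod 2 ^ k = (1 :: nat)"
    using div_less[OF less] mod_less[OF less] by blast+
  moreover assume "\<not> x 0"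
  ultimately show ?thesis using tm_subst_pow[of k x 0] tm_subst_pow[of k x 1] tm_values by simp
qed simp

text \<open>
  Every word that starts with 0 is bounded by 0111..., and substitution preserves bounds of this kind.  The images of
  0111... tend to the Thue-Morse word, which makes the set of admissible sequences large below the critical base.
\<close>

lemma norm_shift_subst_pow_le: "norm_shift ((tm_subst ^^ k) s) i \<sqsubseteq> (tm_subst ^^ k) word01"
proof (induction k arbitrary: i)
  case 0
  show ?case
  proof (cases "norm_shift s i = word01")
    case False
    then obtain j where j: "norm_shift s i j \<noteq> word01 j" by auto
    define n where "n = (LEAST j. norm_shift s i j \<noteq> word01 j)"
    have n: "norm_shift s i n \<noteq> word01 n" using j unfolding n_def by (rule LeastI)
    have "\<And>j. j < n \<Longrightarrow> norm_shift s i j = word01 j" unfolding n_def using not_less_Least by blast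
    moreover have "n > 0" using n by (cases n) (auto simp: word01_def)
    then have "word01 n" by (simp add: word01_def)
    ultimately have "norm_shift s i \<sqsubset> word01" using n by (intro lex_lessI[of n]) auto
    then show ?thesis by (simp add: lex_le_def)
  qed (simp add: lex_le_def)
next
  case (Suc k)
  have "\<not> word01 0" "word01 1" by (simp_all add: word01_def)
  then show ?case using norm_shift_subst_le[OF Suc] tm_subst_pow_01[of word01 k] by simp
qed

text \<open>
  The induction starts at the word of period 01, because the bound at positions inside a block needs a word that starts with 01.
\<close>

lemma norm_shift_per_le: "norm_shift (per k) i \<sqsubseteq> per k"
proof (cases k)
  case 0
  then show ?thesis by (auto simp: per_def norm_shift_def lex_le_def)
next
  case (Suc k)
  have "norm_shift (per (Suc k)) i \<sqsubseteq> per (Suc k)"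
  proof (induction k arbitrary: i)
    case 0
    have "per (Suc 0) = odd" by (rule ext) (simp add: per_def tm_subst_def)
    then show ?case by (cases "even i") (auto simp: norm_shift_def lex_le_def)
  next
    case (Suc k)
    have "per (Suc k) = (tm_subst ^^ k) odd"
    proof -
      have "tm_subst (\<lambda>_. False) = odd" by (rule ext) (simp add: tm_subst_def)
      then show ?thesis unfolding per_def funpow_Suc_right comp_def by simp
    qed
    then have "\<not> per (Suc k) 0" "per (Suc k) 1" using tm_subst_pow_01[of odd k] by auto
    then have "norm_shift (tm_subst (per (Suc k))) i \<sqsubseteq> tm_subst (per (Suc k))"
      by (intro norm_shift_subst_le Suc)
    then show ?case by (simp add: per_def)
  qed
  then show ?thesis using Suc by simp
qed

lemma norm_shift_tm_less: "0 < i \<Longrightarrow> norm_shift tm i \<sqsubset> tm"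
proof (induction i rule: less_induct)
  case (less i)
  show ?case
  proof (cases "even i")
    case True
    then obtain n where n: "i = 2 * n" by blast
    then have "norm_shift tm n \<sqsubset> tm" using less by auto
    then show ?thesis using tm_subst_mono[of "norm_shift tm n" tm] n norm_shift_subst_even[of tm n] tm_subst_tm by simp
  next
    case False
    then obtain n where "i = Suc (2 * n)" using oddE by fastforce
    then show ?thesis using norm_shift_subst_odd[of tm tm n] tm_subst_tm tm_values by simp
  qed
qed

lemma per_less_tm: "per k \<sqsubset> tm"
proof -
  have "(\<lambda>_. False) \<sqsubset> tm" by (rule lex_lessI[of 1]) (auto simp: tm_values)
  from tm_subst_pow_mono[OF this, of k] show ?thesis by (simp add: per_def tm_subst_pow_tm)
qed

lemma per_less_Suc: "per k \<sqsubset> per (Suc k)"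
proof -
  have "(\<lambda>_. False) \<sqsubset> tm_subst (\<lambda>_. False)" by (rule lex_lessI[of 1]) (auto simp: tm_subst_def)
  from tm_subst_pow_mono[OF this, of k] show ?thesis by (simp add: per_def funpow_swap1)
qed

lemma per_prefix: "i < 2 ^ k \<Longrightarrow> per k i = tm i"
  by (simp add: per_def tm_subst_pow)

lemma tm_subst_pow_prefix: "i < 2 ^ k \<Longrightarrow> norm_shift ((tm_subst ^^ k) s) 0 i = tm i"
  by (auto simp: tm_subst_pow norm_shift_def)

definition tm_bounded :: "(nat \<Rightarrow> bool) \<Rightarrow> bool" where
  "tm_bounded s \<longleftrightarrow> (\<forall>i. norm_shift s i \<sqsubset> tm)"

lemma tm_bounded_shift: "tm_bounded s \<Longrightarrow> tm_bounded (\<lambda>i. s (N + i))"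
  by (simp add: tm_bounded_def norm_shift_add)

lemma tm_bounded_subst: "tm_bounded (tm_subst s) \<Longrightarrow> tm_bounded s"
  unfolding tm_bounded_def
  by (metis norm_shift_subst_even tm_subst_mono_iff tm_subst_tm)

text \<open>
  The Thue-Morse word starts with 0110100.  Once the letter has changed, comparison with this prefix excludes a
  letter that occurs three times in a row, and it shows that two consecutive repetitions of a letter end 2 or 4 positions apart.
  So all repetitions straddle the boundaries of one partition into pairs of different letters.
\<close>

lemma tm_bounded_desubst:
  assumes G: "tm_bounded s"
  shows "(\<forall>i. s i = s 0) \<or> (\<exists>N s'. \<forall>i. s (N + i) = tm_subst s' i)"
proof (rule disjCI)
  assume no: "\<nexists>N s'. \<forall>i. s (N + i) = tm_subst s' i"
  have pre: "\<not> norm_shift s i m" if "\<forall>j<m. norm_shift s i j = tm j" "\<not> tm m" for i m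
    using lex_less_prefix[of "norm_shift s i" tm m] G that by (auto simp: tm_bounded_def)
  show "\<forall>i. s i = s 0"
  proof (rule ccontr)
    assume "\<not> (\<forall>i. s i = s 0)"
    then obtain b where "s b \<noteq> s (b - 1)" "b > 0"
    proof -
      assume a: "\<And>b. s b \<noteq> s (b - 1) \<Longrightarrow> b > 0 \<Longrightarrow> thesis"
      have "\<exists>b. s b \<noteq> s (b - 1) \<and> b > 0"
      proof (rule ccontr)
        assume c: "\<not> ?thesis"
        have "s (Suc i) = s i" for i using c by (metis diff_Suc_1 zero_less_Suc)
        then have "s i = s 0" for i by (induction i) auto
        then show False using \<open>\<not> (\<forall>i. s i = s 0)\<close> by blast
      qed
      then show ?thesis using a by blast
    qed
    define a where "a = b - 1"
    have a: "s (Suc a) \<noteq> s a" using \<open>s b \<noteq> s (b - 1)\<close> \<open>b > 0\<close> by (simp add: a_def)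
    have p3: "s (i + 3) = s i" if "s (i + 1) \<noteq> s i" "s (i + 2) \<noteq> s i" for i
      using pre[of 3 i] that tm_values
      by (auto simp: norm_shift_def All_less_Suc eval_nat_numeral)
    have p5: "s (i + 5) = s i"
      if "s (i + 1) \<noteq> s i" "s (i + 2) \<noteq> s i" "s (i + 3) = s i" "s (i + 4) \<noteq> s i" for i
      using pre[of 5 i] that tm_values
      by (auto simp: norm_shift_def All_less_Suc eval_nat_numeral)
    have p6: "s (i + 6) = s i"
      if "s (i + 1) \<noteq> s i" "s (i + 2) \<noteq> s i" "s (i + 3) = s i" "s (i + 4) \<noteq> s i" "s (i + 5) = s i" for i
      using pre[of 6 i] that tm_values
      by (auto simp: norm_shift_def All_less_Suc eval_nat_numeral)
    show False
    proof (cases "\<exists>n>a. s n = s (Suc n)")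
      case False
      have "s (Suc a + i) = tm_subst (\<lambda>_. s (Suc a)) i" for i
      proof (induction i)
        case (Suc i)
        have "s n \<noteq> s (Suc n)" if "a < n" for n using False that by blast
        from this[of "Suc a + i"] have "s (Suc (Suc a + i)) \<noteq> s (Suc a + i)" by simp
        then show ?case using Suc by (auto simp: tm_subst_def)
      qed (simp add: tm_subst_def)
      then show False using no by blast
    next
      case True
      define n where "n = (LEAST n. a < n \<and> s n = s (Suc n))"
      have n: "a < n" "s n = s (Suc n)" using LeastI_ex[of "\<lambda>n. a < n \<and> s n = s (Suc n)"] True
        by (auto simp: n_def)
      have n1: "s (n - 1) \<noteq> s n"
      proof (cases "n = Suc a")
        case False
        then have "\<not> (a < n - 1 \<and> s (n - 1) = s (Suc (n - 1)))"
          using n not_less_Least[of "n - 1" "\<lambda>n. a < n \<and> s n = s (Suc n)"] by (auto simp: n_def)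
        then show ?thesis using n False by auto
      qed (use a in auto)
      define m where "m = n - 1"
      have m: "s (m + 1) \<noteq> s m" "s (m + 2) \<noteq> s m" using n n1 by (auto simp: m_def)
      \<comment> \<open>A: a repetition ends at p + 2.  B: one ends at p + 2 and none ends at p + 4, so that the next one ends at p + 6.\<close>
      define A where "A p \<longleftrightarrow> s (p + 1) \<noteq> s p \<and> s (p + 2) \<noteq> s p" for p
      define B where "B p \<longleftrightarrow> A p \<and> s (p + 3) = s p \<and> s (p + 4) \<noteq> s p" for p
      have stepA: "s (p + 3) \<noteq> s (p + 2) \<and> (A (p + 2) \<or> B p)" if "A p" for p
        using p3[of p] that by (auto simp: A_def B_def eval_nat_numeral)
      have stepB: "s (p + 5) \<noteq> s (p + 4) \<and> A (p + 4)" if "B p" for p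
        using p5[of p] p6[of p] that by (auto simp: A_def B_def eval_nat_numeral)
      have inv: "A (m + 2 * j) \<or> (j > 0 \<and> B (m + 2 * (j - 1)))" for j
      proof (induction j)
        case 0
        then show ?case using m by (simp add: A_def)
      next
        case (Suc j)
        then show ?case
        proof
          assume "A (m + 2 * j)"
          then show ?thesis using stepA[of "m + 2 * j"] by (auto simp: eval_nat_numeral)
        next
          assume h: "0 < j \<and> B (m + 2 * (j - 1))"
          then have "m + 2 * (j - 1) + 4 = m + 2 * Suc j" by auto
          then show ?thesis using stepB[of "m + 2 * (j - 1)"] h by metis
        qed
      qed
      have pair: "s (m + 2 * j + 3) \<noteq> s (m + 2 * j + 2)" for j
        using inv[of j]
      proof
        assume h: "0 < j \<and> B (m + 2 * (j - 1))"
        then have "m + 2 * (j - 1) + 4 = m + 2 * j + 2" "m + 2 * (j - 1) + 5 = m + 2 * j + 3" by auto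
        then show ?thesis using stepB[of "m + 2 * (j - 1)"] h by metis
      qed (use stepA in auto)
      have "s ((m + 2) + i) = tm_subst (\<lambda>j. s (m + 2 * j + 2)) i" for i
      proof (cases "even i")
        case True
        then obtain j where "i = 2 * j" by blast
        then show ?thesis by (simp add: add_ac)
      next
        case False
        then obtain j where j: "i = Suc (2 * j)" using oddE by fastforce
        then have "m + 2 + i = m + 2 * j + 3" by simp
        moreover have "tm_subst (\<lambda>j. s (m + 2 * j + 2)) i = (\<not> s (m + 2 * j + 2))"
          unfolding j by (rule tm_subst_odd)
        ultimately show ?thesis using pair[of j] by metis
      qed
      then show False using no by blast
    qed
  qed
qed

lemma renormalize:
  assumes "tm_bounded s"
  shows "(\<exists>j N c. \<forall>i. s (N + i) = (tm_subst ^^ j) (\<lambda>_. c) i) \<or>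
         (\<forall>k. \<exists>N s'. \<forall>i. s (N + i) = (tm_subst ^^ k) s' i)"
proof (rule disjCI)
  assume inf: "\<not> (\<forall>k. \<exists>N s'. \<forall>i. s (N + i) = (tm_subst ^^ k) s' i)"
  show "\<exists>j N c. \<forall>i. s (N + i) = (tm_subst ^^ j) (\<lambda>_. c) i"
  proof (rule ccontr)
    assume fin: "\<nexists>j N c. \<forall>i. s (N + i) = (tm_subst ^^ j) (\<lambda>_. c) i"
    have "\<exists>N s'. tm_bounded s' \<and> (\<forall>i. s (N + i) = (tm_subst ^^ k) s' i)" for k
    proof (induction k)
      case 0
      then show ?case using assms by (intro exI[of _ 0] exI[of _ s]) auto
    next
      case (Suc k)
      then obtain N s' where s': "tm_bounded s'" "\<And>i. s (N + i) = (tm_subst ^^ k) s' i" by blast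
      have "\<not> (\<forall>i. s' i = s' 0)"
      proof
        assume "\<forall>i. s' i = s' 0"
        then have "s' = (\<lambda>_. s' 0)" by auto
        then show False using fin s'(2) by metis
      qed
      then obtain N' s'' where s'': "\<And>i. s' (N' + i) = tm_subst s'' i"
        using tm_bounded_desubst[OF s'(1)] by blast
      then have *: "(\<lambda>i. s' (N' + i)) = tm_subst s''" by auto
      have "tm_bounded s''" using tm_bounded_shift[OF s'(1), of N'] tm_bounded_subst * by simp
      moreover have "s ((N + 2 ^ k * N') + i) = (tm_subst ^^ Suc k) s'' i" for i
        using s'(2)[of "2 ^ k * N' + i"] by (simp add: tm_subst_pow_shift * add.assoc funpow_swap1)
      ultimately show ?case by blast
    qed
    then show False using inf by blast
  qed
qed

section \<open>Frequency of repeated letters\<close>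

definition repeats :: "(nat \<Rightarrow> bool) \<Rightarrow> nat \<Rightarrow> nat" where
  "repeats s n = (\<Sum>i<n. of_bool (s (Suc i) = s i))"

text \<open>
  The error is kept linear plus bounded, with explicit slope, instead of passing to a limit: in this form the statement
  survives shifts and substitution, and for sequences that can be desubstituted forever the slope tends to 0.
\<close>

definition freq_near :: "(nat \<Rightarrow> bool) \<Rightarrow> real \<Rightarrow> real \<Rightarrow> bool" where
  "freq_near s c \<epsilon> \<longleftrightarrow> (\<exists>B. \<forall>n. \<bar>real (repeats s n) - c * n\<bar> \<le> \<epsilon> * n + B)"

lemma repeats_le: "repeats s n \<le> n"
  by (induction n) (auto simp: repeats_def)

lemma repeats_subst: "repeats (tm_subst s) (2 * n) + repeats s n = n"
  and repeats_subst': "repeats (tm_subst s) (Suc (2 * n)) = repeats (tm_subst s) (2 * n)"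
proof -
  have e: "Suc (Suc (2 * n)) = 2 * Suc n" for n by simp
  show "repeats (tm_subst s) (2 * n) + repeats s n = n"
  proof (induction n)
    case (Suc n)
    have "repeats (tm_subst s) (2 * Suc n) =
        repeats (tm_subst s) (2 * n) + of_bool (s (Suc n) \<noteq> s n)"
      unfolding e[symmetric] repeats_def sum.lessThan_Suc unfolding e
      by (simp del: mult_Suc_right)
    moreover have "repeats s (Suc n) = repeats s n + of_bool (s (Suc n) = s n)"
      by (simp add: repeats_def)
    ultimately show ?case using Suc by (auto simp: of_bool_def split: if_splits)
  qed (simp add: repeats_def)
  show "repeats (tm_subst s) (Suc (2 * n)) = repeats (tm_subst s) (2 * n)"
    by (simp add: repeats_def)
qed

text \<open>
  The two letters of a block differ, so repetitions occur only across block boundaries, and there exactly where the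
  original sequence does not repeat its letter.
\<close>

lemma freq_near_subst:
  assumes "freq_near s c \<epsilon>"
  shows "freq_near (tm_subst s) ((1 - c) / 2) (\<epsilon> / 2)"
proof -
  obtain B where B: "\<And>n. \<bar>real (repeats s n) - c * n\<bar> \<le> \<epsilon> * n + B"
    using assms by (auto simp: freq_near_def)
  have ev: "\<bar>real (repeats (tm_subst s) (2 * n)) - (1 - c) * n\<bar> \<le> \<epsilon> * n + B" for n
  proof -
    have "real (repeats (tm_subst s) (2 * n)) = n - real (repeats s n)"
      using repeats_subst[of s n] by linarith
    then show ?thesis using B[of n] by (simp add: algebra_simps abs_minus_commute)
  qed
  have "\<bar>real (repeats (tm_subst s) n) - (1 - c) / 2 * n\<bar> \<le> \<epsilon> / 2 * n
      + (\<bar>B\<bar> + \<bar>c\<bar> + 1 + \<bar>\<epsilon>\<bar>)" for n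
  proof (cases "even n")
    case True
    then obtain m where m: "n = 2 * m" by blast
    then have "(1 - c) / 2 * n = (1 - c) * m" "\<epsilon> / 2 * n = \<epsilon> * m" by simp_all
    then show ?thesis using ev[of m] m by simp
  next
    case False
    then obtain m where m: "n = Suc (2 * m)" using oddE by fastforce
    then have eq: "(1 - c) / 2 * n = (1 - c) * m + (1 - c) / 2" "\<epsilon> / 2 * n = \<epsilon> * m + \<epsilon> / 2"
      by (simp_all add: field_simps)
    have "\<bar>real (repeats (tm_subst s) n) - (1 - c) * m\<bar> \<le> \<epsilon> * m + B"
      using ev[of m] repeats_subst'[of s m] unfolding m by simp
    moreover have "\<bar>R - (X + y)\<bar> \<le> E + e / 2 + (\<bar>B\<bar> + \<bar>c\<bar> + 1 + \<bar>e\<bar>)"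
      if "\<bar>R - X\<bar> \<le> E + B" "\<bar>y\<bar> \<le> \<bar>c\<bar> + 1" for R X E y e :: real
    proof -
      have "\<bar>R - (X + y)\<bar> \<le> \<bar>R - X\<bar> + \<bar>y\<bar>" "- (e / 2) \<le> \<bar>e\<bar>" "B \<le> \<bar>B\<bar>" by linarith+
      then show ?thesis using that by linarith
    qed
    moreover have "\<bar>(1 - c) / 2\<bar> \<le> \<bar>c\<bar> + 1" by (auto simp: abs_if field_simps)
    ultimately show ?thesis unfolding eq by blast
  qed
  then show ?thesis unfolding freq_near_def by blast
qed

text \<open>
  The map c -> (1 - c)/2 contracts to its fixed point 1/3.
\<close>

lemma freq_near_subst_pow:
  assumes "freq_near s c \<epsilon>"
  shows "freq_near ((tm_subst ^^ k) s) (1 / 3 + (- 1 / 2) ^ k * (c - 1 / 3)) (\<epsilon> / 2 ^ k)"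
proof (induction k)
  case (Suc k)
  have "(1 - (1 / 3 + (- 1 / 2) ^ k * (c - 1 / 3))) / 2 = 1 / 3 + (- 1 / 2) ^ Suc k * (c - 1 / 3)"
    by (simp add: field_simps)
  then show ?case using freq_near_subst[OF Suc] by (simp add: field_simps)
qed (use assms in simp)

lemma freq_near_shift:
  assumes "freq_near (\<lambda>i. s (N + i)) c \<epsilon>" "\<epsilon> \<ge> 0"
  shows "freq_near s c \<epsilon>"
proof -
  obtain B where B: "\<And>n. \<bar>real (repeats (\<lambda>i. s (N + i)) n) - c * n\<bar> \<le> \<epsilon> * n + B"
    using assms by (auto simp: freq_near_def)
  have split: "repeats s (N + n) = repeats s N + repeats (\<lambda>i. s (N + i)) n" for n
    by (induction n) (auto simp: repeats_def)
  have "\<bar>real (repeats s n) - c * n\<bar> \<le> \<epsilon> * n + (\<bar>B\<bar> + N + \<bar>c\<bar> * N)" for n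
  proof (cases "n \<ge> N")
    case True
    then obtain m where m: "n = N + m" using le_Suc_ex by blast
    have "\<bar>real (repeats s n) - c * n\<bar> =
        \<bar>(real (repeats (\<lambda>i. s (N + i)) m) - c * m) + real (repeats s N) - c * N\<bar>"
      unfolding m split by (simp add: algebra_simps)
    also have "\<dots> \<le> (\<epsilon> * m + B) + N + \<bar>c\<bar> * N"
      using B[of m] repeats_le[of s N] abs_mult[of c N] abs_ge_self[of "c*N"] by linarith
    also have "\<dots> \<le> \<epsilon> * n + (\<bar>B\<bar> + N + \<bar>c\<bar> * N)"
    proof -
      have "\<epsilon> * n = \<epsilon> * m + \<epsilon> * N" "0 \<le> \<epsilon> * N" using m assms(2) by (simp_all add: algebra_simps)
      then show ?thesis using abs_ge_self[of B] by linarith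
    qed
    finally show ?thesis .
  next
    case False
    have "\<bar>real (repeats s n) - c * n\<bar> \<le> real (repeats s n) + \<bar>c * n\<bar>" by linarith
    also have "\<dots> \<le> N + \<bar>c\<bar> * N"
      using repeats_le[of s n] False by (auto simp: abs_mult intro!: add_mono mult_left_mono)
    also have "\<dots> \<le> \<epsilon> * n + (\<bar>B\<bar> + N + \<bar>c\<bar> * N)" using assms(2) by simp
    finally show ?thesis .
  qed
  then show ?thesis unfolding freq_near_def by blast
qed

lemma freq_near_const: "freq_near (\<lambda>_. c) 1 0"
  unfolding freq_near_def by (rule exI[of _ 0]) (simp add: repeats_def)

lemma freq_near_trivial: "freq_near s (1 / 3) (2 / 3)"
proof -
  have "\<bar>real (repeats s n) - 1 / 3 * n\<bar> \<le> 2 / 3 * n + 0" for n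
    using repeats_le[of s n] by (auto simp: abs_if)
  then show ?thesis unfolding freq_near_def by blast
qed

lemma freq_limit:
  assumes "\<And>k::nat. freq_near s c (\<epsilon> k)" "\<epsilon> \<longlonglongrightarrow> 0"
  shows "(\<lambda>n. repeats s n / n) \<longlonglongrightarrow> c"
proof (rule LIMSEQ_I)
  fix r :: real assume r: "r > 0"
  obtain k where k: "\<bar>\<epsilon> k\<bar> < r / 2" using LIMSEQ_D[OF assms(2), of "r/2"] r by auto
  obtain B where B: "\<And>n. \<bar>real (repeats s n) - c * n\<bar> \<le> \<epsilon> k * n + B"
    using assms(1)[of k] by (auto simp: freq_near_def)
  obtain N :: nat where N: "N > 2 * \<bar>B\<bar> / r" using reals_Archimedean2 by blast
  show "\<exists>no. \<forall>n\<ge>no. norm (real (repeats s n) / real n - c) < r"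
  proof (intro exI allI impI)
    fix n assume n: "n \<ge> Suc N"
    then have "n > 2 * \<bar>B\<bar> / r" using N by linarith
    then have B2: "B < r / 2 * n" using r by (auto simp: field_simps abs_if split: if_splits)
    have "\<epsilon> k * n \<le> r / 2 * n" using k by (intro mult_right_mono) auto
    then have "\<bar>real (repeats s n) - c * n\<bar> < r * n" using B[of n] B2 by (simp add: field_simps)
    then have "\<bar>real (repeats s n) - c * n\<bar> / n < r" using n by (simp add: field_simps)
    moreover have "real (repeats s n) / real n - c = (real (repeats s n) - c * n) / n"
      using n by (simp add: field_simps)
    ultimately show "norm (real (repeats s n) / real n - c) < r" by simp
  qed
qed


section \<open>Expansions in a small base\<close>

definition digits :: "(nat \<Rightarrow> int) \<Rightarrow> bool" where
  "digits d \<longleftrightarrow> (\<forall>i. d i \<in> {-1, 0, 1})"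

definition val :: "real \<Rightarrow> (nat \<Rightarrow> int) \<Rightarrow> real" where
  "val \<alpha> d = (\<Sum>i. of_int (d i) * \<alpha> ^ Suc i)"

definition wval :: "real \<Rightarrow> (nat \<Rightarrow> bool) \<Rightarrow> real" where
  "wval \<alpha> x = val \<alpha> (\<lambda>i. of_bool (x i))"

lemma digitsD: "digits d \<Longrightarrow> \<bar>d i\<bar> \<le> 1"
  by (auto simp: digits_def dest!: spec[of _ i])

lemma digits_iff: "digits d \<longleftrightarrow> (\<forall>i. \<bar>d i\<bar> \<le> 1)"
  unfolding digits_def by (intro all_cong1) auto

lemma digits_of_bool [simp]: "digits (\<lambda>i. of_bool (x i))"
  by (simp add: digits_iff)

lemma digits_diff_of_bool [simp]: "digits (\<lambda>i. of_bool (x i) - of_bool (y i))"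
  by (simp add: digits_iff)

abbreviation switch_digit :: "(nat \<Rightarrow> bool) \<Rightarrow> nat \<Rightarrow> int" where
  "switch_digit s i \<equiv> of_bool (s (Suc i)) - of_bool (s i)"

lemma digits_shift: "digits d \<Longrightarrow> digits (\<lambda>i. d (f i))"
  by (simp add: digits_iff)

locale base =
  fixes \<alpha> :: real
  assumes pos: "0 < \<alpha>" and less_half: "\<alpha> < 1 / 2"
begin

abbreviation M :: real where "M \<equiv> \<alpha> / (1 - \<alpha>)"

lemma M_pos: "0 < M" and M_less_1: "M < 1"
  using pos less_half by (simp_all add: field_simps)

lemma geo: "(\<lambda>i. \<alpha> ^ Suc i) sums M"
  using sums_mult[OF geometric_sums[of \<alpha>], of \<alpha>] pos less_half by simp

lemma summable_digits: "digits d \<Longrightarrow> summable (\<lambda>i. of_int (d i) * \<alpha> ^ Suc i)"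
proof (rule summable_comparison_test[OF _ sums_summable[OF geo]], intro exI allI impI)
  fix n assume "digits d"
  then have "\<bar>real_of_int (d n)\<bar> \<le> 1" using digitsD[of d n] by linarith
  then show "norm (of_int (d n) * \<alpha> ^ Suc n) \<le> \<alpha> ^ Suc n"
    using pos by (simp add: abs_mult mult_left_le_one_le)
qed

lemma val_sums: "digits d \<Longrightarrow> (\<lambda>i. of_int (d i) * \<alpha> ^ Suc i) sums val \<alpha> d"
  unfolding val_def using summable_digits by (rule summable_sums)

lemma val_bound: assumes "digits d" shows "\<bar>val \<alpha> d\<bar> \<le> M"
proof -
  have a: "\<bar>real_of_int (d i)\<bar> \<le> 1" for i using digitsD[OF assms, of i] by linarith
  have "val \<alpha> d \<le> M"
  proof (rule sums_le[OF _ val_sums[OF assms] geo])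
    fix i have "real_of_int (d i) * \<alpha> ^ Suc i \<le> 1 * \<alpha> ^ Suc i"
      using a[of i] pos by (intro mult_right_mono) auto
    then show "real_of_int (d i) * \<alpha> ^ Suc i \<le> \<alpha> ^ Suc i" by simp
  qed
  moreover have "- M \<le> val \<alpha> d"
  proof (rule sums_le[OF _ sums_minus[OF geo] val_sums[OF assms]])
    fix i have "(- 1) * \<alpha> ^ Suc i \<le> real_of_int (d i) * \<alpha> ^ Suc i"
      using a[of i] pos by (intro mult_right_mono) auto
    then show "- (\<alpha> ^ Suc i) \<le> real_of_int (d i) * \<alpha> ^ Suc i" by simp
  qed
  ultimately show ?thesis by linarith
qed

lemma val_Suc: assumes "digits d" shows "val \<alpha> d = \<alpha> * (of_int (d 0) + val \<alpha> (\<lambda>i. d (Suc i)))"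
proof -
  have "val \<alpha> d = of_int (d 0) * \<alpha> + (\<Sum>i. of_int (d (Suc i)) * \<alpha> ^ Suc (Suc i))"
    unfolding val_def using suminf_split_head[OF summable_digits[OF assms]] by simp
  also have "(\<Sum>i. of_int (d (Suc i)) * \<alpha> ^ Suc (Suc i)) = \<alpha> * val \<alpha> (\<lambda>i. d (Suc i))"
    unfolding val_def
    using suminf_mult[OF summable_digits[OF digits_shift[OF assms, of Suc]], of \<alpha>]
    by (simp add: mult_ac)
  finally show ?thesis by (simp add: algebra_simps)
qed

lemma val_split: "digits d \<Longrightarrow>
  val \<alpha> d = (\<Sum>i<n. of_int (d i) * \<alpha> ^ Suc i) + \<alpha> ^ n * val \<alpha> (\<lambda>i. d (n + i))"
proof (induction n)
  case (Suc n)
  have "val \<alpha> (\<lambda>i. d (n + i)) = \<alpha> * (of_int (d n) + val \<alpha> (\<lambda>i. d (Suc n + i)))"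
    using val_Suc[OF digits_shift[OF Suc.prems, of "\<lambda>i. n + i"]] by simp
  then show ?case using Suc by (simp add: algebra_simps)
qed simp

lemma val_diff: "digits d \<Longrightarrow> digits e \<Longrightarrow> val \<alpha> (\<lambda>i. d i - e i) = val \<alpha> d - val \<alpha> e"
  using sums_unique[OF sums_diff[OF val_sums[of d] val_sums[of e]]]
  by (simp add: val_def left_diff_distrib)

lemma val_mult: "digits d \<Longrightarrow> val \<alpha> (\<lambda>i. c * d i) = of_int c * val \<alpha> d"
  using sums_unique[OF sums_mult[OF val_sums[of d], of "of_int c"]]
  by (simp add: val_def mult.assoc)

lemma is_expansion_iff:
  assumes "A \<subseteq> {-1, 0, 1}"
  shows "is_expansion A \<alpha> x e \<longleftrightarrow> (\<forall>i. e i \<in> A) \<and> val \<alpha> e = x"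
proof (cases "\<forall>i. e i \<in> A")
  case True
  then have "digits e" using assms by (auto simp: digits_def)
  then show ?thesis using True val_sums[of e] sums_unique2 by (auto simp: is_expansion_def)
qed (auto simp: is_expansion_def)

lemma wval_nonneg: "0 \<le> wval \<alpha> x"
  unfolding wval_def val_def using summable_digits[OF digits_of_bool[of x]] pos
  by (intro suminf_nonneg) auto

lemma wval_bound: "wval \<alpha> x \<le> M"
  using val_bound[OF digits_of_bool[of x]] unfolding wval_def by linarith

lemma wval_split:
  "wval \<alpha> x = (\<Sum>i<n. of_bool (x i) * \<alpha> ^ Suc i) + \<alpha> ^ n * wval \<alpha> (\<lambda>i. x (n + i))"
  using val_split[OF digits_of_bool[of x], of n] by (simp add: wval_def)

lemma wval_Suc: "wval \<alpha> x = \<alpha> * (of_bool (x 0) + wval \<alpha> (\<lambda>i. x (Suc i)))"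
  using val_Suc[OF digits_of_bool[of x]] by (simp add: wval_def)

text \<open>
  For a base below 1/2 a digit outweighs all the digits that follow it.
\<close>

lemma wval_gap:
  assumes "\<And>i. i < n \<Longrightarrow> x i = y i" "\<not> x n" "y n"
  shows "\<alpha> ^ Suc n * (1 - M) \<le> wval \<alpha> y - wval \<alpha> x"
proof -
  have eq: "(\<Sum>i<n. of_bool (x i) * \<alpha> ^ Suc i) = (\<Sum>i<n. of_bool (y i) * \<alpha> ^ Suc i)"
    using assms(1) by (intro sum.cong) auto
  define X where "X = wval \<alpha> (\<lambda>i. x (n + Suc i))"
  define Y where "Y = wval \<alpha> (\<lambda>i. y (n + Suc i))"
  have x: "wval \<alpha> (\<lambda>i. x (n + i)) = \<alpha> * X"
    and y: "wval \<alpha> (\<lambda>i. y (n + i)) = \<alpha> * (1 + Y)"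
    using assms wval_Suc[of "\<lambda>i. x (n + i)"] wval_Suc[of "\<lambda>i. y (n + i)"] by (simp_all add: X_def Y_def)
  have "wval \<alpha> y - wval \<alpha> x = \<alpha> ^ n * (\<alpha> * (1 + Y)) - \<alpha> ^ n * (\<alpha> * X)"
    using wval_split[of x n] wval_split[of y n] eq unfolding x y by simp
  also have "\<dots> = \<alpha> ^ Suc n * (1 + Y - X)" by (simp add: algebra_simps)
  also have "\<dots> \<ge> \<alpha> ^ Suc n * (1 - M)"
    using wval_nonneg wval_bound pos unfolding X_def Y_def
    by (intro mult_left_mono) (auto simp: algebra_simps intro: add_increasing2)
  finally show ?thesis .
qed

lemma wval_less: "x \<sqsubset> y \<Longrightarrow> wval \<alpha> x < wval \<alpha> y"
proof -
  assume "x \<sqsubset> y"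
  then obtain n where "\<And>i. i < n \<Longrightarrow> x i = y i" "\<not> x n" "y n" by (auto simp: lex_less_def)
  then have "\<alpha> ^ Suc n * (1 - M) \<le> wval \<alpha> y - wval \<alpha> x" by (rule wval_gap)
  moreover have "0 < \<alpha> ^ Suc n * (1 - M)" using pos M_less_1 by (intro mult_pos_pos) auto
  ultimately show ?thesis by linarith
qed

lemma wval_le: "x \<sqsubseteq> y \<Longrightarrow> wval \<alpha> x \<le> wval \<alpha> y"
  using wval_less by (auto simp: lex_le_def less_imp_le)

lemma lex_less_of_wval: "wval \<alpha> x < wval \<alpha> y \<Longrightarrow> x \<sqsubset> y"
  using lex_less_total[of x y] wval_less[of y x] by fastforce

lemma wval_prefix:
  assumes "\<And>i. i < n \<Longrightarrow> x i = y i"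
  shows "\<bar>wval \<alpha> x - wval \<alpha> y\<bar> \<le> \<alpha> ^ n"
proof -
  have eq: "(\<Sum>i<n. of_bool (x i) * \<alpha> ^ Suc i) = (\<Sum>i<n. of_bool (y i) * \<alpha> ^ Suc i)"
    using assms by (intro sum.cong) auto
  have "\<bar>wval \<alpha> (\<lambda>i. x (n + i)) - wval \<alpha> (\<lambda>i. y (n + i))\<bar> \<le> 1"
    using wval_nonneg[of "\<lambda>i. x (n + i)"] wval_nonneg[of "\<lambda>i. y (n + i)"]
      wval_bound[of "\<lambda>i. x (n + i)"] wval_bound[of "\<lambda>i. y (n + i)"] M_less_1 by linarith
  then have "\<alpha> ^ n * \<bar>wval \<alpha> (\<lambda>i. x (n + i)) - wval \<alpha> (\<lambda>i. y (n + i))\<bar> \<le> \<alpha> ^ n"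
    using pos by (simp add: mult_left_le)
  moreover have "wval \<alpha> x - wval \<alpha> y = \<alpha> ^ n * (wval \<alpha> (\<lambda>i. x (n + i)) - wval \<alpha> (\<lambda>i. y (n + i)))"
    using wval_split[of x n] wval_split[of y n] eq by (simp add: algebra_simps)
  ultimately show ?thesis using pos by (simp add: abs_mult)
qed

lemma val_splice:
  assumes "digits d" "digits e"
  shows "digits (\<lambda>i. if i < n then d i else e (i - n))"
    and "val \<alpha> (\<lambda>i. if i < n then d i else e (i - n)) =
      (\<Sum>i<n. of_int (d i) * \<alpha> ^ Suc i) + \<alpha> ^ n * val \<alpha> e"
proof -
  show dg: "digits (\<lambda>i. if i < n then d i else e (i - n))"
    using assms by (simp add: digits_iff)
  show "val \<alpha> (\<lambda>i. if i < n then d i else e (i - n)) =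
      (\<Sum>i<n. of_int (d i) * \<alpha> ^ Suc i) + \<alpha> ^ n * val \<alpha> e"
    unfolding val_split[OF dg, of n] by simp
qed

end

section \<open>Unique expansions\<close>

text \<open>
  The digit at n can be increased or decreased by 1 exactly if the tail that follows it can
  compensate, and for a base of at least one third every number of modulus at most M is the
  value of some tail.
\<close>

locale overlap_base = base +
  assumes third: "1 / 3 \<le> \<alpha>"
begin

lemma M_ge_half: "1 / 2 \<le> M"
  using third less_half by (simp add: field_simps)

text \<open>
  A greedy expansion: since M is at least 1/2, the intervals of length 2M around -1, 0 and 1 cover all remainders divided by \<alpha>.
\<close>

lemma val_surj:
  assumes "\<bar>r\<bar> \<le> M"
  shows "\<exists>d. digits d \<and> val \<alpha> d = r"
proof -
  define dg :: "real \<Rightarrow> int" where "dg r = (if r / \<alpha> > M then 1 else if r / \<alpha> < - M then -1 else 0)" for r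
  define nx where "nx r = r / \<alpha> - of_int (dg r)" for r
  define R where "R n = (nx ^^ n) r" for n
  define d where "d n = dg (R n)" for n
  have dig: "digits d" by (auto simp: digits_iff d_def dg_def)
  have nx_M: "\<bar>nx r\<bar> \<le> M" if "\<bar>r\<bar> \<le> M" for r
  proof -
    have "\<bar>r / \<alpha>\<bar> = \<bar>r\<bar> / \<alpha>" using pos by simp
    also have "\<dots> \<le> M / \<alpha>" by (intro divide_right_mono that less_imp_le pos)
    also have "M / \<alpha> = 1 + M" using pos less_half by (simp add: field_simps)
    finally have "\<bar>r / \<alpha>\<bar> \<le> 1 + M" .
    moreover have "\<bar>x - of_int (if x > m then 1 else if x < - m then -1 else 0)\<bar> \<le> m"
      if "\<bar>x\<bar> \<le> 1 + m" "1 / 2 \<le> m" for x m :: real using that by auto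
    ultimately show ?thesis unfolding nx_def dg_def using M_ge_half by blast
  qed
  have R: "\<bar>R n\<bar> \<le> M" for n
    by (induction n) (use assms nx_M in \<open>auto simp: R_def\<close>)
  have step: "R n = \<alpha> * (of_int (d n) + R (Suc n))" for n
    using pos by (simp add: R_def d_def nx_def field_simps)
  have part: "r = (\<Sum>i<n. of_int (d i) * \<alpha> ^ Suc i) + \<alpha> ^ n * R n" for n
  proof (induction n)
    case (Suc n)
    then show ?case using step[of n] by (simp add: algebra_simps)
  qed (simp add: R_def)
  have "\<bar>r - val \<alpha> d\<bar> \<le> \<alpha> ^ n * (2 * M)" for n
  proof -
    have "r - val \<alpha> d = \<alpha> ^ n * (R n - val \<alpha> (\<lambda>i. d (n + i)))"
      using part[of n] val_split[OF dig, of n] by (simp add: algebra_simps)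
    moreover have "\<bar>R n - val \<alpha> (\<lambda>i. d (n + i))\<bar> \<le> 2 * M"
      using R[of n] val_bound[OF digits_shift[OF dig, of "\<lambda>i. n + i"]] by linarith
    then have "\<alpha> ^ n * \<bar>R n - val \<alpha> (\<lambda>i. d (n + i))\<bar> \<le> \<alpha> ^ n * (2 * M)"
      using pos by (intro mult_left_mono) auto
    ultimately show ?thesis using pos by (simp only: abs_mult power_abs abs_of_pos)
  qed
  moreover have "(\<lambda>n. \<alpha> ^ n * (2 * M)) \<longlonglongrightarrow> 0 * (2 * M)"
    using pos less_half by (intro tendsto_intros LIMSEQ_realpow_zero) auto
  ultimately have "\<bar>r - val \<alpha> d\<bar> \<le> 0"
    using LIMSEQ_le_const[of "\<lambda>n. \<alpha> ^ n * (2 * M)" 0 "\<bar>r - val \<alpha> d\<bar>"] by auto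
  then show ?thesis using dig by auto
qed

text \<open>
  No digit can be moved by one step in the direction c and compensated by the tail that follows it.
\<close>

definition tails_small :: "(nat \<Rightarrow> int) \<Rightarrow> bool" where
  "tails_small t \<longleftrightarrow> (\<forall>n. \<forall>c\<in>{-1, 1}. t n \<noteq> c \<longrightarrow> of_int c * val \<alpha> (\<lambda>i. t (Suc n + i)) < 1 - M)"

lemma unique_expansion_iff:
  assumes t: "digits t"
  shows "(\<exists>!e. is_expansion {-1, 0, 1} \<alpha> (val \<alpha> t) e) \<longleftrightarrow> tails_small t"
proof
  assume uniq: "\<exists>!e. is_expansion {-1, 0, 1} \<alpha> (val \<alpha> t) e"
  have ex: "is_expansion {-1, 0, 1} \<alpha> (val \<alpha> t) e \<longleftrightarrow> digits e \<and> val \<alpha> e = val \<alpha> t" for e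
    by (simp add: is_expansion_iff digits_def)
  show "tails_small t"
    unfolding tails_small_def
  proof (intro allI ballI impI, rule ccontr)
    fix n and c :: int
    assume c: "c \<in> {-1, 1}" "t n \<noteq> c"
    define r where "r = val \<alpha> (\<lambda>i. t (Suc n + i))"
    assume "\<not> of_int c * val \<alpha> (\<lambda>i. t (Suc n + i)) < 1 - M"
    then have "1 - M \<le> of_int c * r" by (simp add: r_def)
    moreover have "\<bar>r\<bar> \<le> M" unfolding r_def by (rule val_bound[OF digits_shift[OF t]])
    moreover have "\<bar>r - of_int c\<bar> \<le> m" if "1 - m \<le> of_int c * r" "\<bar>r\<bar> \<le> m" "m < 1" for m
      using c that by auto
    ultimately have "\<bar>r - of_int c\<bar> \<le> M" using M_less_1 by blast
    from val_surj[OF this] obtain e where e: "digits e" "val \<alpha> e = r - of_int c" by auto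
    define t' where "t' = t(n := t n + c)"
    have tn: "\<bar>t n\<bar> \<le> 1" using digitsD[OF t] .
    have "\<bar>t n + c\<bar> \<le> 1" using c tn by auto
    then have t': "digits t'" using t by (simp add: t'_def digits_iff)
    define u where "u = (\<lambda>i. if i < Suc n then t' i else e (i - Suc n))"
    have u: "digits u" unfolding u_def by (rule val_splice(1)[OF t' e(1)])
    have "(\<Sum>i<n. of_int (t' i) * \<alpha> ^ Suc i) = (\<Sum>i<n. of_int (t i) * \<alpha> ^ Suc i)"
      by (intro sum.cong) (auto simp: t'_def)
    then have "val \<alpha> u = (\<Sum>i<Suc n. of_int (t i) * \<alpha> ^ Suc i) + \<alpha> ^ Suc n * r"
      unfolding u_def val_splice(2)[OF t' e(1)] e(2) by (simp add: t'_def algebra_simps)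
    also have "\<dots> = val \<alpha> t" unfolding r_def by (rule val_split[OF t, symmetric])
    finally have "u = t" using uniq t u unfolding ex by blast
    then have "u n = t n" by simp
    then show False using c by (simp add: u_def t'_def)
  qed
next
  assume small: "tails_small t"
  show "\<exists>!e. is_expansion {-1, 0, 1} \<alpha> (val \<alpha> t) e"
  proof (rule ex1I)
    show "is_expansion {-1, 0, 1} \<alpha> (val \<alpha> t) t"
      using t by (simp add: is_expansion_iff digits_def)
    fix e assume "is_expansion {-1, 0, 1} \<alpha> (val \<alpha> t) e"
    then have e: "digits e" "val \<alpha> e = val \<alpha> t" by (simp_all add: is_expansion_iff digits_def)
    show "e = t"
    proof (rule ccontr)
      assume "e \<noteq> t"
      then have ex: "\<exists>n. e n \<noteq> t n" by auto
      define n where "n = (LEAST n. e n \<noteq> t n)"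
      have n: "e n \<noteq> t n" unfolding n_def using ex by (rule LeastI_ex)
      have "\<And>i. i < n \<Longrightarrow> e i = t i" unfolding n_def using not_less_Least by blast
      then have eq: "(\<Sum>i<n. of_int (e i) * \<alpha> ^ Suc i) = (\<Sum>i<n. of_int (t i) * \<alpha> ^ Suc i)"
        by (intro sum.cong) auto
      define r where "r = val \<alpha> (\<lambda>i. t (Suc n + i))"
      define r' where "r' = val \<alpha> (\<lambda>i. e (Suc n + i))"
      have "of_int (e n) * \<alpha> ^ Suc n + \<alpha> ^ Suc n * r' = of_int (t n) * \<alpha> ^ Suc n + \<alpha> ^ Suc n * r"
        using val_split[OF t, of "Suc n"] val_split[OF e(1), of "Suc n"] e(2) eq
        by (simp add: r_def r'_def)
      then have "\<alpha> ^ Suc n * (of_int (e n) + r') = \<alpha> ^ Suc n * (of_int (t n) + r)"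
        by (simp only: distrib_left mult.commute[of _ "\<alpha> ^ Suc n"])
      then have *: "of_int (e n) + r' = of_int (t n) + r" using pos by simp
      have r': "\<bar>r'\<bar> \<le> M" unfolding r'_def by (rule val_bound[OF digits_shift[OF e(1)]])
      define c where "c = sgn (e n - t n)"
      have c: "c \<in> {-1, 1}" using n by (auto simp: c_def sgn_if)
      have tc: "t n \<noteq> c" using digitsD[OF e(1), of n] n by (auto simp: c_def sgn_if split: if_splits)
      have "of_int c * r < 1 - M" using small c tc by (auto simp: tails_small_def r_def)
      moreover have "1 \<le> c * (e n - t n)" using n by (auto simp: c_def sgn_if)
      then have "1 \<le> real_of_int c * (of_int (e n) - of_int (t n))"
        by (metis of_int_1_le_iff of_int_diff of_int_mult)
      moreover have "of_int c * r = of_int c * (of_int (e n) - of_int (t n)) + of_int c * r'"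
      proof -
        have "r = (of_int (e n) - of_int (t n)) + r'" using * by linarith
        then show ?thesis by (metis distrib_left)
      qed
      moreover have "- m \<le> of_int c * r'" if "\<bar>r'\<bar> \<le> m" for m using c that by auto
      from this[OF r'] have "- M \<le> of_int c * r'" .
      ultimately show False by linarith
    qed
  qed
qed

text \<open>
  For a difference sequence the tail bound 1 - M becomes a bound on the value of the normalized tail of the
  binary sequence; this is the resulting number.  The orbit of the binary sequence avoids the interval from it to its
  reflection.
\<close>

definition hole :: real where "hole = (1 - M) * \<alpha> / (1 - \<alpha>)"

text \<open>
  Summation by parts.  The tail has the sign of its first nonzero digit, so only one of the two inequalities in
  the uniqueness criterion is a condition.
\<close>

lemma val_of_switches:
  "val \<alpha> (\<lambda>i. switch_digit s (n + i)) =
     (if s n then -1 else 1) * (wval \<alpha> (norm_shift s n) * (1 - \<alpha>) / \<alpha>)"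
proof -
  define c :: int where "c = (if s n then -1 else 1)"
  have "(\<lambda>i. switch_digit s (n + i) :: int) =
      (\<lambda>i. c * (of_bool (norm_shift s n (Suc i)) - of_bool (norm_shift s n i)))"
    by (rule ext) (auto simp: c_def norm_shift_def)
  then have "val \<alpha> (\<lambda>i. switch_digit s (n + i)) =
      of_int c * (wval \<alpha> (\<lambda>i. norm_shift s n (Suc i)) - wval \<alpha> (norm_shift s n))"
    using val_mult[OF digits_diff_of_bool, of c] val_diff[OF digits_of_bool digits_of_bool]
    by (simp add: wval_def)
  also have "wval \<alpha> (\<lambda>i. norm_shift s n (Suc i)) = wval \<alpha> (norm_shift s n) / \<alpha>"
    using wval_Suc[of "norm_shift s n"] pos by simp
  finally show ?thesis using pos by (cases "s n") (simp_all add: c_def field_simps)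
qed

lemma small_iff: "wval \<alpha> (norm_shift s n) * (1 - \<alpha>) / \<alpha> < 1 - M \<longleftrightarrow> wval \<alpha> (norm_shift s n) < hole"
proof -
  have "w * (1 - \<alpha>) / \<alpha> < K \<longleftrightarrow> w < K * \<alpha> / (1 - \<alpha>)" for w K
    using pos less_half by (simp add: field_simps)
  then show ?thesis unfolding hole_def .
qed

lemma tails_small_switches:
  assumes "\<And>i. wval \<alpha> (norm_shift s (Suc i)) < hole"
  shows "tails_small (\<lambda>i. switch_digit s i)"
  unfolding tails_small_def
proof (intro allI ballI impI)
  fix n and c :: int assume c: "c \<in> {-1, 1}" "of_bool (s (Suc n)) - of_bool (s n) \<noteq> c"
  define w where "w = wval \<alpha> (norm_shift s (Suc n)) * (1 - \<alpha>) / \<alpha>"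
  have "w < 1 - M" "0 \<le> w"
    using assms[of n] small_iff wval_nonneg[of "norm_shift s (Suc n)"] pos less_half by (simp_all add: w_def)
  then show "of_int c * val \<alpha> (\<lambda>i. switch_digit s (Suc n + i)) < 1 - M"
    unfolding val_of_switches w_def[symmetric]
  proof -
    have "of_int c * ((if s (Suc n) then -1 else 1) * w) < m" if "w < m" "0 \<le> w" for m
      using c that by auto
    then show "of_int c * ((if s (Suc n) then -1 else 1) * w) < 1 - M" using \<open>w < 1 - M\<close> \<open>0 \<le> w\<close> .
  qed
qed

lemma tails_small_switchesD:
  assumes "tails_small t" "\<And>i. t (N + i) = switch_digit s i"
  shows "wval \<alpha> (norm_shift s (Suc i)) < hole"
proof -
  define w where "w = wval \<alpha> (norm_shift s (Suc i)) * (1 - \<alpha>) / \<alpha>"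
  define c :: int where "c = (if s (Suc i) then -1 else 1)"
  have "t (N + i) \<noteq> c" using assms(2)[of i] by (auto simp: c_def)
  then have "of_int c * val \<alpha> (\<lambda>j. t (Suc (N + i) + j)) < 1 - M"
    using assms(1) by (auto simp: tails_small_def c_def)
  moreover have "(\<lambda>j. t (Suc (N + i) + j)) =
      (\<lambda>j. switch_digit s (Suc i + j))"
    using assms(2)[of "Suc i + j" for j] by (auto simp: add_ac)
  ultimately have "of_int c * ((if s (Suc i) then -1 else 1) * w) < 1 - M"
    by (simp only: val_of_switches w_def)
  then have "w < 1 - M" by (simp add: c_def split: if_splits)
  then show ?thesis using small_iff by (simp add: w_def)
qed

lemma tails_small_zero: "tails_small (\<lambda>_. 0)"
  using M_less_1 by (auto simp: tails_small_def val_def)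

lemma tails_small_one: "tails_small (\<lambda>_. 1)"
proof -
  have "val \<alpha> (\<lambda>_. 1) = M" using sums_unique[OF geo] by (simp add: val_def)
  then show ?thesis using M_less_1 M_pos by (auto simp: tails_small_def)
qed

lemma negative_value_digit:
  assumes "digits d" "c \<in> {-1, 1}" "of_int c * val \<alpha> d < 0"
  shows "d 0 \<noteq> c"
proof
  assume "d 0 = c"
  then have "of_int c * val \<alpha> d = \<alpha> * (1 + of_int c * val \<alpha> (\<lambda>i. d (Suc i)))"
    using val_Suc[OF assms(1)] assms(2) by (auto simp: algebra_simps)
  moreover have "- M \<le> of_int c * val \<alpha> (\<lambda>i. d (Suc i))"
    using val_bound[OF digits_shift[OF assms(1), of Suc]] assms(2) by auto
  then have "0 < \<alpha> * (1 + of_int c * val \<alpha> (\<lambda>i. d (Suc i)))"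
    using pos M_less_1 by (intro mult_pos_pos) linarith+
  ultimately show False using assms(3) by linarith
qed

text \<open>
  The bound on the base says that a tail of value below 1 - M that starts with the digit 1 is
  negative from its second digit on, so that the next nonzero digit must be -1.  Hence from the
  first switch on the nonzero digits alternate in sign, and t is the sequence of differences of a
  binary sequence.
\<close>

lemma tails_small_cases:
  assumes t: "digits t" "tails_small t" and \<alpha>: "\<alpha>\<^sup>2 - 3 * \<alpha> + 1 < 0"
  obtains (const) c where "c \<in> {-1, 1}" "\<And>i. t i = c"
    | (zero) N where "\<And>i. t (N + i) = 0"
    | (switch) N s where "\<And>i. t (N + i) = switch_digit s i"
proof (cases "\<exists>m. \<exists>c\<in>{-1, 1}. t m \<noteq> c \<and> t (Suc m) = c")
  case False
  show thesis
  proof (cases "\<exists>m. t m = 0")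
    case True
    then obtain m where m: "t m = 0" by blast
    have "t (m + i) = 0" for i
    proof (induction i)
      case (Suc i)
      then show ?case using False t(1) by (auto simp: digits_def) (metis zero_neq_neg_one zero_neq_one)
    qed (use m in simp)
    then show thesis using zero by blast
  next
    case nz: False
    have d: "t i \<in> {-1, 1}" for i using nz t(1) by (auto simp: digits_def)
    have "t i = t 0" for i
    proof (induction i)
      case (Suc i)
      then show ?case using False d[of i] d[of "Suc i"] by metis
    qed simp
    then show thesis using const[of "t 0"] d[of 0] by blast
  qed
next
  case True
  then obtain m and c :: int where m: "c \<in> {-1, 1}" "t m \<noteq> c" "t (Suc m) = c" by blast
  define r where "r n = val \<alpha> (\<lambda>i. t (Suc n + i))" for n
  have r: "r n = \<alpha> * (of_int (t (Suc n)) + r (Suc n))" for n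
    using val_Suc[OF digits_shift[OF t(1), of "\<lambda>i. Suc n + i"]] by (simp add: r_def)
  have M\<alpha>: "1 - M < \<alpha>" using \<alpha> less_half by (simp add: field_simps power2_eq_square)
  have alt: "of_int c * r (Suc n) < 0" if "c \<in> {-1, 1}" "t n \<noteq> c" "t (Suc n) = c" for c n
  proof -
    have "of_int c * r n < 1 - M" using t(2) that by (auto simp: tails_small_def r_def)
    moreover have "of_int c * r n = \<alpha> * (1 + of_int c * r (Suc n))"
      using that r[of n] by (auto simp: algebra_simps)
    ultimately have "\<alpha> * (1 + of_int c * r (Suc n)) < \<alpha> * 1" using M\<alpha> by linarith
    then show ?thesis using pos by (subst (asm) mult_less_cancel_left_pos) auto
  qed
  define s where "s = rec_nat (c = 1) (\<lambda>i b. if t (m + 2 + i) = 0 then b else t (m + 2 + i) = 1)"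
  have s0: "s 0 = (c = 1)" and sS: "s (Suc i) = (if t (m + 2 + i) = 0 then s i else t (m + 2 + i) = 1)" for i
    by (simp_all add: s_def)
  define cc :: "nat \<Rightarrow> int" where "cc i = (if s i then 1 else -1)" for i
  have inv: "of_int (cc i) * r (m + 1 + i) < 0 \<and> t (m + 1 + i) \<noteq> - cc i" for i
  proof (induction i)
    case 0
    have "cc 0 = c" using m(1) by (auto simp: cc_def s0)
    then show ?case using alt[OF m] m by auto
  next
    case (Suc i)
    define d where "d = t (m + 2 + i)"
    have c: "cc i \<in> {-1, 1}" by (simp add: cc_def)
    have d: "d \<in> {-1, 0, 1}" using t(1) by (auto simp: digits_def d_def)
    have rr: "r (m + 1 + i) = \<alpha> * (of_int d + r (m + 1 + Suc i))"
      using r[of "m + 1 + i"] by (simp add: d_def)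
    have "d \<noteq> cc i"
      using negative_value_digit[OF digits_shift[OF t(1), of "\<lambda>j. Suc (m + 1 + i) + j"] c] Suc
      by (auto simp: r_def d_def)
    show ?case
    proof (cases "d = 0")
      case True
      then have "cc (Suc i) = cc i" by (simp add: cc_def sS d_def)
      moreover have "\<alpha> * (of_int (cc i) * r (m + 1 + Suc i)) < 0"
        using Suc rr True by (simp add: algebra_simps)
      then have "of_int (cc i) * r (m + 1 + Suc i) < 0" using pos by (simp add: mult_less_0_iff)
      ultimately show ?thesis using True c by (auto simp: d_def)
    next
      case False
      then have dd: "d = - cc i" using \<open>d \<noteq> cc i\<close> c d by auto
      have "cc (Suc i) = d" using False d by (auto simp: cc_def sS d_def)
      moreover have "of_int d * r (Suc (m + 1 + i)) < 0"
        using Suc dd d False by (intro alt) (auto simp: d_def)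
      ultimately show ?thesis using dd False by (auto simp: d_def)
    qed
  qed
  have "t (m + 2 + i) = switch_digit s i" for i
  proof -
    have c: "cc i \<in> {-1, 1}" by (simp add: cc_def)
    have "t (m + 2 + i) \<noteq> cc i"
      using negative_value_digit[OF digits_shift[OF t(1), of "\<lambda>j. Suc (m + 1 + i) + j"] c] inv[of i]
      by (auto simp: r_def)
    moreover have "t (m + 2 + i) \<in> {-1, 0, 1}" using t(1) by (auto simp: digits_def)
    ultimately show ?thesis by (auto simp: sS cc_def split: if_splits)
  qed
  then show thesis using switch by blast
qed

end


section \<open>The dimension of a Cantor set with prescribed digits\<close>

lemma hausdorff_measure_zeroI:
  fixes E :: "'a::metric_space set"
  assumes cover: "\<And>\<delta> \<epsilon>. \<delta> > 0 \<Longrightarrow> \<epsilon> > 0 \<Longrightarrow> \<exists>\<A> r. finite \<A> \<and> E \<subseteq> \<Union>\<A> \<and> 0 \<le> r \<and> r \<le> \<delta> \<and>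
      (\<forall>A\<in>\<A>. bounded A \<and> diameter A \<le> r) \<and> card \<A> * r powr s \<le> \<epsilon>"
    and s: "0 < s"
  shows "hausdorff_measure s E = 0"
proof -
  have "hausdorff_premeasure s \<delta> E = 0" if \<delta>: "\<delta> > 0" for \<delta>
  proof -
    have small: "hausdorff_premeasure s \<delta> E \<le> ennreal \<epsilon>" if \<epsilon>: "\<epsilon> > 0" for \<epsilon>
    proof -
      obtain \<A> r where A: "finite \<A>" "E \<subseteq> \<Union>\<A>" "0 \<le> r" "r \<le> \<delta>" "card \<A> * r powr s \<le> \<epsilon>"
        and AA: "\<And>A. A \<in> \<A> \<Longrightarrow> bounded A \<and> diameter A \<le> r"
        using cover[OF \<delta> \<epsilon>] by blast
      obtain f where f: "bij_betw f {..<card \<A>} \<A>"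
        using ex_bij_betw_nat_finite[OF A(1)] by (auto simp: atLeast0LessThan)
      define C where "C i = (if i < card \<A> then f i else {})" for i
      have fA: "f i \<in> \<A>" if "i < card \<A>" for i using f that by (auto simp: bij_betw_def)
      have "\<Union>\<A> \<subseteq> (\<Union>i. C i)"
      proof
        fix x assume "x \<in> \<Union>\<A>"
        then obtain A where A: "A \<in> \<A>" "x \<in> A" by blast
        then obtain i where "i \<in> {..<card \<A>}" "A = f i"
          using bij_betw_imp_surj_on[OF f] by (metis imageE)
        then have "x \<in> C i" using A by (simp add: C_def)
        then show "x \<in> (\<Union>i. C i)" by blast
      qed
      then have "E \<subseteq> (\<Union>i. C i)" by (rule subset_trans[OF A(2)])
      moreover have "bounded (f i)" "diameter (f i) \<le> \<delta>" if "i < card \<A>" for i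
        using AA[OF fA[OF that]] A(4) by auto
      ultimately have cov: "hausdorff_cover \<delta> E C"
        using \<delta> by (auto simp: hausdorff_cover_def C_def)
      have "hausdorff_premeasure s \<delta> E \<le> (\<Sum>i. ennreal (diameter (C i) powr s))"
        unfolding hausdorff_premeasure_def using cov by (intro INF_lower) auto
      also have "\<dots> = (\<Sum>i<card \<A>. ennreal (diameter (C i) powr s))"
        by (rule suminf_finite) (auto simp: C_def)
      also have "\<dots> \<le> (\<Sum>i<card \<A>. ennreal (r powr s))"
      proof (rule sum_mono)
        fix i assume i: "i \<in> {..<card \<A>}"
        then have "diameter (C i) \<le> r" "bounded (C i)" using AA fA by (auto simp: C_def)
        then show "ennreal (diameter (C i) powr s) \<le> ennreal (r powr s)"
          using s by (intro ennreal_leI powr_mono2) (auto simp: diameter_ge_0)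
      qed
      also have "\<dots> = ennreal (card \<A> * r powr s)"
        by (simp add: ennreal_mult ennreal_of_nat_eq_real_of_nat)
      also have "\<dots> \<le> ennreal \<epsilon>" using A(5) by (rule ennreal_leI)
      finally show ?thesis .
    qed
    have "hausdorff_premeasure s \<delta> E \<le> 0"
    proof (rule ennreal_le_epsilon)
      fix e :: real assume "0 < e"
      from small[OF this] show "hausdorff_premeasure s \<delta> E \<le> 0 + ennreal e" by simp
    qed
    then show ?thesis by (simp only: le_zero_eq)
  qed
  then have "hausdorff_measure s E \<le> 0" unfolding hausdorff_measure_def by (intro SUP_least) simp
  then show ?thesis by (simp only: le_zero_eq)
qed

text \<open>
  A Hoelder image of E of positive length bounds the measure of E from below: the images of the
  sets of a cover are contained in intervals whose total length is at most a constant times the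
  sum of the powers of the diameters.
\<close>

lemma hausdorff_measure_pos:
  fixes f :: "'b \<Rightarrow> 'a::metric_space" and g :: "'b \<Rightarrow> real"
  assumes hoelder: "\<And>x y. x \<in> X \<Longrightarrow> y \<in> X \<Longrightarrow> \<bar>g x - g y\<bar> \<le> K * dist (f x) (f y) powr s"
    and onto: "{0..<1} \<subseteq> g ` X" and s: "0 < s" and K: "0 < K"
  shows "hausdorff_measure s (f ` X) \<noteq> 0"
proof -
  have "ennreal (1 / (2 * K)) \<le> hausdorff_premeasure s 1 (f ` X)"
    unfolding hausdorff_premeasure_def
  proof (rule INF_greatest)
    fix C assume "C \<in> {C. hausdorff_cover 1 (f ` X) C}"
    then have C: "f ` X \<subseteq> (\<Union>i. C i)" "\<And>i. bounded (C i)" by (auto simp: hausdorff_cover_def)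
    define r where "r i = K * diameter (C i) powr s" for i
    define I where "I i = (if \<exists>x\<in>X. f x \<in> C i
        then (let x = SOME x. x \<in> X \<and> f x \<in> C i in {g x - r i .. g x + r i}) else {})" for i
    have r0: "0 \<le> r i" for i using K by (simp add: r_def)
    have "{0..<1} \<subseteq> (\<Union>i. I i)"
    proof
      fix u :: real assume "u \<in> {0..<1}"
      then obtain x where x: "x \<in> X" "g x = u" using onto by blast
      then obtain i where i: "f x \<in> C i" using C(1) by blast
      define y where "y = (SOME x. x \<in> X \<and> f x \<in> C i)"
      have y: "y \<in> X" "f y \<in> C i" using someI[of "\<lambda>x. x \<in> X \<and> f x \<in> C i" x] x i by (auto simp: y_def)
      have "dist (f x) (f y) \<le> diameter (C i)" by (rule diameter_bounded_bound[OF C(2) i y(2)])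
      then have "K * dist (f x) (f y) powr s \<le> r i"
        unfolding r_def using K s by (intro mult_left_mono powr_mono2) auto
      then have "\<bar>g x - g y\<bar> \<le> r i" using hoelder[OF x(1) y(1)] by linarith
      then have "u \<in> I i" using x i y by (auto simp: I_def y_def[symmetric] Let_def abs_le_iff)
      then show "u \<in> (\<Union>i. I i)" by blast
    qed
    moreover have sets: "I i \<in> sets lborel" for i by (simp add: I_def Let_def)
    ultimately have "emeasure lborel {0..<1::real} \<le> emeasure lborel (\<Union>i. I i)"
      by (intro emeasure_mono) auto
    also have "\<dots> \<le> (\<Sum>i. emeasure lborel (I i))"
      using sets by (intro emeasure_subadditive_countably) auto
    also have "\<dots> \<le> (\<Sum>i. ennreal (2 * K) * ennreal (diameter (C i) powr s))"
    proof (rule suminf_le)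
      fix i
      have "emeasure lborel (I i) \<le> ennreal (2 * r i)"
        using r0[of i] by (simp add: I_def Let_def)
      also have "\<dots> = ennreal (2 * K) * ennreal (diameter (C i) powr s)"
        using K by (simp add: r_def ennreal_mult mult.assoc)
      finally show "emeasure lborel (I i) \<le> ennreal (2 * K) * ennreal (diameter (C i) powr s)" .
    qed auto
    also have "\<dots> = ennreal (2 * K) * (\<Sum>i. ennreal (diameter (C i) powr s))"
      by (rule ennreal_suminf_cmult)
    finally have "ennreal (1 / (2 * K)) * 1 \<le>
        ennreal (1 / (2 * K)) * (ennreal (2 * K) * (\<Sum>i. ennreal (diameter (C i) powr s)))"
      by (intro mult_left_mono) auto
    also have "\<dots> = (\<Sum>i. ennreal (diameter (C i) powr s))"
      using K by (simp add: mult.assoc[symmetric] flip: ennreal_mult)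
    finally show "ennreal (1 / (2 * K)) \<le> (\<Sum>i. ennreal (diameter (C i) powr s))" by simp
  qed
  also have "\<dots> \<le> hausdorff_measure s (f ` X)"
    unfolding hausdorff_measure_def by (rule SUP_upper) simp
  finally show ?thesis using K by (auto simp: ennreal_eq_0_iff)
qed

lemma binary_expansion:
  fixes r :: real
  assumes "0 \<le> r" "r < 1"
  shows "\<exists>b. (\<lambda>k. of_bool (b k) * (1 / 2) ^ Suc k) sums r"
proof -
  define b where "b k = odd \<lfloor>2 ^ Suc k * r\<rfloor>" for k
  have part: "(\<Sum>k<n. of_bool (b k) * (1 / 2 :: real) ^ Suc k) = of_int \<lfloor>2 ^ n * r\<rfloor> * (1 / 2) ^ n" for n
  proof (induction n)
    case 0
    have "\<lfloor>r\<rfloor> = 0" using assms by (simp add: floor_eq_iff)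
    then show ?case by simp
  next
    case (Suc n)
    define m where "m = \<lfloor>2 ^ n * r\<rfloor>"
    have "of_int m \<le> 2 ^ n * r" "2 ^ n * r < of_int m + 1" unfolding m_def by linarith+
    then have "of_int (2 * m) \<le> 2 ^ Suc n * r" "2 ^ Suc n * r < of_int (2 * m) + 2" by simp_all
    then have "\<lfloor>2 ^ Suc n * r\<rfloor> = 2 * m \<or> \<lfloor>2 ^ Suc n * r\<rfloor> = 2 * m + 1" by linarith
    then have "\<lfloor>2 ^ Suc n * r\<rfloor> = 2 * m + of_bool (b n)" unfolding b_def by auto
    then have "of_int \<lfloor>2 ^ Suc n * r\<rfloor> * (1 / 2 :: real) ^ Suc n = of_int m * (1 / 2) ^ n + of_bool (b n) * (1 / 2) ^ Suc n"
      by (simp add: algebra_simps)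
    then show ?case using Suc unfolding m_def sum.lessThan_Suc by linarith
  qed
  have "(\<lambda>n. of_int \<lfloor>2 ^ n * r\<rfloor> * (1 / 2) ^ n) \<longlonglongrightarrow> r"
  proof (rule tendsto_sandwich)
    show "(\<lambda>n. r - (1 / 2) ^ n) \<longlonglongrightarrow> r"
      using tendsto_diff[OF tendsto_const[of r] LIMSEQ_realpow_zero[of "1/2"]] by simp
    show "\<forall>\<^sub>F n in sequentially. r - (1 / 2) ^ n \<le> of_int \<lfloor>2 ^ n * r\<rfloor> * (1 / 2) ^ n"
    proof (rule always_eventually, rule allI)
      fix n :: nat
      have "(2 ^ n * r - 1) * (1 / 2) ^ n \<le> of_int \<lfloor>2 ^ n * r\<rfloor> * (1 / 2) ^ n"
        by (rule mult_right_mono) (linarith, simp)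
      then show "r - (1 / 2) ^ n \<le> of_int \<lfloor>2 ^ n * r\<rfloor> * (1 / 2) ^ n"
        by (simp add: field_simps)
    qed
    show "\<forall>\<^sub>F n in sequentially. of_int \<lfloor>2 ^ n * r\<rfloor> * (1 / 2) ^ n \<le> r"
    proof (rule always_eventually, rule allI)
      fix n :: nat
      have "of_int \<lfloor>2 ^ n * r\<rfloor> * (1 / 2) ^ n \<le> (2 ^ n * r) * (1 / 2) ^ n"
        by (rule mult_right_mono) (linarith, simp)
      then show "of_int \<lfloor>2 ^ n * r\<rfloor> * (1 / 2) ^ n \<le> r" by (simp add: field_simps)
    qed
  qed simp
  then have "(\<lambda>k. of_bool (b k) * (1 / 2) ^ Suc k) sums r" unfolding sums_def part .
  then show ?thesis by blast
qed

context base
begin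

definition free_count :: "nat set \<Rightarrow> nat \<Rightarrow> nat" where
  "free_count Z n = card (Z \<inter> {..<n})"

definition digit_set :: "nat set \<Rightarrow> (nat \<Rightarrow> bool) \<Rightarrow> real set" where
  "digit_set Z c = wval \<alpha> ` {x. \<forall>i. i \<notin> Z \<longrightarrow> x i = c i}"

lemma free_count_Suc: "free_count Z (Suc n) = free_count Z n + of_bool (n \<in> Z)"
proof -
  have "Z \<inter> {..<Suc n} = (if n \<in> Z then insert n (Z \<inter> {..<n}) else Z \<inter> {..<n})"
    by (auto simp: less_Suc_eq)
  then show ?thesis by (simp add: free_count_def)
qed

lemma free_count_0 [simp]: "free_count Z 0 = 0" by (simp add: free_count_def)

text \<open>
  The points whose first n digits agree lie in an interval of length \<alpha>^n, and there are 2^N such intervals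
  if N of these digits are free.
\<close>

lemma hausdorff_measure_digit_set_zero:
  assumes lim: "(\<lambda>n. free_count Z n / n) \<longlonglongrightarrow> d" and s: "d * ln 2 / (- ln \<alpha>) < s" "0 < s"
  shows "hausdorff_measure s (digit_set Z c) = 0"
proof (rule hausdorff_measure_zeroI)
  fix \<delta> \<epsilon> :: real assume de: "\<delta> > 0" "\<epsilon> > 0"
  have ln\<alpha>: "ln \<alpha> < 0" using pos less_half by simp
  have "d < s * (- ln \<alpha>) / ln 2" using s ln\<alpha> by (simp add: field_simps)
  then obtain d' where d': "d < d'" "d' < s * (- ln \<alpha>) / ln 2" using dense by blast
  define q where "q = exp (d' * ln 2 + s * ln \<alpha>)"
  have "d' * ln 2 + s * ln \<alpha> < 0" using d'(2) by (simp add: field_simps)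
  then have q: "0 < q" "q < 1" by (simp_all add: q_def)
  have ev1: "\<forall>\<^sub>F n in sequentially. free_count Z n / n < d'" using order_tendstoD(2)[OF lim d'(1)] .
  have ev2: "\<forall>\<^sub>F n in sequentially. q ^ n < \<epsilon>"
    using order_tendstoD(2)[OF LIMSEQ_realpow_zero[of q] de(2)] q by simp
  have ev3: "\<forall>\<^sub>F n in sequentially. \<alpha> ^ n < \<delta>"
    using order_tendstoD(2)[OF LIMSEQ_realpow_zero[of \<alpha>] de(1)] pos less_half by simp
  obtain n where n: "free_count Z n / n < d'" "q ^ n < \<epsilon>" "\<alpha> ^ n < \<delta>" "n > 0"
    using eventually_happens'[OF _ eventually_conj[OF ev1 eventually_conj[OF ev2 eventually_conj[OF ev3 eventually_gt_at_top[of 0]]]]]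
    by auto
  define X where "X = {x. \<forall>i. i \<notin> Z \<longrightarrow> x i = c i}"
  define P where "P A = wval \<alpha> ` {x \<in> X. \<forall>i\<in>Z \<inter> {..<n}. x i = (i \<in> A)}" for A
  define \<A> where "\<A> = P ` Pow (Z \<inter> {..<n})"
  have fin: "finite \<A>" by (simp add: \<A>_def)
  have cov: "digit_set Z c \<subseteq> \<Union>\<A>"
  proof
    fix u assume "u \<in> digit_set Z c"
    then obtain x where x: "x \<in> X" "u = wval \<alpha> x" by (auto simp: digit_set_def X_def)
    then have "u \<in> P {i \<in> Z \<inter> {..<n}. x i}" by (auto simp: P_def)
    then show "u \<in> \<Union>\<A>" by (auto simp: \<A>_def)
  qed
  have "bounded A \<and> diameter A \<le> \<alpha> ^ n" if "A \<in> \<A>" for A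
  proof
    have "A \<subseteq> {0..M}" using that wval_nonneg wval_bound by (auto simp: \<A>_def P_def)
    then show "bounded A" using bounded_subset bounded_closed_interval by blast
    obtain B where B: "A = P B" using \<open>A \<in> \<A>\<close> by (auto simp: \<A>_def)
    show "diameter A \<le> \<alpha> ^ n"
    proof (rule diameter_le)
      fix u v assume "u \<in> A" "v \<in> A"
      then obtain x y where x: "x \<in> X" "\<forall>i\<in>Z \<inter> {..<n}. x i = (i \<in> B)" "u = wval \<alpha> x"
        and y: "y \<in> X" "\<forall>i\<in>Z \<inter> {..<n}. y i = (i \<in> B)" "v = wval \<alpha> y" by (auto simp: B P_def)
      have "x i = y i" if "i < n" for i using x y that by (cases "i \<in> Z") (auto simp: X_def)
      then show "norm (u - v) \<le> \<alpha> ^ n" using wval_prefix[of n x y] x y by simp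
    qed (use pos in simp)
  qed
  moreover have "card \<A> * (\<alpha> ^ n) powr s \<le> \<epsilon>"
  proof -
    have "card \<A> \<le> 2 ^ free_count Z n"
      unfolding \<A>_def free_count_def
      using card_image_le[of "Pow (Z \<inter> {..<n})" P] card_Pow[of "Z \<inter> {..<n}"] by simp
    then have "real (card \<A>) \<le> 2 ^ free_count Z n" by (metis of_nat_le_iff of_nat_numeral of_nat_power)
    then have "card \<A> * (\<alpha> ^ n) powr s \<le> 2 ^ free_count Z n * (\<alpha> ^ n) powr s"
      by (intro mult_right_mono) auto
    also have "\<dots> = exp (free_count Z n * ln 2) * exp (n * (s * ln \<alpha>))"
      using pos by (simp add: exp_of_nat_mult powr_def ln_realpow mult_ac)
    also have "exp (free_count Z n * ln 2) * exp (n * (s * ln \<alpha>)) \<le> exp (n * d' * ln 2) * exp (n * (s * ln \<alpha>))"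
      using n(1,4) by (intro mult_right_mono) (auto simp: field_simps)
    also have "\<dots> = q ^ n" by (simp add: q_def exp_of_nat_mult[symmetric] exp_add[symmetric] algebra_simps)
    finally show ?thesis using n(2) by linarith
  qed
  ultimately show "\<exists>\<A> r. finite \<A> \<and> digit_set Z c \<subseteq> \<Union>\<A> \<and> 0 \<le> r \<and> r \<le> \<delta> \<and>
      (\<forall>A\<in>\<A>. bounded A \<and> diameter A \<le> r) \<and> card \<A> * r powr s \<le> \<epsilon>"
    using fin cov n(3) pos by (intro exI[of _ \<A>] exI[of _ "\<alpha> ^ n"]) auto
qed (rule s)

text \<open>
  The lower bound uses the Cantor function: it reads the free digits of a point as the binary
  digits of a number.
\<close>

lemma hausdorff_measure_digit_set_pos:
  assumes lim: "(\<lambda>n. free_count Z n / n) \<longlonglongrightarrow> d" and s: "s < d * ln 2 / (- ln \<alpha>)" "0 < s"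
  shows "hausdorff_measure s (digit_set Z c) \<noteq> 0"
proof -
  have ln\<alpha>: "ln \<alpha> < 0" using pos less_half by simp
  define N where "N = free_count Z"
  define h where "h n = (1 / 2 :: real) ^ N n" for n
  define X where "X = {x. \<forall>i. i \<notin> Z \<longrightarrow> x i = c i}"
  have h_Suc: "h (Suc n) = (if n \<in> Z then h n / 2 else h n)" for n
    by (simp add: h_def N_def free_count_Suc)
  have h_pos: "0 < h n" for n by (simp add: h_def)
  \<comment> \<open>The binary place value of a free digit; it is 0 at the fixed positions.\<close>
  define g where "g n = h n - h (Suc n)" for n
  have g_nonneg: "0 \<le> g n" for n using h_pos[of n] by (simp add: g_def h_Suc)
  have g_sum: "(\<Sum>i<m. g i) = 1 - h m" for m
    by (induction m) (auto simp: g_def h_def N_def)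
  have "summable g"
    using g_nonneg g_sum h_pos by (intro summableI_nonneg_bounded[of _ 1]) (auto simp: less_imp_le)
  then have summ: "summable (\<lambda>i. of_bool (x i) * g i)" for x :: "nat \<Rightarrow> bool"
    by (rule summable_comparison_test[rotated]) (use g_nonneg in auto)
  define G where "G x = (\<Sum>i. of_bool (x i) * g i)" for x :: "nat \<Rightarrow> bool"
  have G_lim: "(\<lambda>m. \<Sum>i<m. of_bool (x i) * g i) \<longlonglongrightarrow> G x" for x
    using summable_LIMSEQ[OF summ[of x]] by (simp add: G_def)
  have G_diff: "\<bar>G x - G y\<bar> \<le> h n" if eq: "\<And>i. i < n \<Longrightarrow> x i = y i" for x y n
  proof -
    have part: "\<bar>(\<Sum>i<n + m. of_bool (x i) * g i) - (\<Sum>i<n + m. of_bool (y i) * g i)\<bar> \<le> h n - h (n + m)" for m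
    proof (induction m)
      case 0
      have "(\<Sum>i<n. of_bool (x i) * g i) = (\<Sum>i<n. of_bool (y i) * g i)"
        using eq by (intro sum.cong) auto
      then show ?case by simp
    next
      case (Suc m)
      have "\<bar>of_bool (x (n + m)) * g (n + m) - of_bool (y (n + m)) * g (n + m)\<bar> \<le> g (n + m)"
        using g_nonneg[of "n + m"] by auto
      then show ?case using Suc by (simp add: g_def)
    qed
    have "(\<lambda>m. \<bar>(\<Sum>i<m + n. of_bool (x i) * g i) - (\<Sum>i<m + n. of_bool (y i) * g i)\<bar>) \<longlonglongrightarrow> \<bar>G x - G y\<bar>"
      by (intro tendsto_intros LIMSEQ_ignore_initial_segment G_lim)
    then show ?thesis
    proof (rule LIMSEQ_le_const2, intro exI allI impI)
      fix m :: nat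
      show "\<bar>(\<Sum>i<m + n. of_bool (x i) * g i) - (\<Sum>i<m + n. of_bool (y i) * g i)\<bar> \<le> h n"
        using part[of m] h_pos[of "n + m"] by (simp add: add.commute)
    qed
  qed
  have "s * (- ln \<alpha>) / ln 2 < d" using s ln\<alpha> by (simp add: field_simps)
  from order_tendstoD(1)[OF lim this] obtain n0 where n0:
    "\<And>n. n \<ge> n0 \<Longrightarrow> s * (- ln \<alpha>) / ln 2 < N n / n"
    by (auto simp: eventually_sequentially N_def)
  define K1 where "K1 = 1 / (\<alpha> ^ n0) powr s"
  have K1: "1 \<le> K1"
  proof -
    have "(\<alpha> ^ n0) powr s \<le> 1"
      using pos less_half s(2) powr_mono2[of s "\<alpha> ^ n0" 1] by (simp add: power_le_one)
    then show ?thesis using pos by (simp add: K1_def)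
  qed
  have h_le: "h n \<le> K1 * (\<alpha> ^ n) powr s" for n
  proof (cases "n \<ge> Suc n0")
    case True
    then have "s * (- ln \<alpha>) / ln 2 < N n / n" using n0[of n] by simp
    then have "n * (s * (- ln \<alpha>)) \<le> N n * ln 2" using True by (simp add: field_simps)
    then have "exp (- (N n * ln 2)) \<le> exp (n * (s * ln \<alpha>))" by simp
    moreover have "h n = exp (- (N n * ln 2))"
      by (simp add: h_def exp_minus exp_of_nat_mult power_one_over inverse_eq_divide)
    moreover have "(\<alpha> ^ n) powr s = exp (n * (s * ln \<alpha>))"
      using pos by (simp add: powr_def ln_realpow mult_ac)
    ultimately have "h n \<le> 1 * (\<alpha> ^ n) powr s" by simp
    also have "\<dots> \<le> K1 * (\<alpha> ^ n) powr s" using K1 by (intro mult_right_mono) auto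
    finally show ?thesis .
  next
    case False
    then have "\<alpha> ^ n0 \<le> \<alpha> ^ n" using pos less_half by (intro power_decreasing) auto
    then have "(\<alpha> ^ n0) powr s \<le> (\<alpha> ^ n) powr s" using pos s(2) by (intro powr_mono2) auto
    then have "1 \<le> K1 * (\<alpha> ^ n) powr s" using pos by (simp add: K1_def field_simps)
    moreover have "h n \<le> 1" by (simp add: h_def power_le_one)
    ultimately show ?thesis by linarith
  qed
  define w where "w = \<alpha> * (1 - M)"
  have w: "0 < w" unfolding w_def using pos M_less_1 by (intro mult_pos_pos) linarith+
  define K where "K = K1 / w powr s"
  have K: "0 < K" using K1 w by (simp add: K_def)
  have first: "\<bar>G x - G y\<bar> \<le> K * \<bar>wval \<alpha> y - wval \<alpha> x\<bar> powr s"
    if n: "\<And>i. i < n \<Longrightarrow> x i = y i" "\<not> x n" "y n" for x y n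
  proof -
    have "\<alpha> ^ n * w = \<alpha> ^ Suc n * (1 - M)" unfolding w_def power_Suc by (simp only: mult_ac)
    then have "\<alpha> ^ n * w \<le> \<bar>wval \<alpha> y - wval \<alpha> x\<bar>" using wval_gap[of n x y, OF n] by linarith
    then have "(\<alpha> ^ n * w) powr s \<le> \<bar>wval \<alpha> y - wval \<alpha> x\<bar> powr s"
      using s(2) w pos by (intro powr_mono2) auto
    then have "K * (\<alpha> ^ n * w) powr s \<le> K * \<bar>wval \<alpha> y - wval \<alpha> x\<bar> powr s"
      using K by simp
    moreover have "\<bar>G x - G y\<bar> \<le> K1 * (\<alpha> ^ n) powr s" using G_diff[of n x y, OF n(1)] h_le[of n] by linarith
    moreover have "(\<alpha> ^ n * w) powr s = (\<alpha> ^ n) powr s * w powr s"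
      by (rule powr_mult)
    then have "K1 * (\<alpha> ^ n) powr s = K * (\<alpha> ^ n * w) powr s" using w by (simp add: K_def)
    ultimately show ?thesis by linarith
  qed
  have hoelder: "\<bar>G x - G y\<bar> \<le> K * dist (wval \<alpha> x) (wval \<alpha> y) powr s" for x y
  proof (cases "x = y")
    case False
    then have "x \<sqsubset> y \<or> y \<sqsubset> x" by (rule lex_less_total)
    then show ?thesis
    proof
      assume "x \<sqsubset> y"
      then obtain n where "\<And>i. i < n \<Longrightarrow> x i = y i" "\<not> x n" "y n" by (auto simp: lex_less_def)
      from first[of n x y, OF this] show ?thesis by (simp add: dist_real_def abs_minus_commute)
    next
      assume "y \<sqsubset> x"
      then obtain n where "\<And>i. i < n \<Longrightarrow> y i = x i" "\<not> y n" "x n" by (auto simp: lex_less_def)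
      from first[of n y x, OF this] show ?thesis by (simp add: dist_real_def abs_minus_commute)
    qed
  qed simp
  have N_inf: "filterlim N at_top sequentially"
  proof -
    have "0 < s * (- ln \<alpha>) / ln 2" using s(2) ln\<alpha> by (intro divide_pos_pos mult_pos_pos) auto
    moreover have "filterlim (\<lambda>n. s * (- ln \<alpha>) / ln 2 * real n) at_top sequentially"
      using calculation by (intro filterlim_tendsto_pos_mult_at_top[OF tendsto_const] filterlim_real_sequentially)
    then have "filterlim (\<lambda>n. real (N n)) at_top sequentially"
    proof (rule filterlim_at_top_mono)
      show "\<forall>\<^sub>F n in sequentially. s * (- ln \<alpha>) / ln 2 * real n \<le> real (N n)"
        using eventually_ge_at_top[of "Suc n0"]
      proof eventually_elim
        case (elim n)
        then show ?case using n0[of n] by (simp add: field_simps)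
      qed
    qed
    then show ?thesis by (simp add: filterlim_sequentially_iff_filterlim_real)
  qed
  have onto: "{0..<1} \<subseteq> G ` X"
  proof
    fix r :: real assume "r \<in> {0..<1}"
    then obtain b where b: "(\<lambda>k. of_bool (b k) * (1 / 2) ^ Suc k) sums r"
      using binary_expansion[of r] by auto
    define x where "x i = (if i \<in> Z then b (N i) else c i)" for i
    have part: "(\<Sum>i<m. of_bool (x i) * g i) = (\<Sum>k<N m. of_bool (b k) * (1 / 2) ^ Suc k)" for m
    proof (induction m)
      case (Suc m)
      show ?case
      proof (cases "m \<in> Z")
        case True
        then have "N (Suc m) = Suc (N m)" "g m = (1 / 2) ^ Suc (N m)" "x m = b (N m)"
          by (simp_all add: N_def free_count_Suc g_def h_Suc x_def) (simp add: h_def N_def)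
        then show ?thesis using Suc by simp
      next
        case False
        then have "N (Suc m) = N m" "g m = 0"
          by (simp_all add: N_def free_count_Suc g_def h_Suc)
        then show ?thesis using Suc by simp
      qed
    qed (simp add: N_def)
    have "(\<lambda>m. \<Sum>k<N m. of_bool (b k) * (1 / 2 :: real) ^ Suc k) \<longlonglongrightarrow> r"
      using filterlim_compose[OF b[unfolded sums_def] N_inf] .
    then have "G x = r" using LIMSEQ_unique[OF G_lim[of x, unfolded part]] by blast
    moreover have "x \<in> X" by (simp add: x_def X_def)
    ultimately show "r \<in> G ` X" by blast
  qed
  have "digit_set Z c = wval \<alpha> ` X" by (simp add: digit_set_def X_def)
  then show ?thesis using hausdorff_measure_pos[OF hoelder onto s(2) K] by simp
qed

theorem hausdorff_dim_digit_set:
  assumes lim: "(\<lambda>n. free_count Z n / n) \<longlonglongrightarrow> d"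
  shows "hausdorff_dim (digit_set Z c) = d * ln 2 / (- ln \<alpha>)"
proof -
  define D where "D = d * ln 2 / (- ln \<alpha>)"
  define S where "S = {s. 0 < s \<and> hausdorff_measure s (digit_set Z c) = 0}"
  have "0 \<le> d" using lim by (rule LIMSEQ_le_const) auto
  moreover have "ln \<alpha> < 0" using pos less_half by simp
  ultimately have D: "0 \<le> D" by (simp add: D_def divide_nonneg_neg)
  have upper: "s \<in> S" if "D < s" for s
    using hausdorff_measure_digit_set_zero[OF lim, of s c] that D by (auto simp: S_def D_def)
  have lower: "D \<le> s" if "s \<in> S" for s
    using hausdorff_measure_digit_set_pos[OF lim, of s c] that by (force simp: S_def D_def)
  have ne: "S \<noteq> {}" using upper[of "D + 1"] by auto
  have "Inf S \<le> D"
  proof (rule field_le_epsilon)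
    fix e :: real assume "0 < e"
    then show "Inf S \<le> D + e" using lower by (intro cInf_lower upper bdd_belowI[of _ D]) auto
  qed
  moreover have "D \<le> Inf S" using ne lower by (rule cInf_greatest)
  ultimately show ?thesis by (simp add: hausdorff_dim_def S_def D_def)
qed

end


section \<open>Dimensions of intersections\<close>

lemma free_count_limit:
  fixes a b :: "nat \<Rightarrow> nat"
  assumes "(\<lambda>n. a n / n) \<longlonglongrightarrow> d" "\<And>n. b (N + n) = b N + a n"
  shows "(\<lambda>n. b n / n) \<longlonglongrightarrow> d"
proof (rule LIMSEQ_offset[of _ N])
  have "(\<lambda>n. (real (b N) / n + a n / n) / (1 + real N / n)) \<longlonglongrightarrow> (0 + d) / (1 + 0)"
    by (intro tendsto_intros lim_const_over_n assms(1)) auto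
  moreover have "\<forall>\<^sub>F n in sequentially. (real (b N) / n + a n / n) / (1 + real N / n) = b (n + N) / (n + N)"
    using eventually_gt_at_top[of 0]
  proof eventually_elim
    case (elim n)
    have "b (n + N) = b N + a n" using assms(2)[of n] by (simp add: add.commute)
    moreover have "(real (b N) / n + a n / n) = (real (b N) + a n) / n" "1 + real N / n = (real n + N) / n"
      using elim by (simp_all add: field_simps)
    ultimately show ?case using elim by simp
  qed
  ultimately show "(\<lambda>n. b (n + N) / (n + N)) \<longlonglongrightarrow> d"
    using Lim_transform_eventually by fastforce
qed

lemma pow_pow_tendsto: "0 \<le> x \<Longrightarrow> x < 1 \<Longrightarrow> (\<lambda>k. x ^ 2 ^ k) \<longlonglongrightarrow> (0 :: real)"
proof (rule tendsto_sandwich[OF _ _ tendsto_const])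
  assume x: "0 \<le> x" "x < 1"
  then show "(\<lambda>k. x ^ k) \<longlonglongrightarrow> 0" by (intro LIMSEQ_realpow_zero) auto
  show "\<forall>\<^sub>F k in sequentially. x ^ 2 ^ k \<le> x ^ k"
    using x by (intro always_eventually allI power_decreasing) (auto intro: less_imp_le)
qed simp

context overlap_base
begin

abbreviation full_dim :: real where "full_dim \<equiv> ln 2 / (- ln \<alpha>)"

lemma cantor_set_eq: "cantor_set \<alpha> = range (wval \<alpha>)"
proof (intro equalityI subsetI)
  fix x assume "x \<in> cantor_set \<alpha>"
  then obtain e where "is_expansion {0, 1} \<alpha> x e" by (auto simp: cantor_set_def)
  then have e: "\<And>i. e i \<in> {0, 1}" "val \<alpha> e = x" by (simp_all add: is_expansion_iff)
  have "e = (\<lambda>i. of_bool (e i = 1))"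
  proof
    show "e i = of_bool (e i = 1)" for i using e(1)[of i] by auto
  qed
  then have "wval \<alpha> (\<lambda>i. e i = 1) = x" using e(2) unfolding wval_def by metis
  then show "x \<in> range (wval \<alpha>)" by blast
next
  fix x assume "x \<in> range (wval \<alpha>)"
  then obtain w where "x = wval \<alpha> w" by blast
  then have "is_expansion {0, 1} \<alpha> x (\<lambda>i. of_bool (w i))" by (simp add: is_expansion_iff wval_def)
  then show "x \<in> cantor_set \<alpha>" unfolding cantor_set_def by blast
qed

definition inter_dim :: "(nat \<Rightarrow> int) \<Rightarrow> real" where
  "inter_dim t = hausdorff_dim (digit_set {i. t i = 0} (\<lambda>i. t i = 1))"

text \<open>
  A point of the intersection yields an expansion of the translation by subtracting digits.  As
  this expansion is unique, its zeros mark exactly the digits of the point that are free.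
\<close>

lemma cantor_set_inter_translate:
  assumes t: "digits t" "tails_small t"
  shows "cantor_set \<alpha> \<inter> (\<lambda>x. x + val \<alpha> t) ` cantor_set \<alpha> = digit_set {i. t i = 0} (\<lambda>i. t i = 1)"
proof (intro equalityI subsetI)
  fix x assume "x \<in> cantor_set \<alpha> \<inter> (\<lambda>x. x + val \<alpha> t) ` cantor_set \<alpha>"
  then obtain a b where a: "x = wval \<alpha> a" and b: "x = wval \<alpha> b + val \<alpha> t"
    unfolding cantor_set_eq by blast
  define e :: "nat \<Rightarrow> int" where "e = (\<lambda>i. of_bool (a i) - of_bool (b i))"
  have "val \<alpha> e = val \<alpha> t"
    using a b val_diff[OF digits_of_bool digits_of_bool, of a b] by (simp add: wval_def e_def)
  moreover have "digits e" by (simp add: e_def)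
  ultimately have "is_expansion {-1, 0, 1} \<alpha> (val \<alpha> t) e" "is_expansion {-1, 0, 1} \<alpha> (val \<alpha> t) t"
    using t by (simp_all add: is_expansion_iff digits_def)
  then have "e = t" using unique_expansion_iff[OF t(1)] t(2) by blast
  have "a i = (t i = 1)" if "t i \<noteq> 0" for i
    using fun_cong[OF \<open>e = t\<close>, of i] that by (cases "a i"; cases "b i") (auto simp: e_def)
  then show "x \<in> digit_set {i. t i = 0} (\<lambda>i. t i = 1)" using a by (auto simp: digit_set_def)
next
  fix x assume "x \<in> digit_set {i. t i = 0} (\<lambda>i. t i = 1)"
  then obtain a where a: "x = wval \<alpha> a" "\<And>i. t i \<noteq> 0 \<Longrightarrow> a i = (t i = 1)" by (auto simp: digit_set_def)
  define b where "b i = (if t i = 0 then a i else \<not> a i)" for i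
  have "t = (\<lambda>i. of_bool (a i) - of_bool (b i))"
  proof
    fix i
    have "t i \<in> {-1, 0, 1}" using t(1) by (simp add: digits_def)
    then show "t i = of_bool (a i) - of_bool (b i)" using a(2)[of i] by (auto simp: b_def)
  qed
  then have "val \<alpha> t = wval \<alpha> a - wval \<alpha> b"
    using val_diff[OF digits_of_bool digits_of_bool, of a b] unfolding wval_def by metis
  then have "x = wval \<alpha> b + val \<alpha> t" using a(1) by simp
  then show "x \<in> cantor_set \<alpha> \<inter> (\<lambda>x. x + val \<alpha> t) ` cantor_set \<alpha>"
    using a(1) unfolding cantor_set_eq by blast
qed

lemma dim_set_eq: "dim_set \<alpha> = inter_dim ` {t. digits t \<and> tails_small t}"
proof -
  have "unique_expansion_set \<alpha> = val \<alpha> ` {t. digits t \<and> tails_small t}"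
  proof (intro equalityI subsetI)
    fix u assume "u \<in> unique_expansion_set \<alpha>"
    then have ex1: "\<exists>!e. is_expansion {-1, 0, 1} \<alpha> u e" by (simp add: unique_expansion_set_def)
    then obtain e where "is_expansion {-1, 0, 1} \<alpha> u e" by blast
    then have e: "digits e" "val \<alpha> e = u" by (simp_all add: is_expansion_iff digits_def)
    then have "tails_small e" using unique_expansion_iff[OF e(1)] ex1 by simp
    then show "u \<in> val \<alpha> ` {t. digits t \<and> tails_small t}" using e by blast
  next
    fix u assume "u \<in> val \<alpha> ` {t. digits t \<and> tails_small t}"
    then obtain t where t: "digits t" "tails_small t" "u = val \<alpha> t" by blast
    have "t = (\<lambda>i. of_bool (t i = 1) - of_bool (t i = -1))"
    proof
      fix i
      have "t i \<in> {-1, 0, 1}" using t(1) by (simp add: digits_def)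
      then show "t i = of_bool (t i = 1) - of_bool (t i = -1)" by auto
    qed
    then have "u = wval \<alpha> (\<lambda>i. t i = 1) - wval \<alpha> (\<lambda>i. t i = -1)"
      using val_diff[OF digits_of_bool digits_of_bool, of "\<lambda>i. t i = 1" "\<lambda>i. t i = -1"] t(3)
      unfolding wval_def by metis
    then have "u \<in> difference_set (cantor_set \<alpha>)" unfolding difference_set_def cantor_set_eq by blast
    then show "u \<in> unique_expansion_set \<alpha>"
      using unique_expansion_iff[OF t(1)] t by (simp add: unique_expansion_set_def)
  qed
  then show ?thesis
    unfolding dim_set_def image_image inter_dim_def by (auto simp: cantor_set_inter_translate image_image)
qed

lemma inter_dim_eq:
  fixes a :: "nat \<Rightarrow> nat"
  assumes "(\<lambda>n. a n / n) \<longlonglongrightarrow> d" "\<And>n. a n = (\<Sum>i<n. of_bool (t (N + i) = 0))"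
  shows "inter_dim t = d * full_dim"
proof -
  have "free_count {i. t i = 0} (N + n) = free_count {i. t i = 0} N + a n" for n
    by (induction n) (simp_all add: assms(2) free_count_Suc)
  then have "(\<lambda>n. free_count {i. t i = 0} n / n) \<longlonglongrightarrow> d"
    by (rule free_count_limit[OF assms(1)])
  then show ?thesis by (simp add: inter_dim_def hausdorff_dim_digit_set)
qed

text \<open>
  The position 0 is exempt: the first digit of the difference sequence is the switch from position 0 to position 1.
\<close>

definition admissible :: "(nat \<Rightarrow> bool) \<Rightarrow> bool" where
  "admissible s \<longleftrightarrow> (\<forall>i. wval \<alpha> (norm_shift s (Suc i)) < hole)"

lemma inter_dim_switches:
  assumes "(\<lambda>n. repeats s n / n) \<longlonglongrightarrow> d" "\<And>i. t (N + i) = switch_digit s i"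
  shows "inter_dim t = d * full_dim"
proof (rule inter_dim_eq[OF assms(1), where N = N])
  fix n
  have "(t (N + i) = 0) = (s (Suc i) = s i)" for i using assms(2)[of i] by auto
  then show "repeats s n = (\<Sum>i<n. of_bool (t (N + i) = 0))" by (simp add: repeats_def)
qed

lemma admissible_dim:
  assumes "admissible s" "(\<lambda>n. repeats s n / n) \<longlonglongrightarrow> d"
  shows "d * full_dim \<in> dim_set \<alpha>"
proof -
  define t :: "nat \<Rightarrow> int" where "t i = switch_digit s i" for i
  have "tails_small t" unfolding t_def using assms(1) by (intro tails_small_switches) (simp add: admissible_def)
  moreover have "digits t" by (auto simp: digits_iff t_def)
  moreover have "inter_dim t = d * full_dim"
    using assms(2) by (rule inter_dim_switches[where N = 0]) (simp add: t_def)
  ultimately show ?thesis unfolding dim_set_eq by (metis (mono_tags, lifting) image_eqI mem_Collect_eq)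
qed

lemma inter_dim_zero: assumes "\<And>i. t (N + i) = 0" shows "inter_dim t = full_dim"
proof -
  have "(\<lambda>n. real n / real n) \<longlonglongrightarrow> 1"
    by (rule Lim_transform_eventually[OF tendsto_const], rule eventually_mono[OF eventually_gt_at_top[of 0]]) auto
  then show ?thesis using inter_dim_eq[of "\<lambda>n. n" 1 t N] assms by simp
qed

lemma inter_dim_nonzero: assumes "\<And>i. t i \<noteq> 0" shows "inter_dim t = 0"
  using inter_dim_eq[of "\<lambda>n. 0" 0 t 0] assms by simp

lemma full_dim_in: "full_dim \<in> dim_set \<alpha>"
  unfolding dim_set_eq using inter_dim_zero[of "\<lambda>_. 0" 0] tails_small_zero
  by (intro image_eqI[of _ _ "\<lambda>_. 0"]) (auto simp: digits_iff)

lemma zero_in: "0 \<in> dim_set \<alpha>"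
  unfolding dim_set_eq using inter_dim_nonzero[of "\<lambda>_. 1"] tails_small_one
  by (intro image_eqI[of _ _ "\<lambda>_. 1"]) (auto simp: digits_iff)

lemma dim_set_cases:
  assumes "x \<in> dim_set \<alpha>" "\<alpha>\<^sup>2 - 3 * \<alpha> + 1 < 0"
  obtains "x = 0" | "x = full_dim"
    | s where "admissible s" "\<And>d. (\<lambda>n. repeats s n / n) \<longlonglongrightarrow> d \<Longrightarrow> x = d * full_dim"
proof -
  obtain t where t: "digits t" "tails_small t" "x = inter_dim t" using assms(1) unfolding dim_set_eq by blast
  show thesis
  proof (cases rule: tails_small_cases[OF t(1,2) assms(2)])
    case (1 c)
    then have "t i \<noteq> 0" for i using 1(2)[of i] by auto
    then show thesis using inter_dim_nonzero t(3) that(1) by simp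
  next
    case (2 N)
    then show thesis using inter_dim_zero[of t N] t(3) that(2) by simp
  next
    case (3 N s)
    have "admissible s" unfolding admissible_def using tails_small_switchesD[OF t(2) 3] by blast
    moreover have "x = d * full_dim" if "(\<lambda>n. repeats s n / n) \<longlonglongrightarrow> d" for d
      using inter_dim_switches[OF that 3] t(3) by simp
    ultimately show thesis by (rule that(3))
  qed
qed

section \<open>The dimensions above, at and below the critical base\<close>

definition per_freq :: "nat \<Rightarrow> real" where
  "per_freq k = 1 / 3 + (- 1 / 2) ^ k * (2 / 3)"

lemma freq_limit_0: "freq_near s c 0 \<Longrightarrow> (\<lambda>n. repeats s n / n) \<longlonglongrightarrow> c"
  by (rule freq_limit[where \<epsilon> = "\<lambda>_. 0"]) auto

lemma freq_near_per: "freq_near ((tm_subst ^^ k) (\<lambda>_. c)) (per_freq k) 0"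
  using freq_near_subst_pow[OF freq_near_const[of c], of k] by (simp add: per_freq_def)

lemma admissible_per:
  assumes "wval \<alpha> (per k) < hole"
  shows "admissible (per k)"
  unfolding admissible_def using assms wval_le[OF norm_shift_per_le[of k]] order_le_less_trans by blast

lemma per_dim_in: "wval \<alpha> (per k) < hole \<Longrightarrow> per_freq k * full_dim \<in> dim_set \<alpha>"
  using admissible_dim[OF admissible_per freq_limit_0[OF freq_near_per[of k False, folded per_def]]] .

lemma norm_shift_subst_pow_const: "norm_shift ((tm_subst ^^ j) (\<lambda>_. c)) 0 = per j"
  by (auto simp: norm_shift_def per_def tm_subst_pow fun_eq_iff)

text \<open>
  At or above the critical base every normalized tail lies below the Thue-Morse word, so that renormalization applies.
\<close>

lemma admissible_cases:
  assumes "admissible s" "hole \<le> wval \<alpha> tm"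
  shows "(\<exists>j. wval \<alpha> (per j) < hole \<and> (\<lambda>n. repeats s n / n) \<longlonglongrightarrow> per_freq j) \<or>
    (\<forall>k. \<exists>N s'. \<forall>i. s (Suc N + i) = (tm_subst ^^ k) s' i)"
proof -
  define s1 where "s1 i = s (1 + i)" for i
  have rel1: "norm_shift s1 i = norm_shift s (Suc i)" for i unfolding s1_def norm_shift_add by simp
  have "tm_bounded s1"
    unfolding tm_bounded_def rel1 using assms by (intro allI lex_less_of_wval) (auto simp: admissible_def intro: less_le_trans)
  from renormalize[OF this] show ?thesis
  proof
    assume "\<exists>j N c. \<forall>i. s1 (N + i) = (tm_subst ^^ j) (\<lambda>_. c) i"
    then obtain j N c where j: "\<And>i. s1 (N + i) = (tm_subst ^^ j) (\<lambda>_. c) i" by blast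
    then have eq: "(\<lambda>i. s1 (N + i)) = (tm_subst ^^ j) (\<lambda>_. c)" by auto
    have "norm_shift s1 N = per j" using norm_shift_add[of s1 N 0] norm_shift_subst_pow_const[of j c] by (simp add: eq)
    moreover have "wval \<alpha> (norm_shift s1 N) < hole" using assms(1) unfolding rel1 admissible_def by blast
    ultimately have "wval \<alpha> (per j) < hole" by simp
    moreover have "freq_near s1 (per_freq j) 0" using freq_near_per[of j c] eq by (intro freq_near_shift[of s1 N]) simp_all
    then have "freq_near s (per_freq j) 0" by (intro freq_near_shift[of s 1]) (simp_all add: s1_def[abs_def])
    ultimately show ?thesis using freq_limit_0 by blast
  next
    assume "\<forall>k. \<exists>N s'. \<forall>i. s1 (N + i) = (tm_subst ^^ k) s' i"
    then show ?thesis by (simp add: s1_def)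
  qed
qed

lemma per_dim:
  assumes "1 \<le> n"
  shows "per_freq (n + 1) * full_dim = ln 2 / ln \<alpha> * (\<Sum>i=1..n. (- 1 / 2) ^ i)"
proof -
  have "(\<Sum>i=1..n. (- 1 / 2 :: real) ^ i) = - per_freq (n + 1)" if "1 \<le> n" for n
    using that
  proof (induction n rule: dec_induct)
    case base
    then show ?case by (simp add: per_freq_def power2_eq_square)
  next
    case (step n)
    then show ?case by (simp add: per_freq_def field_simps)
  qed
  then show ?thesis using assms by simp
qed

lemma per_freq_0: "per_freq 0 = 1" and per_freq_1: "per_freq (Suc 0) = 0"
  by (simp_all add: per_freq_def)

text \<open>
  The levels 0 and 1 have the frequencies 1 and 0 and thus give the two dimensions that are present anyway.
\<close>

lemma per_freq_dims:
  "{0, full_dim} \<union> (\<lambda>j. per_freq j * full_dim) ` A =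
   {0, full_dim} \<union> {ln 2 / ln \<alpha> * (\<Sum>i=1..n. (- 1 / 2) ^ i) | n. 1 \<le> n \<and> Suc n \<in> A}"
proof -
  have "(\<lambda>j. per_freq j * full_dim) ` A \<subseteq>
     {0, full_dim} \<union> {ln 2 / ln \<alpha> * (\<Sum>i=1..n. (- 1 / 2) ^ i) | n. 1 \<le> n \<and> Suc n \<in> A}"
  proof
    fix x assume "x \<in> (\<lambda>j. per_freq j * full_dim) ` A"
    then obtain j where j: "j \<in> A" "x = per_freq j * full_dim" by blast
    consider "j = 0" | "j = Suc 0" | n where "j = Suc n" "1 \<le> n"
      by (metis One_nat_def Suc_le_eq gr0_conv_Suc neq0_conv)
    then show "x \<in> {0, full_dim} \<union> {ln 2 / ln \<alpha> * (\<Sum>i=1..n. (- 1 / 2) ^ i) | n. 1 \<le> n \<and> Suc n \<in> A}"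
    proof cases
      case 3
      then have "x = ln 2 / ln \<alpha> * (\<Sum>i=1..n. (- 1 / 2) ^ i)" using per_dim[of n] j by simp
      then show ?thesis using 3 j by blast
    qed (use j per_freq_0 per_freq_1 in simp_all)
  qed
  moreover have "{ln 2 / ln \<alpha> * (\<Sum>i=1..n. (- 1 / 2) ^ i) | n. 1 \<le> n \<and> Suc n \<in> A} \<subseteq>
      (\<lambda>j. per_freq j * full_dim) ` A"
    using per_dim by (auto simp: image_iff) (metis Suc_eq_plus1 One_nat_def)
  ultimately show ?thesis by blast
qed

text \<open>
  The bound lies strictly below the value of the Thue-Morse word, and hence below the value of every word that shares
  a sufficiently long prefix with it.  This excludes unlimited renormalization and all but finitely many levels;
  the remaining levels are downward closed since the period doubling words increase.
\<close>

theorem dim_set_finite: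
  assumes "hole < wval \<alpha> tm" "\<alpha>\<^sup>2 - 3 * \<alpha> + 1 < 0"
  shows "\<exists>nstar. dim_set \<alpha> = {0, full_dim} \<union>
     {ln 2 / ln \<alpha> * (\<Sum>i=1..n. (- 1 / 2) ^ i) | n. 1 \<le> n \<and> n \<le> nstar}"
proof -
  define A where "A = {j. wval \<alpha> (per j) < hole}"
  have down: "j \<in> A" if "Suc j \<in> A" for j
    using that wval_less[OF per_less_Suc[of j]] by (simp add: A_def)
  have "\<forall>\<^sub>F k in sequentially. \<alpha> ^ (2 ^ k) < wval \<alpha> tm - hole"
    using order_tendstoD(2)[OF pow_pow_tendsto[of \<alpha>]] assms(1) pos less_half by simp
  then obtain k where k: "\<alpha> ^ (2 ^ k) < wval \<alpha> tm - hole" by (auto simp: eventually_sequentially)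
  have above: "hole < wval \<alpha> x" if "\<And>i. i < 2 ^ k \<Longrightarrow> x i = tm i" for x
    using wval_prefix[of "2 ^ k" x tm] that k by fastforce
  have dims: "dim_set \<alpha> = {0, full_dim} \<union> (\<lambda>j. per_freq j * full_dim) ` A"
  proof (intro equalityI subsetI)
    fix x assume x: "x \<in> dim_set \<alpha>"
    show "x \<in> {0, full_dim} \<union> (\<lambda>j. per_freq j * full_dim) ` A"
    proof (cases rule: dim_set_cases[OF x assms(2)])
      case (3 s)
      have "\<not> (\<forall>k. \<exists>N s'. \<forall>i. s (Suc N + i) = (tm_subst ^^ k) s' i)"
      proof
        assume "\<forall>k. \<exists>N s'. \<forall>i. s (Suc N + i) = (tm_subst ^^ k) s' i"
        then obtain N s' where "\<And>i. s (Suc N + i) = (tm_subst ^^ k) s' i" by metis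
        then have "(\<lambda>i. s (Suc N + i)) = (tm_subst ^^ k) s'" by auto
        then have "norm_shift s (Suc N) = norm_shift ((tm_subst ^^ k) s') 0" using norm_shift_add[of s "Suc N" 0] by simp
        then have "hole < wval \<alpha> (norm_shift s (Suc N))" using above[of "norm_shift s (Suc N)"] tm_subst_pow_prefix[of _ k s'] by simp
        then show False using 3(1) by (auto simp: admissible_def dest: spec[of _ N])
      qed
      then obtain j where "j \<in> A" "(\<lambda>n. repeats s n / n) \<longlonglongrightarrow> per_freq j"
        using admissible_cases[OF 3(1) less_imp_le[OF assms(1)]] unfolding A_def mem_Collect_eq by meson
      then show ?thesis using 3(2) by blast
    qed auto
  next
    fix x assume "x \<in> {0, full_dim} \<union> (\<lambda>j. per_freq j * full_dim) ` A"
    then show "x \<in> dim_set \<alpha>" using zero_in full_dim_in per_dim_in by (auto simp: A_def)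
  qed
  have ex: "\<exists>n. n + 2 \<notin> A"
  proof -
    have "per (k + 2) i = tm i" if "i < 2 ^ k" for i
      using that by (intro per_prefix) (auto intro: less_le_trans)
    then have "k + 2 \<notin> A" using above[of "per (k + 2)"] by (simp add: A_def)
    then show ?thesis by blast
  qed
  define m where "m = (LEAST n. n + 2 \<notin> A)"
  have m: "m + 2 \<notin> A" unfolding m_def using ex by (rule LeastI_ex)
  have "n + 2 \<notin> A" if "m \<le> n" for n
    using that by (induction n rule: dec_induct) (use m down in auto)
  moreover have "n + 2 \<in> A" if "n < m" for n using that not_less_Least unfolding m_def by blast
  ultimately have iff: "n + 2 \<in> A \<longleftrightarrow> n < m" for n by (metis not_le)
  have "1 \<le> n \<and> Suc n \<in> A \<longleftrightarrow> 1 \<le> n \<and> n \<le> m" for n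
    using iff[of "n - 1"] by (cases n) auto
  then show ?thesis unfolding dims per_freq_dims by (intro exI[of _ m]) (simp only:)
qed

text \<open>
  Unlimited renormalization gives the frequency 1/3, and the Thue-Morse word realizes it: its proper
  normalized tails are strictly smaller than the word itself.
\<close>

theorem dim_set_critical:
  assumes "hole = wval \<alpha> tm" "\<alpha>\<^sup>2 - 3 * \<alpha> + 1 < 0"
  shows "dim_set \<alpha> = {0, full_dim, full_dim / 3} \<union>
     {ln 2 / ln \<alpha> * (\<Sum>i=1..n. (- 1 / 2) ^ i) | n. 1 \<le> n}"
proof -
  have third: "(\<lambda>n. repeats s n / n) \<longlonglongrightarrow> 1 / 3"
    if ren: "\<forall>k. \<exists>N s'. \<forall>i. s (Suc N + i) = (tm_subst ^^ k) s' i" for s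
  proof (rule freq_limit)
    fix k :: nat
    obtain N s' where "\<And>i. s (Suc N + i) = (tm_subst ^^ k) s' i" using ren by metis
    then have "(\<lambda>i. s (Suc N + i)) = (tm_subst ^^ k) s'" by auto
    then show "freq_near s (1 / 3) (2 / 3 / 2 ^ k)"
      using freq_near_subst_pow[OF freq_near_trivial[of s'], of k] by (intro freq_near_shift[of s "Suc N"]) simp_all
  next
    show "(\<lambda>k. 2 / 3 / 2 ^ k :: real) \<longlonglongrightarrow> 0"
      using tendsto_mult_right_zero[OF LIMSEQ_realpow_zero[of "1/2 :: real"], of "2/3"] by (simp add: power_one_over)
  qed
  have all: "wval \<alpha> (per j) < hole" for j unfolding assms(1) by (rule wval_less[OF per_less_tm])
  have "dim_set \<alpha> = {full_dim / 3} \<union> ({0, full_dim} \<union> (\<lambda>j. per_freq j * full_dim) ` UNIV)"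
  proof (intro equalityI subsetI)
    fix x assume x: "x \<in> dim_set \<alpha>"
    show "x \<in> {full_dim / 3} \<union> ({0, full_dim} \<union> (\<lambda>j. per_freq j * full_dim) ` UNIV)"
    proof (cases rule: dim_set_cases[OF x assms(2)])
      case (3 s)
      from admissible_cases[OF 3(1) eq_refl[OF assms(1)]] consider
          j where "(\<lambda>n. repeats s n / n) \<longlonglongrightarrow> per_freq j"
        | "\<forall>k. \<exists>N s'. \<forall>i. s (Suc N + i) = (tm_subst ^^ k) s' i" by meson
      then show ?thesis
      proof cases
        case 1
        then show ?thesis using 3(2) by blast
      next
        case 2
        then show ?thesis using 3(2)[OF third] by auto
      qed
    qed auto
  next
    fix x assume "x \<in> {full_dim / 3} \<union> ({0, full_dim} \<union> (\<lambda>j. per_freq j * full_dim) ` UNIV)"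
    moreover have "full_dim / 3 \<in> dim_set \<alpha>"
    proof -
      have "admissible tm"
        unfolding admissible_def assms(1) using wval_less[OF norm_shift_tm_less] by simp
      moreover have "(\<lambda>n. repeats tm n / n) \<longlonglongrightarrow> 1 / 3"
      proof (rule third, rule allI)
        fix k
        have "tm (Suc (2 ^ k - 1) + i) = (tm_subst ^^ k) (\<lambda>i. tm (1 + i)) i" for i
          using tm_subst_pow_shift[of k tm 1 i] by (simp add: tm_subst_pow_tm)
        then show "\<exists>N s'. \<forall>i. tm (Suc N + i) = (tm_subst ^^ k) s' i" by blast
      qed
      ultimately have "1 / 3 * full_dim \<in> dim_set \<alpha>" by (rule admissible_dim)
      then show ?thesis by (metis mult_1 times_divide_eq_left)
    qed
    ultimately show "x \<in> dim_set \<alpha>" using zero_in full_dim_in per_dim_in[OF all] by auto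
  qed
  then show ?thesis unfolding per_freq_dims by auto
qed

text \<open>
  The letter is repeated exactly where the integer part of c n increases.
\<close>

lemma sequence_with_freq:
  assumes "0 \<le> c" "c \<le> 1"
  shows "\<exists>s. freq_near s c 0"
proof -
  define r where "r i \<longleftrightarrow> \<lfloor>c * (real i + 1)\<rfloor> \<noteq> \<lfloor>c * real i\<rfloor>" for i :: nat
  define s where "s = rec_nat False (\<lambda>i b. if r i then b else \<not> b)"
  have s: "s (Suc i) = s i \<longleftrightarrow> r i" for i by (simp add: s_def)
  have "int (repeats s n) = \<lfloor>c * real n\<rfloor>" for n
  proof (induction n)
    case (Suc n)
    have "\<lfloor>c * (real n + 1)\<rfloor> = \<lfloor>c * real n\<rfloor> + of_bool (r n)"
    proof -
      have "c * (real n + 1) = c * real n + c" by (simp add: algebra_simps)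
      then have "\<lfloor>c * real n\<rfloor> \<le> \<lfloor>c * (real n + 1)\<rfloor>" "\<lfloor>c * (real n + 1)\<rfloor> \<le> \<lfloor>c * real n\<rfloor> + 1"
        using assms by linarith+
      then show ?thesis by (auto simp: r_def)
    qed
    moreover have "repeats s (Suc n) = repeats s n + of_bool (r n)" by (simp add: repeats_def s)
    ultimately show ?case using Suc by (simp add: add.commute)
  qed (simp add: repeats_def)
  then have "real (repeats s n) = of_int \<lfloor>c * real n\<rfloor>" for n by (metis of_int_of_nat_eq)
  then have "\<bar>real (repeats s n) - c * n\<bar> \<le> 0 * real n + 1" for n by simp linarith
  then show ?thesis unfolding freq_near_def by (intro exI[of _ s] exI[of _ 1] allI)
qed

text \<open>
  An even level is chosen so that the affine map of frequencies is increasing.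
\<close>

theorem dim_set_interval:
  assumes "wval \<alpha> tm < hole"
  shows "\<exists>a b. a < b \<and> {a..b} \<subseteq> dim_set \<alpha>"
proof -
  have "\<forall>\<^sub>F k in sequentially. \<alpha> ^ (2 ^ k) < hole - wval \<alpha> tm"
    using order_tendstoD(2)[OF pow_pow_tendsto[of \<alpha>]] assms(1) pos less_half by simp
  then obtain k0 where k0: "\<And>k. k \<ge> k0 \<Longrightarrow> \<alpha> ^ (2 ^ k) < hole - wval \<alpha> tm" by (auto simp: eventually_sequentially)
  define k where "k = 2 * k0"
  have "(tm_subst ^^ k) word01 i = tm i" if "i < 2 ^ k" for i using that by (simp add: tm_subst_pow word01_def)
  then have small: "wval \<alpha> ((tm_subst ^^ k) word01) < hole"
    using wval_prefix[of "2 ^ k" "(tm_subst ^^ k) word01" tm] k0[of k] by (auto simp: k_def)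
  have adm: "admissible ((tm_subst ^^ k) s)" for s
    unfolding admissible_def using wval_le[OF norm_shift_subst_pow_le[of k s]] small order_le_less_trans by blast
  have fd: "0 < full_dim" using pos less_half by (simp add: divide_pos_neg)
  have pow: "(- 1 / 2 :: real) ^ k = 1 / 2 ^ k" by (simp add: k_def power_mult power_divide power2_eq_square)
  have val_in: "(1 / 3 + 1 / 2 ^ k * (c - 1 / 3)) * full_dim \<in> dim_set \<alpha>" if c: "0 \<le> c" "c \<le> 1" for c
  proof -
    obtain s where "freq_near s c 0" using sequence_with_freq[OF c] by blast
    from freq_near_subst_pow[OF this, of k] have "freq_near ((tm_subst ^^ k) s) (1 / 3 + 1 / 2 ^ k * (c - 1 / 3)) 0"
      unfolding pow by simp
    then show ?thesis using admissible_dim[OF adm freq_limit_0] by blast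
  qed
  define lo where "lo = (1 / 3 + 1 / 2 ^ k * (0 - 1 / 3)) * full_dim"
  define hi where "hi = (1 / 3 + 1 / 2 ^ k * (1 - 1 / 3)) * full_dim"
  have "1 / 2 ^ k * (0 - 1 / 3) < 1 / 2 ^ k * (1 - 1 / 3 :: real)" by (rule mult_strict_left_mono) simp_all
  then have "lo < hi" unfolding lo_def hi_def by (intro mult_strict_right_mono add_strict_left_mono fd)
  moreover have "{lo..hi} \<subseteq> dim_set \<alpha>"
  proof
    fix y assume y: "y \<in> {lo..hi}"
    define z where "z = y / full_dim"
    have scale: "w = w / F * F" "(u * F \<le> v * F) = (u \<le> v)" if "0 < F" for u v w F :: real using that by simp_all
    have yz: "y = z * full_dim" unfolding z_def by (rule scale(1)[OF fd])
    have z: "1 / 3 + 1 / 2 ^ k * (0 - 1 / 3) \<le> z" "z \<le> 1 / 3 + 1 / 2 ^ k * (1 - 1 / 3)"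
      using y unfolding yz lo_def hi_def atLeastAtMost_iff scale(2)[OF fd] by blast+
    define c where "c = 1 / 3 + (z - 1 / 3) * 2 ^ k"
    have "0 \<le> c" "c \<le> 1" using z by (simp_all add: c_def field_simps)
    moreover have "1 / 3 + 1 / 2 ^ k * (c - 1 / 3) = z" by (simp add: c_def)
    ultimately show "y \<in> dim_set \<alpha>" using val_in[of c] yz by simp
  qed
  ultimately show ?thesis by blast
qed

end


section \<open>The Thue-Morse power series\<close>

text \<open>
  The signs of the Thue-Morse sequence.  Their power series is the infinite product of the factors 1 - x^(2^k).
\<close>

definition tm_coeff :: "nat \<Rightarrow> int" where "tm_coeff i = (if tm i then -1 else 1)"

definition tm_series :: "real \<Rightarrow> real" where "tm_series x = (\<Sum>i. of_int (tm_coeff i) * x ^ i)"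

definition tm_prod :: "nat \<Rightarrow> real \<Rightarrow> real" where "tm_prod k x = (\<Prod>j<k. 1 - x ^ 2 ^ j)"

lemma tm_coeff_even: "tm_coeff (2 * i) = tm_coeff i" and tm_coeff_odd: "tm_coeff (Suc (2 * i)) = - tm_coeff i"
  by (simp_all add: tm_coeff_def)

lemma tm_coeff_0 [simp]: "tm_coeff 0 = 1" by (simp add: tm_coeff_def)

lemma abs_tm_coeff: "\<bar>of_int (tm_coeff i) :: real\<bar> = 1" by (simp add: tm_coeff_def)

lemma tm_series_sums:
  assumes "\<bar>x\<bar> < 1"
  shows "(\<lambda>i. of_int (tm_coeff i) * x ^ i) sums tm_series x"
proof -
  have "summable (\<lambda>i. of_int (tm_coeff i) * x ^ i)"
  proof (rule summable_comparison_test)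
    show "summable (\<lambda>i. \<bar>x\<bar> ^ i)" using assms by (intro summable_geometric) simp
    show "\<exists>N. \<forall>n\<ge>N. norm (of_int (tm_coeff n) * x ^ n) \<le> \<bar>x\<bar> ^ n"
      by (simp add: abs_mult abs_tm_coeff power_abs)
  qed
  then show ?thesis unfolding tm_series_def by (rule summable_sums)
qed

lemma tm_series_rec:
  assumes "\<bar>x\<bar> < 1"
  shows "tm_series x = (1 - x) * tm_series (x\<^sup>2)"
proof -
  have x2: "\<bar>x\<^sup>2\<bar> < 1" using assms by (simp add: abs_square_less_1)
  have "(\<lambda>n. \<Sum>i\<in>{n * 2..<n * 2 + 2}. of_int (tm_coeff i) * x ^ i) sums tm_series x"
    by (rule sums_group[OF tm_series_sums[OF assms]]) simp
  moreover have "(\<Sum>i\<in>{n * 2..<n * 2 + 2}. of_int (tm_coeff i) * x ^ i) = (1 - x) * (of_int (tm_coeff n) * (x\<^sup>2) ^ n)" for n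
  proof -
    have "{n * 2..<n * 2 + 2} = {2 * n, Suc (2 * n)}" by auto
    then have "(\<Sum>i\<in>{n * 2..<n * 2 + 2}. of_int (tm_coeff i) * x ^ i) =
        of_int (tm_coeff (2 * n)) * x ^ (2 * n) + of_int (tm_coeff (Suc (2 * n))) * x ^ Suc (2 * n)"
      by simp
    also have "\<dots> = (1 - x) * (of_int (tm_coeff n) * (x\<^sup>2) ^ n)"
      unfolding tm_coeff_even tm_coeff_odd power_Suc power_mult by (simp add: algebra_simps)
    finally show ?thesis .
  qed
  ultimately have "(\<lambda>n. (1 - x) * (of_int (tm_coeff n) * (x\<^sup>2) ^ n)) sums tm_series x" by simp
  moreover have "(\<lambda>n. (1 - x) * (of_int (tm_coeff n) * (x\<^sup>2) ^ n)) sums ((1 - x) * tm_series (x\<^sup>2))"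
    by (rule sums_mult[OF tm_series_sums[OF x2]])
  ultimately show ?thesis by (rule sums_unique2)
qed

lemma tm_series_prod:
  assumes "\<bar>x\<bar> < 1"
  shows "tm_series x = tm_prod k x * tm_series (x ^ 2 ^ k)"
proof (induction k)
  case (Suc k)
  have "\<bar>x ^ 2 ^ k\<bar> < 1" using assms by (simp add: power_abs power_less_one_iff)
  from tm_series_rec[OF this] have "tm_series (x ^ 2 ^ k) = (1 - x ^ 2 ^ k) * tm_series (x ^ 2 ^ Suc k)"
    by (simp add: power_mult[symmetric] mult.commute)
  then show ?case using Suc by (simp add: tm_prod_def mult.assoc)
qed (simp add: tm_prod_def)

lemma tm_series_near_0:
  assumes "0 \<le> x" "x < 1"
  shows "\<bar>tm_series x - 1\<bar> \<le> x / (1 - x)"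
proof -
  have 1: "(\<lambda>i. of_int (tm_coeff (Suc i)) * x ^ Suc i) sums (tm_series x - 1)"
    using sums_split_initial_segment[OF tm_series_sums, of x 1] assms by simp
  have 2: "(\<lambda>i. x ^ Suc i) sums (x / (1 - x))"
    using sums_mult[OF geometric_sums[of x], of x] assms by simp
  have le: "\<bar>of_int (tm_coeff (Suc i)) * x ^ Suc i\<bar> \<le> x ^ Suc i" for i
    using assms by (simp only: abs_mult abs_tm_coeff) simp
  have "tm_series x - 1 \<le> x / (1 - x)"
  proof (rule sums_le[OF _ 1 2])
    show "of_int (tm_coeff (Suc i)) * x ^ Suc i \<le> x ^ Suc i" for i using le[of i] by linarith
  qed
  moreover have "- (x / (1 - x)) \<le> tm_series x - 1"
  proof (rule sums_le[OF _ sums_minus[OF 2] 1])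
    show "- (x ^ Suc i) \<le> of_int (tm_coeff (Suc i)) * x ^ Suc i" for i using le[of i] by linarith
  qed
  ultimately show ?thesis by linarith
qed

lemma isCont_tm_series: "\<bar>x\<bar> < 1 \<Longrightarrow> isCont tm_series x"
proof -
  assume "\<bar>x\<bar> < 1"
  then obtain K where K: "\<bar>x\<bar> < K" "K < 1" using dense by blast
  then have "summable (\<lambda>n. of_int (tm_coeff n) * K ^ n)"
    using sums_summable[OF tm_series_sums[of K]] by auto
  then have "isCont (\<lambda>x. \<Sum>n. of_int (tm_coeff n) * x ^ n) x"
    using K by (intro isCont_powser[of _ K]) auto
  then show ?thesis unfolding tm_series_def[abs_def] .
qed

lemma tm_series_0 [simp]: "tm_series 0 = 1"
  using tm_series_near_0[of 0] by simp

lemma tm_prod_pos: "0 \<le> x \<Longrightarrow> x < 1 \<Longrightarrow> 0 < tm_prod k x"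
  unfolding tm_prod_def by (intro prod_pos) (simp add: power_less_one_iff)

lemma tm_series_pow_tendsto:
  assumes "0 \<le> x" "x < 1"
  shows "(\<lambda>k. tm_series (x ^ 2 ^ k)) \<longlonglongrightarrow> 1"
  using isCont_tendsto_compose[OF isCont_tm_series pow_pow_tendsto[OF assms]] by simp

lemma tm_prod_tendsto:
  assumes "0 \<le> x" "x < 1"
  shows "(\<lambda>k. tm_prod k x) \<longlonglongrightarrow> tm_series x"
proof -
  note c = tm_series_pow_tendsto[OF assms]
  then have "(\<lambda>k. tm_series x / tm_series (x ^ 2 ^ k)) \<longlonglongrightarrow> tm_series x / 1"
    by (intro tendsto_intros) auto
  moreover have "\<forall>\<^sub>F k in sequentially. tm_series x / tm_series (x ^ 2 ^ k) = tm_prod k x"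
  proof -
    have "\<forall>\<^sub>F k in sequentially. tm_series (x ^ 2 ^ k) > 0" using order_tendstoD(1)[OF c, of 0] by simp
    then show ?thesis
    proof eventually_elim
      case (elim k)
      then show ?case using tm_series_prod[of x k] assms by simp
    qed
  qed
  ultimately show ?thesis using Lim_transform_eventually by fastforce
qed

lemma tm_series_nonneg: "0 \<le> x \<Longrightarrow> x < 1 \<Longrightarrow> 0 \<le> tm_series x"
  using LIMSEQ_le_const[OF tm_prod_tendsto[of x], of 0] tm_prod_pos[of x] less_imp_le by blast

lemma tm_series_antimono:
  assumes "0 \<le> x" "x \<le> y" "y < 1"
  shows "tm_series y \<le> tm_series x"
proof (rule LIMSEQ_le[OF tm_prod_tendsto tm_prod_tendsto])
  have "tm_prod k y \<le> tm_prod k x" for k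
    unfolding tm_prod_def using assms
    by (intro prod_mono) (auto simp: power_le_one intro: power_mono)
  then show "\<exists>N. \<forall>n\<ge>N. tm_prod n y \<le> tm_prod n x" by blast
qed (use assms in auto)

lemma tm_series_le_1: "0 \<le> x \<Longrightarrow> x < 1 \<Longrightarrow> tm_series x \<le> 1"
  using tm_series_antimono[of 0 x] by simp

lemma tm_series_pos:
  assumes "0 \<le> x" "x < 1"
  shows "0 < tm_series x"
proof -
  note c = tm_series_pow_tendsto[OF assms]
  then have "\<forall>\<^sub>F k in sequentially. tm_series (x ^ 2 ^ k) > 0" using order_tendstoD(1)[OF c, of 0] by simp
  then obtain k where "tm_series (x ^ 2 ^ k) > 0" by (auto simp: eventually_sequentially)
  then show ?thesis using tm_series_prod[of x k] tm_prod_pos[OF assms, of k] assms by simp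
qed

section \<open>The critical base\<close>

definition KL_rhs :: "real \<Rightarrow> real" where "KL_rhs x = (3 * x - 1) / (1 - x)\<^sup>2"

lemma tm_sums:
  assumes "0 < x" "x < 1"
  shows "(\<lambda>i. of_bool (tm i) * x ^ i) sums ((1 / (1 - x) - tm_series x) / 2)"
proof -
  have "(\<lambda>i. (x ^ i - of_int (tm_coeff i) * x ^ i) / 2) sums ((1 / (1 - x) - tm_series x) / 2)"
    using assms by (intro sums_divide sums_diff geometric_sums tm_series_sums) auto
  moreover have "(x ^ i - of_int (tm_coeff i) * x ^ i) / 2 = of_bool (tm i) * x ^ i" for i
    by (simp add: tm_coeff_def)
  ultimately show ?thesis by simp
qed

text \<open>
  Summation by parts expresses the differences of the Thue-Morse sequence by the sequence, and the latter is an affine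
  function of its signs.
\<close>

lemma KL_equation_iff:
  assumes x: "0 < x" "x < 1"
  shows "KL_equation x \<longleftrightarrow> tm_series x = KL_rhs x"
proof -
  define T where "T = (1 / (1 - x) - tm_series x) / 2"
  have T: "(\<lambda>i. of_bool (tm i) * x ^ i) sums T" unfolding T_def by (rule tm_sums[OF x])
  have T1: "(\<lambda>i. of_bool (tm (Suc i)) * x ^ Suc i) sums T"
    using sums_split_initial_segment[OF T, of 1] by simp
  have T2: "(\<lambda>i. x * (of_bool (tm i) * x ^ i)) sums (x * T)" by (rule sums_mult[OF T])
  have T3: "(\<lambda>i. x * x ^ i) sums (x * (1 / (1 - x)))" using x by (intro sums_mult geometric_sums) auto
  have "(\<lambda>i. x * x ^ i + (of_bool (tm (Suc i)) * x ^ Suc i - x * (of_bool (tm i) * x ^ i))) sums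
      (x * (1 / (1 - x)) + (T - x * T))"
    by (intro sums_add sums_diff T1 T2 T3)
  moreover have "x * x ^ i + (of_bool (tm (Suc i)) * x ^ Suc i - x * (of_bool (tm i) * x ^ i)) =
      of_int (1 + tm_diff (Suc i)) * x ^ Suc i" for i
    by (simp add: tm_diff_def thue_morse_tm algebra_simps)
  ultimately have s: "(\<lambda>i. of_int (1 + tm_diff (Suc i)) * x ^ Suc i) sums (x * (1 / (1 - x)) + (T - x * T))"
    by simp
  have "KL_equation x \<longleftrightarrow> x * (1 / (1 - x)) + (T - x * T) = 1"
    unfolding KL_equation_def
  proof
    assume "(\<lambda>i. of_int (1 + tm_diff (Suc i)) * x ^ Suc i) sums 1"
    then show "x * (1 / (1 - x)) + (T - x * T) = 1" by (rule sums_unique2[OF s])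
  qed (use s in simp)
  also have "x * (1 / (1 - x)) + (T - x * T) = 1 + (3 * x - 1 - (1 - x)\<^sup>2 * tm_series x) / (2 * (1 - x))"
  proof -
    define d where "d = 1 - x"
    have d: "d \<noteq> 0" "x = 1 - d" using x by (simp_all add: d_def)
    have "x * (1 / d) = 1 / d - 1" using d by (simp add: field_simps)
    moreover have "T - x * T = (1 - d * tm_series x) / 2"
    proof -
      have "T - x * T = d * T" by (simp add: d_def algebra_simps)
      also have "\<dots> = (1 - d * tm_series x) / 2" using d(1) by (simp add: T_def d_def[symmetric] field_simps)
      finally show ?thesis .
    qed
    moreover have "(3 * x - 1 - d\<^sup>2 * tm_series x) / (2 * d) = 1 / d - 3 / 2 - d * tm_series x / 2"
      unfolding power2_eq_square using d by (simp add: diff_divide_distrib)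
    ultimately show ?thesis unfolding d_def[symmetric] by (simp only:) (simp add: diff_divide_distrib)
  qed
  also have "\<dots> = 1 \<longleftrightarrow> (1 - x)\<^sup>2 * tm_series x = 3 * x - 1" using x by auto
  also have "\<dots> \<longleftrightarrow> tm_series x = KL_rhs x" using x by (auto simp: KL_rhs_def field_simps)
  finally show ?thesis .
qed

lemma KL_rhs_strict_mono: "0 < x \<Longrightarrow> x < y \<Longrightarrow> y < 1 \<Longrightarrow> 1 / 3 \<le> x \<Longrightarrow> KL_rhs x < KL_rhs y"
  unfolding KL_rhs_def by (intro frac_less) (auto simp: power_strict_mono intro!: power_mono)

context overlap_base
begin

lemma wval_tm: "wval \<alpha> tm = \<alpha> * ((1 / (1 - \<alpha>) - tm_series \<alpha>) / 2)"
proof -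
  have "(\<lambda>i. \<alpha> * (of_bool (tm i) * \<alpha> ^ i)) sums (\<alpha> * ((1 / (1 - \<alpha>) - tm_series \<alpha>) / 2))"
    using pos less_half by (intro sums_mult tm_sums) auto
  then show ?thesis unfolding wval_def val_def by (simp add: sums_iff mult_ac)
qed

lemma hole_minus_wval_tm: "hole - wval \<alpha> tm = \<alpha> / 2 * (tm_series \<alpha> - KL_rhs \<alpha>)"
  unfolding wval_tm hole_def KL_rhs_def using less_half
  by (simp add: power2_eq_square divide_simps) (simp add: algebra_simps)

lemma hole_vs_wval_tm:
  "hole < wval \<alpha> tm \<longleftrightarrow> tm_series \<alpha> < KL_rhs \<alpha>"
  "hole = wval \<alpha> tm \<longleftrightarrow> tm_series \<alpha> = KL_rhs \<alpha>"
  "wval \<alpha> tm < hole \<longleftrightarrow> KL_rhs \<alpha> < tm_series \<alpha>"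
proof -
  have "hole < wval \<alpha> tm \<longleftrightarrow> \<alpha> / 2 * (tm_series \<alpha> - KL_rhs \<alpha>) < 0" using hole_minus_wval_tm by linarith
  also have "\<dots> \<longleftrightarrow> tm_series \<alpha> < KL_rhs \<alpha>" using pos by (simp add: mult_less_0_iff)
  finally show "hole < wval \<alpha> tm \<longleftrightarrow> tm_series \<alpha> < KL_rhs \<alpha>" .
  have "hole = wval \<alpha> tm \<longleftrightarrow> \<alpha> / 2 * (tm_series \<alpha> - KL_rhs \<alpha>) = 0" using hole_minus_wval_tm by linarith
  also have "\<dots> \<longleftrightarrow> tm_series \<alpha> = KL_rhs \<alpha>" using pos by simp
  finally show "hole = wval \<alpha> tm \<longleftrightarrow> tm_series \<alpha> = KL_rhs \<alpha>" .
  have "wval \<alpha> tm < hole \<longleftrightarrow> 0 < \<alpha> / 2 * (tm_series \<alpha> - KL_rhs \<alpha>)" using hole_minus_wval_tm by linarith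
  also have "\<dots> \<longleftrightarrow> KL_rhs \<alpha> < tm_series \<alpha>" using pos by (simp add: zero_less_mult_iff)
  finally show "wval \<alpha> tm < hole \<longleftrightarrow> KL_rhs \<alpha> < tm_series \<alpha>" .
qed

end

lemma tm_prod_4: "tm_prod 4 x = (1 - x) * (1 - x\<^sup>2) * (1 - x ^ 4) * (1 - x ^ 8)"
  by (simp add: tm_prod_def eval_nat_numeral)

text \<open>
  Four factors of the product suffice: the product of the others differs from 1 by less than one millionth, because the 16th power of 0.3944
  is below 1/2000000.
\<close>

lemma critical_base_bracket:
  "KL_rhs 0.394325 < tm_series 0.394325" "tm_series 0.394335 < KL_rhs 0.394335"
proof -
  have "tm_series 0.394335 = tm_prod 4 0.394335 * tm_series (0.394335 ^ 2 ^ 4)"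
    by (rule tm_series_prod) simp
  also have "\<dots> \<le> tm_prod 4 0.394335 * 1"
    by (intro mult_left_mono tm_series_le_1 less_imp_le[OF tm_prod_pos]) (simp_all add: power_less_one_iff)
  also have "\<dots> < KL_rhs 0.394335" by (simp add: tm_prod_4 KL_rhs_def power_divide)
  finally show "tm_series 0.394335 < KL_rhs 0.394335" .
  have y: "(0.394325 :: real) ^ 2 ^ 4 \<le> 1 / 2000000" by (simp add: power_divide)
  have y0: "0 \<le> (0.394325 :: real) ^ 2 ^ 4" by simp
  have "z / (1 - z) \<le> 1 / 1000000" if "0 \<le> z" "z \<le> 1 / 2000000" for z :: real
    using that by (simp add: divide_le_eq)
  from this[OF y0 y] have "(0.394325 :: real) ^ 2 ^ 4 / (1 - 0.394325 ^ 2 ^ 4) \<le> 1 / 1000000" .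
  then have "1 - 1 / 1000000 \<le> tm_series (0.394325 ^ 2 ^ 4)"
    using tm_series_near_0[of "0.394325 ^ 2 ^ 4"] y y0 by linarith
  then have "tm_prod 4 0.394325 * (1 - 1 / 1000000) \<le> tm_prod 4 0.394325 * tm_series (0.394325 ^ 2 ^ 4)"
    by (intro mult_left_mono less_imp_le[OF tm_prod_pos]) simp_all
  also have "\<dots> = tm_series 0.394325" by (rule tm_series_prod[symmetric]) simp
  finally have "tm_prod 4 0.394325 * (1 - 1 / 1000000) \<le> tm_series 0.394325" .
  moreover have "KL_rhs 0.394325 < tm_prod 4 0.394325 * (1 - 1 / 1000000)"
    by (simp add: tm_prod_4 KL_rhs_def power_divide)
  ultimately show "KL_rhs 0.394325 < tm_series 0.394325" by linarith
qed

lemma critical_base_exists: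
  obtains a where "0.394325 < a" "a < 0.394335" "tm_series a = KL_rhs a"
    "\<And>x. 1 / 3 < x \<Longrightarrow> x < a \<Longrightarrow> KL_rhs x < tm_series x"
    "\<And>x. a < x \<Longrightarrow> x < 1 / 2 \<Longrightarrow> tm_series x < KL_rhs x"
proof -
  define g where "g x = tm_series x - KL_rhs x" for x
  have cont: "isCont g x" if "0 < x" "x < 1" for x
    unfolding g_def[abs_def] KL_rhs_def using that
    by (intro continuous_intros isCont_tm_series) auto
  have "\<exists>x\<ge>0.394325. x \<le> 0.394335 \<and> g x = 0"
  proof (rule IVT2)
    show "\<forall>x. 0.394325 \<le> x \<and> x \<le> 0.394335 \<longrightarrow> isCont g x" using cont by auto
  qed (use critical_base_bracket in \<open>simp_all add: g_def\<close>)
  then obtain a where a: "0.394325 \<le> a" "a \<le> 0.394335" "g a = 0" by blast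
  have dec: "g y < g x" if "1 / 3 < x" "x < y" "y < 1 / 2" for x y
    using tm_series_antimono[of x y] KL_rhs_strict_mono[of x y] that by (simp add: g_def)
  have "g 0.394325 \<noteq> 0" "g 0.394335 \<noteq> 0" using critical_base_bracket by (simp_all add: g_def)
  then have "a \<noteq> 0.394325" "a \<noteq> 0.394335" using a(3) by metis+
  then show thesis using that[of a] a dec[of _ a] dec[of a] by (force simp: g_def)
qed


section \<open>Small integer solutions and a Liouville inequality\<close>

text \<open>
  The pigeonhole principle: the integer vectors with entries between 0 and H outnumber their possible images, so two of
  them have the same image, and their difference is a solution.
\<close>

lemma siegel:
  fixes A :: "nat \<Rightarrow> nat \<Rightarrow> int"
  assumes mn: "m < n" and B: "1 \<le> B" and A: "\<And>i j. i < m \<Longrightarrow> j < n \<Longrightarrow> \<bar>A i j\<bar> \<le> B"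
  shows "\<exists>x. (\<exists>j<n. x j \<noteq> 0) \<and> (\<forall>j<n. \<bar>x j\<bar> \<le> (2 * int n * B) ^ m) \<and>
    (\<forall>i<m. (\<Sum>j<n. A i j * x j) = 0)"
proof -
  define H where "H = (2 * int n * B) ^ m"
  have nB: "1 \<le> int n * B" using mn B mult_mono[of 1 "int n" 1 B] by simp
  have H: "1 \<le> H" unfolding H_def using nB by (intro one_le_power) linarith
  define X where "X = {..<n} \<rightarrow>\<^sub>E {0..H}"
  define Y where "Y = {..<m} \<rightarrow>\<^sub>E {- (int n * B * H)..int n * B * H}"
  define f where "f x = restrict (\<lambda>i. \<Sum>j<n. A i j * x j) {..<m}" for x
  have fXY: "f ` X \<subseteq> Y"
  proof
    fix y assume "y \<in> f ` X"
    then obtain x where x: "x \<in> X" "y = f x" by blast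
    have xj: "\<bar>x j\<bar> \<le> H" if "j < n" for j using x(1) that by (auto simp: X_def PiE_def Pi_def)
    have bnd: "\<bar>\<Sum>j<n. A i j * x j\<bar> \<le> int n * B * H" if i: "i < m" for i
    proof -
      have "\<bar>\<Sum>j<n. A i j * x j\<bar> \<le> (\<Sum>j<n. \<bar>A i j * x j\<bar>)" by (rule sum_abs)
      also have "\<dots> \<le> (\<Sum>j<n. B * H)"
        using A[OF i] xj B by (intro sum_mono) (auto simp: abs_mult intro!: mult_mono)
      finally show ?thesis by simp
    qed
    have "(\<Sum>j<n. A i j * x j) \<in> {- (int n * B * H)..int n * B * H}" if "i < m" for i
      using bnd[OF that] unfolding atLeastAtMost_iff by linarith
    then show "y \<in> Y" unfolding x(2) f_def Y_def restrict_PiE_iff by blast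
  qed
  have fin: "finite X" "finite Y" by (auto simp: X_def Y_def intro!: finite_PiE)
  have "int (card Y) < int (card X)"
  proof -
    have cX: "int (card X) = (H + 1) ^ n" using H by (simp add: X_def card_PiE)
    have cY: "int (card Y) = (2 * (int n * B * H) + 1) ^ m"
    proof -
      define T where "T = int n * B * H"
      have "0 \<le> T" unfolding T_def using H B by (intro mult_nonneg_nonneg) linarith+
      then show ?thesis unfolding Y_def T_def[symmetric] by (simp add: card_PiE)
    qed
    have "2 * (int n * B * H) + 1 \<le> (2 * int n * B) * (H + 1)" using nB by (simp add: algebra_simps)
    then have "int (card Y) \<le> ((2 * int n * B) * (H + 1)) ^ m"
      unfolding cY using H B by (intro power_mono) auto
    also have "\<dots> = H * (H + 1) ^ m" by (simp add: H_def power_mult_distrib)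
    also have "\<dots> < (H + 1) * (H + 1) ^ m" using H by (intro mult_strict_right_mono) auto
    also have "\<dots> = (H + 1) ^ Suc m" by simp
    also have "\<dots> \<le> (H + 1) ^ n" using H mn by (intro power_increasing) auto
    finally show ?thesis using cX by simp
  qed
  then have "\<not> inj_on f X" using card_inj_on_le[of f X Y] fXY fin by auto
  then obtain x y where xy: "x \<in> X" "y \<in> X" "f x = f y" "x \<noteq> y" by (auto simp: inj_on_def)
  define z where "z j = x j - y j" for j
  have "\<exists>j<n. z j \<noteq> 0"
  proof (rule ccontr)
    assume "\<not> ?thesis"
    then have "x j = y j" if "j \<in> {..<n}" for j using that by (auto simp: z_def)
    then have "x = y" using xy(1,2) unfolding X_def by (intro PiE_ext[of x "{..<n}" _ y]) auto
    then show False using xy(4) by simp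
  qed
  moreover have "\<bar>z j\<bar> \<le> H" if "j < n" for j
  proof -
    have "x j \<in> {0..H}" "y j \<in> {0..H}"
      using PiE_mem[OF xy(1)[unfolded X_def], of j] PiE_mem[OF xy(2)[unfolded X_def], of j] that by simp_all
    then show ?thesis unfolding z_def atLeastAtMost_iff by linarith
  qed
  moreover have "(\<Sum>j<n. A i j * z j) = 0" if "i < m" for i
  proof -
    have "(\<Sum>j<n. A i j * x j) = (\<Sum>j<n. A i j * y j)" using fun_cong[OF xy(3), of i] that by (simp add: f_def)
    then show ?thesis by (simp add: z_def right_diff_distrib sum_subtractf)
  qed
  ultimately show ?thesis unfolding H_def by blast
qed

text \<open>
  The length of a polynomial, a submultiplicative norm.
\<close>

definition plen :: "real poly \<Rightarrow> real" where "plen p = (\<Sum>i\<le>degree p. \<bar>coeff p i\<bar>)"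

definition int_coeffs :: "real poly \<Rightarrow> bool" where "int_coeffs p \<longleftrightarrow> (\<forall>i. coeff p i \<in> \<int>)"

lemma plen_eq: "degree p \<le> n \<Longrightarrow> plen p = (\<Sum>i\<le>n. \<bar>coeff p i\<bar>)"
  unfolding plen_def by (rule sum.mono_neutral_left) (auto simp: coeff_eq_0)

lemma plen_nonneg: "0 \<le> plen p" by (simp add: plen_def sum_nonneg)

lemma plen_0 [simp]: "plen 0 = 0" by (simp add: plen_def)

lemma plen_pCons: "plen (pCons a p) = \<bar>a\<bar> + plen p"
  by (subst plen_eq[of _ "Suc (degree p)"])
    (auto simp: degree_pCons_le sum.atMost_Suc_shift plen_def simp del: sum.atMost_Suc)

lemma plen_smult: "plen (smult c p) = \<bar>c\<bar> * plen p"
  by (subst plen_eq[of _ "degree p"]) (auto simp: degree_smult_le plen_def abs_mult sum_distrib_left)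

lemma plen_add: "plen (p + q) \<le> plen p + plen q"
proof -
  define n where "n = max (degree p) (degree q)"
  have "plen (p + q) = (\<Sum>i\<le>n. \<bar>coeff p i + coeff q i\<bar>)"
    by (subst plen_eq[of _ n]) (auto simp: n_def degree_add_le)
  also have "\<dots> \<le> (\<Sum>i\<le>n. \<bar>coeff p i\<bar> + \<bar>coeff q i\<bar>)" by (intro sum_mono abs_triangle_ineq)
  also have "\<dots> = plen p + plen q"
    by (simp add: sum.distrib plen_eq[of p n] plen_eq[of q n] n_def)
  finally show ?thesis .
qed

lemma plen_mult: "plen (p * q) \<le> plen p * plen q"
proof (induction p)
  case (pCons a p)
  have "plen (pCons a p * q) \<le> plen (smult a q) + plen (pCons 0 (p * q))"
    unfolding mult_pCons_left by (rule plen_add)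
  then show ?case using pCons.IH by (simp add: plen_smult plen_pCons algebra_simps)
qed simp

lemma plen_1 [simp]: "plen 1 = 1" by (simp add: plen_def)

lemma plen_power: "plen (p ^ n) \<le> plen p ^ n"
proof (induction n)
  case (Suc n)
  have "plen (p ^ Suc n) \<le> plen p * plen (p ^ n)" using plen_mult[of p "p ^ n"] by simp
  also have "\<dots> \<le> plen p * plen p ^ n" using Suc plen_nonneg by (intro mult_left_mono)
  finally show ?case by simp
qed simp

lemma plen_sum: "finite S \<Longrightarrow> plen (\<Sum>i\<in>S. f i) \<le> (\<Sum>i\<in>S. plen (f i))"
  by (induction S rule: finite_induct) (auto intro: order_trans[OF plen_add])

lemma plen_monom: "plen (monom c n) = \<bar>c\<bar>"
  by (induction n) (simp_all add: monom_0 monom_Suc plen_pCons)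

lemma int_coeffs_add: "int_coeffs p \<Longrightarrow> int_coeffs q \<Longrightarrow> int_coeffs (p + q)"
  by (simp add: int_coeffs_def)

lemma int_coeffs_mult: "int_coeffs p \<Longrightarrow> int_coeffs q \<Longrightarrow> int_coeffs (p * q)"
  by (auto simp: int_coeffs_def coeff_mult intro!: Ints_sum Ints_mult)

lemma int_coeffs_1: "int_coeffs 1" by (auto simp: int_coeffs_def)

lemma int_coeffs_power: "int_coeffs p \<Longrightarrow> int_coeffs (p ^ n)"
  by (induction n) (auto intro: int_coeffs_mult int_coeffs_1)

lemma int_coeffs_sum: "(\<And>i. i \<in> S \<Longrightarrow> int_coeffs (f i)) \<Longrightarrow> int_coeffs (\<Sum>i\<in>S. f i)"
  by (simp add: int_coeffs_def coeff_sum Ints_sum)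

lemma int_coeffs_pCons: "a \<in> \<int> \<Longrightarrow> int_coeffs p \<Longrightarrow> int_coeffs (pCons a p)"
  by (simp add: int_coeffs_def coeff_pCons split: nat.split)

lemma int_coeffs_0: "int_coeffs 0" by (simp add: int_coeffs_def)

lemma int_coeffs_monom: "a \<in> \<int> \<Longrightarrow> int_coeffs (monom a n)"
  by (simp add: int_coeffs_def)

text \<open>
  Multiplying by the leading coefficient a at each step makes the reduction of a power modulo p integral, at the price
  of a factor C per step.
\<close>

lemma powers_in_lattice:
  fixes z :: real
  assumes d: "0 < d" and p: "int_coeffs p" "degree p = d" "poly p z = 0"
  obtains a C :: int and c :: "nat \<Rightarrow> nat \<Rightarrow> int" where "a \<noteq> 0" "\<bar>a\<bar> \<le> C" "1 \<le> C"
    "\<And>e. (of_int a * z) ^ e = (\<Sum>j<d. of_int (c e j) * z ^ j)" "\<And>e j. \<bar>c e j\<bar> \<le> C ^ e"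
proof -
  define q where "q i = \<lfloor>coeff p i\<rfloor>" for i
  have q: "of_int (q i) = coeff p i" for i using p(1) by (simp add: q_def int_coeffs_def)
  define a where "a = q d"
  define C where "C = 2 * (1 + (\<Sum>i\<le>d. \<bar>q i\<bar>))"
  have qC: "2 * \<bar>q i\<bar> \<le> C" if "i \<le> d" for i
    using member_le_sum[of i "{..d}" "\<lambda>i. \<bar>q i\<bar>"] that by (simp add: C_def)
  have C1: "1 \<le> C" using sum_nonneg[of "{..d}" "\<lambda>i. \<bar>q i\<bar>"] by (simp add: C_def)
  define c where "c = rec_nat (\<lambda>j. of_bool (j = 0))
    (\<lambda>e c j. a * (if j = 0 then 0 else c (j - 1)) - (if j \<le> d then c (d - 1) * q j else 0))"
  have c0: "c 0 j = of_bool (j = 0)" for j by (simp add: c_def)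
  have cS: "c (Suc e) j = a * (if j = 0 then 0 else c e (j - 1)) - (if j \<le> d then c e (d - 1) * q j else 0)" for e j
    by (simp add: c_def)
  have bound: "\<bar>c e j\<bar> \<le> C ^ e" for e j
  proof (induction e arbitrary: j)
    case (Suc e)
    have "\<bar>a * (if j = 0 then 0 else c e (j - 1))\<bar> \<le> \<bar>a\<bar> * C ^ e"
      using Suc C1 by (auto simp: abs_mult intro: mult_left_mono)
    moreover have "\<bar>if j \<le> d then c e (d - 1) * q j else 0\<bar> \<le> (if j \<le> d then \<bar>q j\<bar> else 0) * C ^ e"
      using Suc by (auto simp: abs_mult mult.commute intro: mult_left_mono)
    ultimately have "\<bar>c (Suc e) j\<bar> \<le> (\<bar>a\<bar> + (if j \<le> d then \<bar>q j\<bar> else 0)) * C ^ e"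
      unfolding cS distrib_right by linarith
    also have "\<dots> \<le> C * C ^ e"
      using qC[of d] qC[of j] C1 by (intro mult_right_mono) (auto simp: a_def)
    finally show ?case by simp
  qed (simp add: c0)
  obtain d' where d': "d = Suc d'" using d by (cases d) auto
  have root: "of_int a * z ^ d = - (\<Sum>j<d. of_int (q j) * z ^ j)"
    using p(3) unfolding poly_altdef p(2) q[symmetric] a_def lessThan_Suc_atMost[symmetric] by simp
  have pow: "(of_int a * z) ^ e = (\<Sum>j<d. of_int (c e j) * z ^ j)" for e
  proof (induction e)
    case 0
    have "(\<Sum>j<d. of_int (c 0 j) * z ^ j) = (\<Sum>j<d. if j = 0 then 1 else 0)"
      by (intro sum.cong) (auto simp: c0)
    then show ?case using d by simp
  next
    case (Suc e)
    have "(of_int a * z) ^ Suc e = of_int a * z * (\<Sum>j<d. of_int (c e j) * z ^ j)" using Suc by simp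
    also have "\<dots> = (\<Sum>j<d. of_int (a * c e j) * z ^ Suc j)"
      by (simp add: sum_distrib_left mult_ac)
    also have "\<dots> = (\<Sum>j<d'. of_int (a * c e j) * z ^ Suc j) + of_int (c e d') * (of_int a * z ^ d)"
      by (simp add: d')
    also have "(\<Sum>j<d'. of_int (a * c e j) * z ^ Suc j) =
        (\<Sum>j<d. of_int (a * (if j = 0 then 0 else c e (j - 1))) * z ^ j)"
      unfolding d' by (subst sum.lessThan_Suc_shift) simp
    also have "\<dots> + of_int (c e d') * (of_int a * z ^ d) =
        (\<Sum>j<d. of_int (a * (if j = 0 then 0 else c e (j - 1))) * z ^ j - of_int (c e d') * (of_int (q j) * z ^ j))"
      unfolding root by (simp add: sum_subtractf sum_distrib_left)
    also have "\<dots> = (\<Sum>j<d. of_int (c (Suc e) j) * z ^ j)"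
      by (intro sum.cong) (auto simp: cS d' algebra_simps)
    finally show ?case .
  qed
  have "p \<noteq> 0" using d p(2) by auto
  then have "a \<noteq> 0" using q[of d] p(2) by (metis a_def leading_coeff_0_iff of_int_0)
  moreover have "\<bar>a\<bar> \<le> C" using qC[of d] by (simp add: a_def)
  ultimately show thesis using that pow bound C1 by blast
qed

text \<open>
  Let d be the degree of z.  Multiplication by a fixed number R(z) acts on the lattice spanned by the powers of z below the
  d-th.  The pigeonhole principle gives a short lattice vector Q(z) that it maps to an integer
  (after clearing denominators), and this integer does not vanish.
\<close>

lemma liouville:
  fixes z :: real
  assumes "algebraic z"
  obtains C1 C2 :: real and d :: nat where "0 < C1" "1 \<le> C2" "0 < d"
    "\<And>R D L. int_coeffs R \<Longrightarrow> degree R \<le> D \<Longrightarrow> plen R \<le> L \<Longrightarrow> 1 \<le> L \<Longrightarrow> poly R z \<noteq> 0 \<Longrightarrow>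
      1 \<le> \<bar>poly R z\<bar> * C1 * C2 ^ D * L ^ d"
proof -
  define V where "V n \<longleftrightarrow> (\<exists>p. int_coeffs p \<and> p \<noteq> 0 \<and> poly p z = 0 \<and> degree p = n)" for n
  have exV: "\<exists>n. V n" using assms unfolding algebraic_def V_def int_coeffs_def by blast
  define d where "d = (LEAST n. V n)"
  have "V d" unfolding d_def using exV by (rule LeastI_ex)
  then obtain p where p: "int_coeffs p" "p \<noteq> 0" "poly p z = 0" "degree p = d" by (auto simp: V_def)
  have minimal: "poly q z \<noteq> 0" if "int_coeffs q" "q \<noteq> 0" "degree q < d" for q
    using that not_less_Least[of "degree q" V] by (auto simp: V_def d_def)
  have d: "0 < d"
  proof (rule ccontr)
    assume "\<not> 0 < d"
    then obtain b where "p = [:b:]" using p(4) by (metis degree_eq_zeroE neq0_conv)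
    then show False using p(2,3) by simp
  qed
  obtain a C :: int and c :: "nat \<Rightarrow> nat \<Rightarrow> int" where a: "a \<noteq> 0" "\<bar>a\<bar> \<le> C" and C: "1 \<le> C"
    and pow: "\<And>e. (of_int a * z) ^ e = (\<Sum>j<d. of_int (c e j) * z ^ j)"
    and c: "\<And>e j. \<bar>c e j\<bar> \<le> C ^ e"
    by (rule powers_in_lattice[OF d p(1,4,3)]) (rule that)
  define A where "A = (1 + \<bar>z\<bar>) ^ d"
  define C2 :: real where "C2 = of_int C ^ d"
  define C1 :: real where "C1 = of_int C ^ (d * d) * (d * A * (4 * d) ^ d)"
  have A1: "1 \<le> A" unfolding A_def by (intro one_le_power) simp
  have "0 < C1" unfolding C1_def using C A1 d by (intro mult_pos_pos zero_less_power) auto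
  moreover have "1 \<le> C2" unfolding C2_def using C by (intro one_le_power) simp
  moreover have "1 \<le> \<bar>poly R z\<bar> * C1 * C2 ^ D * L ^ d"
    if R: "int_coeffs R" "degree R \<le> D" "plen R \<le> L" "1 \<le> L" "poly R z \<noteq> 0" for R D L
  proof -
    define r where "r i = \<lfloor>coeff R i\<rfloor>" for i
    have r: "of_int (r i) = coeff R i" for i using R(1) by (simp add: r_def int_coeffs_def)
    define K where "K = D + d"
    define m where "m i j = (\<Sum>e\<le>D. r e * a ^ (K - (e + i)) * c (e + i) j)" for i j
    define B where "B = \<lceil>L\<rceil> * C ^ K"
    have LB: "1 \<le> \<lceil>L\<rceil>" using R(4) by linarith
    have B1: "1 \<le> B"
    proof -
      have "1 * 1 \<le> \<lceil>L\<rceil> * C ^ K" using LB C by (intro mult_mono one_le_power) auto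
      then show ?thesis by (simp add: B_def)
    qed
    have m_bound: "\<bar>m i j\<bar> \<le> B" if i: "i < d" for i j
    proof -
      have "\<bar>m i j\<bar> \<le> (\<Sum>e\<le>D. \<bar>r e * a ^ (K - (e + i)) * c (e + i) j\<bar>)" unfolding m_def by (rule sum_abs)
      also have "\<dots> \<le> (\<Sum>e\<le>D. \<bar>r e\<bar> * C ^ K)"
      proof (rule sum_mono)
        fix e assume e: "e \<in> {..D}"
        have "\<bar>a ^ (K - (e + i))\<bar> * \<bar>c (e + i) j\<bar> \<le> C ^ (K - (e + i)) * C ^ (e + i)"
          using a(2) c[of "e + i" j] C by (intro mult_mono) (auto simp: power_abs intro: power_mono)
        also have "\<dots> = C ^ K" using e i by (simp add: K_def flip: power_add)
        finally have "\<bar>r e\<bar> * (\<bar>a ^ (K - (e + i))\<bar> * \<bar>c (e + i) j\<bar>) \<le> \<bar>r e\<bar> * C ^ K"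
          by (rule mult_left_mono) simp
        then show "\<bar>r e * a ^ (K - (e + i)) * c (e + i) j\<bar> \<le> \<bar>r e\<bar> * C ^ K" by (simp add: abs_mult mult.assoc)
      qed
      also have "\<dots> = (\<Sum>e\<le>D. \<bar>r e\<bar>) * C ^ K" by (simp add: sum_distrib_right)
      also have "\<dots> \<le> \<lceil>L\<rceil> * C ^ K"
      proof (rule mult_right_mono)
        have "real_of_int (\<Sum>e\<le>D. \<bar>r e\<bar>) = plen R" by (simp add: r plen_eq[OF R(2)])
        then show "(\<Sum>e\<le>D. \<bar>r e\<bar>) \<le> \<lceil>L\<rceil>" using R(3) by linarith
      qed (use C in simp)
      finally show ?thesis by (simp add: B_def)
    qed
    have "d - 1 < d" using d by simp
    from siegel[OF this B1, of "\<lambda>j i. m i (Suc j)"] m_bound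
    obtain x where x: "\<exists>i<d. x i \<noteq> 0" "\<And>i. i < d \<Longrightarrow> \<bar>x i\<bar> \<le> (2 * int d * B) ^ (d - 1)"
      "\<And>j. j < d - 1 \<Longrightarrow> (\<Sum>i<d. m i (Suc j) * x i) = 0" by blast
    define Q where "Q = (\<Sum>i<d. monom (of_int (x i)) i :: real poly)"
    have Qc: "coeff Q i = (if i < d then of_int (x i) else 0)" for i
      by (simp add: Q_def coeff_sum if_distrib sum.delta' cong: if_cong)
    have "int_coeffs Q" by (simp add: int_coeffs_def Qc)
    moreover have "Q \<noteq> 0" using x(1) Qc by (metis coeff_0 of_int_0_eq_iff)
    moreover have "degree Q \<le> d - 1" by (rule degree_le) (auto simp: Qc)
    then have "degree Q < d" using d by linarith
    ultimately have Q0: "poly Q z \<noteq> 0" by (rule minimal)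
    have Qval: "poly Q z = (\<Sum>i<d. of_int (x i) * z ^ i)" by (simp add: Q_def poly_sum poly_monom)
    define n where "n = (\<Sum>i<d. m i 0 * x i)"
    have row: "of_int a ^ K * poly R z * z ^ i = (\<Sum>j<d. of_int (m i j) * z ^ j)" if i: "i < d" for i
    proof -
      have "of_int a ^ K * poly R z * z ^ i = (\<Sum>e\<le>D. of_int a ^ K * (of_int (r e) * z ^ e) * z ^ i)"
        unfolding poly_altdef r[symmetric]
        by (subst sum.mono_neutral_left[of "{..D}" "{..degree R}"])
          (use R(2) in \<open>auto simp: r coeff_eq_0 sum_distrib_left sum_distrib_right\<close>)
      also have "\<dots> = (\<Sum>e\<le>D. of_int (r e * a ^ (K - (e + i))) * (of_int a * z) ^ (e + i))"
      proof (rule sum.cong)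
        fix e assume "e \<in> {..D}"
        then have "of_int a ^ K = of_int a ^ (K - (e + i)) * (of_int a :: real) ^ (e + i)"
          using i by (simp add: K_def flip: power_add)
        then show "of_int a ^ K * (of_int (r e) * z ^ e) * z ^ i =
            of_int (r e * a ^ (K - (e + i))) * (of_int a * z) ^ (e + i)"
          by (simp add: power_mult_distrib power_add mult_ac)
      qed simp
      also have "\<dots> = (\<Sum>e\<le>D. \<Sum>j<d. of_int (r e * a ^ (K - (e + i)) * c (e + i) j) * z ^ j)"
        unfolding pow sum_distrib_left by (simp add: mult_ac)
      also have "\<dots> = (\<Sum>j<d. of_int (m i j) * z ^ j)"
        by (subst sum.swap) (simp add: m_def sum_distrib_right)
      finally show ?thesis .
    qed
    have "of_int a ^ K * poly R z * poly Q z = (\<Sum>i<d. of_int (x i) * (of_int a ^ K * poly R z * z ^ i))"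
      by (simp add: Qval sum_distrib_left mult_ac)
    also have "\<dots> = (\<Sum>i<d. \<Sum>j<d. of_int (m i j * x i) * z ^ j)"
    proof (rule sum.cong)
      fix i assume "i \<in> {..<d}"
      then have i: "i < d" by simp
      show "of_int (x i) * (of_int a ^ K * poly R z * z ^ i) = (\<Sum>j<d. of_int (m i j * x i) * z ^ j)"
        unfolding row[OF i] sum_distrib_left by (simp add: mult_ac)
    qed simp
    also have "\<dots> = (\<Sum>j<d. of_int (\<Sum>i<d. m i j * x i) * z ^ j)"
      by (subst sum.swap) (simp add: sum_distrib_right)
    also have "\<dots> = of_int n"
    proof -
      obtain d' where d': "d = Suc d'" using d by (cases d) auto
      have "(\<Sum>j<Suc d'. of_int (\<Sum>i<d. m i j * x i) * z ^ j) = of_int (\<Sum>i<d. m i 0 * x i) * z ^ 0 +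
          (\<Sum>j<d'. of_int (\<Sum>i<d. m i (Suc j) * x i) * z ^ Suc j)"
        by (rule sum.lessThan_Suc_shift)
      also have "(\<Sum>j<d'. of_int (\<Sum>i<d. m i (Suc j) * x i) * z ^ Suc j) = 0"
        using x(3) d' by (intro sum.neutral) simp
      finally show ?thesis using d' by (simp add: n_def)
    qed
    finally have eq: "of_int a ^ K * poly R z * poly Q z = of_int n" .
    then have "n \<noteq> 0" using a(1) R(5) Q0 by auto
    then have "1 \<le> \<bar>real_of_int n\<bar>" by linarith
    also have "\<dots> = \<bar>of_int a\<bar> ^ K * \<bar>poly R z\<bar> * \<bar>poly Q z\<bar>"
      unfolding eq[symmetric] by (simp add: abs_mult power_abs)
    also have "\<dots> \<le> of_int C ^ K * \<bar>poly R z\<bar> * (d * ((4 * d * L * of_int C ^ K) ^ (d - 1) * A))"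
    proof (intro mult_mono power_mono)
      show "\<bar>poly Q z\<bar> \<le> d * ((4 * d * L * of_int C ^ K) ^ (d - 1) * A)"
      proof -
        have "\<bar>poly Q z\<bar> \<le> (\<Sum>i<d. \<bar>of_int (x i) * z ^ i\<bar>)" unfolding Qval by (rule sum_abs)
        also have "\<dots> \<le> (\<Sum>i<d. (4 * d * L * of_int C ^ K) ^ (d - 1) * A)"
        proof (rule sum_mono)
          fix i assume i: "i \<in> {..<d}"
          have "real_of_int \<bar>x i\<bar> \<le> real_of_int ((2 * int d * B) ^ (d - 1))" using x(2)[of i] i by (simp only: of_int_le_iff lessThan_iff)
          also have "\<dots> = (2 * real d * (of_int \<lceil>L\<rceil> * of_int C ^ K)) ^ (d - 1)" by (simp add: B_def)
          also have "\<dots> \<le> (2 * real d * ((2 * L) * of_int C ^ K)) ^ (d - 1)"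
          proof (intro power_mono mult_left_mono mult_right_mono)
            show "of_int \<lceil>L\<rceil> \<le> 2 * L" using R(4) by linarith
          qed (use C LB in auto)
          finally have "\<bar>of_int (x i)\<bar> \<le> (4 * d * L * of_int C ^ K) ^ (d - 1)" by (simp add: mult_ac)
          moreover have "\<bar>z ^ i\<bar> \<le> A"
          proof -
            have "\<bar>z ^ i\<bar> \<le> (1 + \<bar>z\<bar>) ^ i" by (simp add: power_abs power_mono)
            also have "\<dots> \<le> (1 + \<bar>z\<bar>) ^ d" using i by (intro power_increasing) auto
            finally show ?thesis by (simp add: A_def)
          qed
          ultimately show "\<bar>of_int (x i) * z ^ i\<bar> \<le> (4 * d * L * of_int C ^ K) ^ (d - 1) * A"
            using C R(4) by (simp only: abs_mult) (intro mult_mono, auto)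
        qed
        finally show ?thesis by simp
      qed
      have "\<bar>real_of_int a\<bar> = of_int \<bar>a\<bar>" by simp
      also have "\<dots> \<le> of_int C" using a(2) by (simp only: of_int_le_iff)
      finally show "\<bar>real_of_int a\<bar> \<le> of_int C" .
    qed (use C in auto)
    also have "\<dots> \<le> of_int C ^ K * \<bar>poly R z\<bar> * (d * ((4 * d) ^ d * L ^ d * of_int C ^ (K * (d - 1)) * A))"
    proof (intro mult_left_mono mult_right_mono)
      have "(4 * d * L * of_int C ^ K) ^ (d - 1) = (4 * real d) ^ (d - 1) * L ^ (d - 1) * of_int C ^ (K * (d - 1))"
        by (simp add: power_mult_distrib power_mult)
      also have "\<dots> \<le> (4 * real d) ^ d * L ^ d * of_int C ^ (K * (d - 1))"
        using d R(4) C by (intro mult_right_mono mult_mono power_increasing) auto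
      finally show "(4 * d * L * of_int C ^ K) ^ (d - 1) \<le> (4 * d) ^ d * L ^ d * of_int C ^ (K * (d - 1))" by simp
    qed (use A1 C in auto)
    also have "\<dots> = \<bar>poly R z\<bar> * (of_int C ^ K * of_int C ^ (K * (d - 1)) * (d * A * (4 * d) ^ d)) * L ^ d"
      by (simp only: mult_ac)
    also have "of_int C ^ K * of_int C ^ (K * (d - 1)) = (of_int C ^ (d * d) * C2 ^ D :: real)"
    proof -
      have "K + K * (d - 1) = d * d + d * D" using d by (cases d) (simp_all add: K_def algebra_simps)
      then show ?thesis by (simp add: C2_def flip: power_add power_mult)
    qed
    finally show "1 \<le> \<bar>poly R z\<bar> * C1 * C2 ^ D * L ^ d" by (simp add: C1_def mult_ac)
  qed
  ultimately show thesis using that d by blast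
qed


section \<open>Transcendence of the critical base\<close>

lemma one_minus_power_le:
  fixes x :: real
  assumes "0 \<le> x" "x \<le> 1"
  shows "1 - x ^ n \<le> n * (1 - x)"
proof (induction n)
  case (Suc n)
  have "1 - x ^ Suc n = (1 - x ^ n) + x ^ n * (1 - x)" by (simp add: algebra_simps)
  also have "x ^ n * (1 - x) \<le> 1 * (1 - x)" using assms by (intro mult_right_mono power_le_one) auto
  finally show ?case using Suc by (simp add: algebra_simps)
qed simp

text \<open>
  Each of the first m factors of the product vanishes at 1.
\<close>

lemma tm_series_flat:
  "\<exists>C. \<forall>x. 0 < x \<longrightarrow> x < 1 \<longrightarrow> tm_series x \<le> C * (1 - x) ^ m"
proof (intro exI allI impI)
  fix x :: real assume x: "0 < x" "x < 1"
  have "tm_series x = tm_prod m x * tm_series (x ^ 2 ^ m)" using x by (intro tm_series_prod) simp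
  also have "\<dots> \<le> tm_prod m x * 1"
    using x by (intro mult_left_mono tm_series_le_1 less_imp_le[OF tm_prod_pos]) (simp_all add: power_less_one_iff)
  also have "\<dots> \<le> (\<Prod>j<m. real (2 ^ j) * (1 - x))"
    unfolding tm_prod_def mult_1_right using x
    by (intro prod_mono conjI one_minus_power_le) (simp_all add: power_le_one)
  also have "\<dots> = (\<Prod>j<m. real (2 ^ j)) * (1 - x) ^ m" by (simp add: prod.distrib)
  finally show "tm_series x \<le> (\<Prod>j<m. real (2 ^ j)) * (1 - x) ^ m" .
qed

lemma flat_poly_eq_0:
  fixes p :: "real poly"
  assumes flat: "\<And>m. \<exists>C. \<forall>x. 0 < x \<longrightarrow> x < 1 \<longrightarrow> \<bar>poly p x\<bar> \<le> C * (1 - x) ^ m"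
  shows "p = 0"
proof (rule ccontr)
  assume "p \<noteq> 0"
  from order_decomp[OF this, of 1] obtain q where q: "p = [:-1, 1:] ^ order 1 p * q" "\<not> [:-1, 1:] dvd q" by blast
  define n where "n = order 1 p"
  obtain C where C: "\<And>x. 0 < x \<Longrightarrow> x < 1 \<Longrightarrow> \<bar>poly p x\<bar> \<le> C * (1 - x) ^ Suc n"
    using flat by blast
  have le: "\<bar>poly q x\<bar> \<le> C * (1 - x)" if x: "0 < x" "x < 1" for x
  proof -
    have "poly p x = (x - 1) ^ n * poly q x" by (subst q(1)) (simp add: n_def poly_power)
    then have "\<bar>poly p x\<bar> = (1 - x) ^ n * \<bar>poly q x\<bar>" using x by (simp add: abs_mult power_abs)
    then have "(1 - x) ^ n * \<bar>poly q x\<bar> \<le> (1 - x) ^ n * (C * (1 - x))" using C[OF x] by (simp add: mult_ac)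
    then show ?thesis using x by simp
  qed
  have "\<bar>poly q 1\<bar> \<le> C * (1 - 1)"
  proof (rule tendsto_le[of "at_left (1 :: real)"])
    show "((\<lambda>x. \<bar>poly q x\<bar>) \<longlongrightarrow> \<bar>poly q 1\<bar>) (at_left 1)" by (intro tendsto_intros)
    show "((\<lambda>x. C * (1 - x)) \<longlongrightarrow> C * (1 - 1)) (at_left 1)" by (intro tendsto_intros)
    show "\<forall>\<^sub>F x in at_left 1. \<bar>poly q x\<bar> \<le> C * (1 - x)"
      using eventually_at_left_real[of 0 1] by (rule eventually_mono) (use le in auto)
  qed simp
  then have "poly q 1 = 0" by simp
  then show False using q(2) by (simp add: poly_eq_0_iff_dvd)
qed

lemma abs_poly_le_plen: "\<bar>x\<bar> \<le> 1 \<Longrightarrow> \<bar>poly p x\<bar> \<le> plen p"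
proof -
  assume x: "\<bar>x\<bar> \<le> 1"
  have "\<bar>poly p x\<bar> \<le> (\<Sum>i\<le>degree p. \<bar>coeff p i * x ^ i\<bar>)" unfolding poly_altdef by (rule sum_abs)
  also have "\<dots> \<le> plen p"
    unfolding plen_def using x
    by (intro sum_mono) (simp add: abs_mult power_abs mult_left_le power_le_one)
  finally show ?thesis .
qed

text \<open>
  The Thue-Morse series decays faster than any power of 1 - x as x tends to 1, which no algebraic
  function other than 0 does.
\<close>

lemma tm_series_transcendental:
  assumes "\<And>x. 0 < x \<Longrightarrow> x < 1 \<Longrightarrow> (\<Sum>j\<le>N. poly (a j) x * tm_series x ^ j) = 0"
  shows "j \<le> N \<Longrightarrow> a j = 0"
  using assms
proof (induction N arbitrary: a j)
  case 0
  have "a 0 = 0"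
  proof (rule flat_poly_eq_0)
    fix m show "\<exists>C. \<forall>x. 0 < x \<longrightarrow> x < 1 \<longrightarrow> \<bar>poly (a 0) x\<bar> \<le> C * (1 - x) ^ m"
      using 0 by (intro exI[of _ 0]) simp
  qed
  then show ?case using 0 by simp
next
  case (Suc N)
  define S where "S x = (\<Sum>j\<le>N. poly (a (Suc j)) x * tm_series x ^ j)" for x
  have split: "poly (a 0) x + tm_series x * S x = 0" if "0 < x" "x < 1" for x
    using Suc.prems(2)[OF that]
    by (simp add: S_def sum.atMost_Suc_shift sum_distrib_left mult_ac del: sum.atMost_Suc)
  define K where "K = (\<Sum>j\<le>N. plen (a (Suc j)))"
  have K0: "0 \<le> K" by (simp add: K_def sum_nonneg plen_nonneg)
  have S_le: "\<bar>S x\<bar> \<le> K" if x: "0 < x" "x < 1" for x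
  proof -
    have "\<bar>S x\<bar> \<le> (\<Sum>j\<le>N. \<bar>poly (a (Suc j)) x * tm_series x ^ j\<bar>)" unfolding S_def by (rule sum_abs)
    also have "\<dots> \<le> (\<Sum>j\<le>N. plen (a (Suc j)) * 1)"
    proof (rule sum_mono)
      fix j
      have "0 \<le> tm_series x" "tm_series x \<le> 1" using x tm_series_nonneg tm_series_le_1 by simp_all
      then have "\<bar>tm_series x ^ j\<bar> \<le> 1" by (simp add: power_abs power_le_one)
      moreover have "\<bar>poly (a (Suc j)) x\<bar> \<le> plen (a (Suc j))" using x by (intro abs_poly_le_plen) simp
      ultimately show "\<bar>poly (a (Suc j)) x * tm_series x ^ j\<bar> \<le> plen (a (Suc j)) * 1"
        unfolding abs_mult using plen_nonneg by (intro mult_mono) auto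
    qed
    finally show ?thesis by (simp add: K_def)
  qed
  have a0: "a 0 = 0"
  proof (rule flat_poly_eq_0)
    fix m
    obtain C where C: "\<And>x. 0 < x \<Longrightarrow> x < 1 \<Longrightarrow> tm_series x \<le> C * (1 - x) ^ m"
      using tm_series_flat by blast
    have "\<bar>poly (a 0) x\<bar> \<le> K * C * (1 - x) ^ m" if x: "0 < x" "x < 1" for x
    proof -
      have "\<bar>poly (a 0) x\<bar> = \<bar>tm_series x * S x\<bar>" using split[OF x] by linarith
      also have "\<dots> = \<bar>S x\<bar> * tm_series x" using tm_series_nonneg[of x] x by (simp add: abs_mult)
      also have "\<dots> \<le> K * (C * (1 - x) ^ m)"
        using S_le[OF x] C[OF x] K0 tm_series_nonneg[of x] x by (intro mult_mono) auto
      finally show ?thesis by (simp add: mult.assoc)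
    qed
    then show "\<exists>C. \<forall>x. 0 < x \<longrightarrow> x < 1 \<longrightarrow> \<bar>poly (a 0) x\<bar> \<le> C * (1 - x) ^ m" by blast
  qed
  have "S x = 0" if "0 < x" "x < 1" for x
    using split[OF that] a0 tm_series_pos[of x] that by simp
  then have IH: "a (Suc j) = 0" if "j \<le> N" for j
    using Suc.IH[of j "\<lambda>j. a (Suc j)"] that by (simp add: S_def)
  show ?case using a0 IH Suc.prems(1) by (cases j) auto
qed

definition tm_fps :: "real fps" where "tm_fps = Abs_fps (\<lambda>i. of_int (tm_coeff i))"

lemma fps_power_Ints: "fps_nth (tm_fps ^ n) l \<in> \<int>"
proof (induction n arbitrary: l)
  case (Suc n)
  then show ?case by (auto simp: fps_mult_nth tm_fps_def intro!: Ints_sum Ints_mult)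
qed (simp add: fps_one_nth)

lemma tm_fps_radius: "1 \<le> fps_conv_radius tm_fps"
  unfolding fps_conv_radius_def
proof (rule conv_radius_geI_ex')
  fix r :: real assume "0 < r" "ereal r < 1"
  then show "summable (\<lambda>n. fps_nth tm_fps n * of_real r ^ n)"
    using sums_summable[OF tm_series_sums[of r]] by (simp add: tm_fps_def)
qed

lemma eval_tm_fps: "eval_fps tm_fps x = tm_series x"
  by (simp add: eval_fps_def tm_series_def tm_fps_def)

text \<open>
  Polynomials in x and the series with degree at most N in both have (N + 1)^2 coefficients, so that
  N^2 Taylor coefficients can be made to vanish.
\<close>

lemma auxiliary_polynomials:
  obtains P :: "nat \<Rightarrow> real poly" where "\<And>j. int_coeffs (P j)" "\<And>j. degree (P j) \<le> N"
    "\<exists>j\<le>N. P j \<noteq> 0" "\<And>l. l < N * N \<Longrightarrow> fps_nth (\<Sum>j\<le>N. fps_of_poly (P j) * tm_fps ^ j) l = 0"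
proof -
  define k where "k = Suc N"
  define w where "w u = fps_X ^ (u mod k) * tm_fps ^ (u div k)" for u
  have w_int: "fps_nth (w u) l \<in> \<int>" for u l
    by (simp add: w_def fps_X_power_mult_nth fps_power_Ints)
  define A where "A l u = \<lfloor>fps_nth (w u) l\<rfloor>" for l u
  have A: "of_int (A l u) = fps_nth (w u) l" for l u using w_int by (simp add: A_def)
  define B where "B = 1 + (\<Sum>l<N * N. \<Sum>u<k * k. \<bar>A l u\<bar>)"
  have "\<bar>A l u\<bar> \<le> B" if "l < N * N" "u < k * k" for l u
  proof -
    have "\<bar>A l u\<bar> \<le> (\<Sum>u<k * k. \<bar>A l u\<bar>)" using that by (intro member_le_sum) auto
    also have "\<dots> \<le> (\<Sum>l<N * N. \<Sum>u<k * k. \<bar>A l u\<bar>)"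
      using that by (intro member_le_sum[of l _ "\<lambda>l. \<Sum>u<k * k. \<bar>A l u\<bar>"]) (auto intro: sum_nonneg)
    finally show ?thesis by (simp add: B_def)
  qed
  moreover have "N * N < k * k" by (simp add: k_def)
  moreover have "1 \<le> B" by (simp add: B_def sum_nonneg)
  ultimately obtain x where x: "\<exists>u<k * k. x u \<noteq> 0" "\<And>l. l < N * N \<Longrightarrow> (\<Sum>u<k * k. A l u * x u) = 0"
    using siegel[of "N * N" "k * k" B A] by blast
  define S where "S j = {u \<in> {..<k * k}. u div k = j}" for j
  define P where "P j = (\<Sum>u\<in>S j. monom (of_int (x u)) (u mod k) :: real poly)" for j
  have fin: "finite (S j)" for j by (simp add: S_def)
  have "int_coeffs (P j)" for j unfolding P_def by (intro int_coeffs_sum int_coeffs_monom) simp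
  moreover have "degree (P j) \<le> N" for j
    unfolding P_def
  proof (intro degree_sum_le fin)
    fix u
    have "degree (monom (of_int (x u)) (u mod k) :: real poly) \<le> u mod k" by (rule degree_monom_le)
    also have "\<dots> \<le> N" using mod_less_divisor[of k u] by (simp add: k_def)
    finally show "degree (monom (of_int (x u)) (u mod k) :: real poly) \<le> N" .
  qed
  moreover have "\<exists>j\<le>N. P j \<noteq> 0"
  proof -
    obtain u where u: "u < k * k" "x u \<noteq> 0" using x(1) by blast
    have "coeff (P (u div k)) (u mod k) = (\<Sum>v\<in>S (u div k). if v = u then of_int (x v) else 0)"
      unfolding P_def coeff_sum
    proof (rule sum.cong)
      fix v assume "v \<in> S (u div k)"
      then have "v div k = u div k" by (simp add: S_def)
      then have "v mod k = u mod k \<longleftrightarrow> v = u" by (metis div_mult_mod_eq)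
      then show "coeff (monom (of_int (x v)) (v mod k)) (u mod k) = (if v = u then of_int (x v) else (0 :: real))"
        by simp
    qed simp
    also have "\<dots> = of_int (x u)" using u(1) fin by (simp add: S_def)
    finally have "P (u div k) \<noteq> 0" using u(2) by auto
    moreover have "u div k \<le> N" using u(1) by (simp add: less_mult_imp_div_less k_def less_Suc_eq_le flip: less_Suc_eq_le)
    ultimately show ?thesis by blast
  qed
  moreover have "fps_nth (\<Sum>j\<le>N. fps_of_poly (P j) * tm_fps ^ j) l = 0" if l: "l < N * N" for l
  proof -
    have "fps_of_poly (P j) * tm_fps ^ j = (\<Sum>u\<in>S j. fps_const (of_int (x u)) * w u)" for j
      unfolding P_def fps_of_poly_sum sum_distrib_right
      by (intro sum.cong) (auto simp: S_def w_def fps_of_poly_monom mult_ac)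
    then have "(\<Sum>j\<le>N. fps_of_poly (P j) * tm_fps ^ j) = (\<Sum>j\<le>N. \<Sum>u\<in>S j. fps_const (of_int (x u)) * w u)"
      by simp
    also have "\<dots> = (\<Sum>u<k * k. fps_const (of_int (x u)) * w u)"
      unfolding S_def
    proof (rule sum.group)
      show "(\<lambda>u. u div k) ` {..<k * k} \<subseteq> {..N}"
        by (auto simp: k_def less_mult_imp_div_less simp flip: less_Suc_eq_le)
    qed auto
    also have "fps_nth \<dots> l = of_int (\<Sum>u<k * k. A l u * x u)"
      by (simp add: fps_sum_nth A mult.commute)
    finally show ?thesis using x(2)[OF l] by simp
  qed
  ultimately show thesis by (rule that)
qed

text \<open>
  The auxiliary function is not identically 0 by transcendence, so near 0 it behaves like the first
  nonvanishing term of its Taylor series.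
\<close>

lemma auxiliary_function:
  obtains P :: "nat \<Rightarrow> real poly" and C \<epsilon> :: real where "\<And>j. int_coeffs (P j)" "\<And>j. degree (P j) \<le> N"
    "0 < \<epsilon>" "\<And>x. 0 < x \<Longrightarrow> x < \<epsilon> \<Longrightarrow> (\<Sum>j\<le>N. poly (P j) x * tm_series x ^ j) \<noteq> 0"
    "\<And>x. 0 < x \<Longrightarrow> x < \<epsilon> \<Longrightarrow> \<bar>\<Sum>j\<le>N. poly (P j) x * tm_series x ^ j\<bar> \<le> C * x ^ (N * N)"
proof -
  obtain P :: "nat \<Rightarrow> real poly" where P: "\<And>j. int_coeffs (P j)" "\<And>j. degree (P j) \<le> N"
    "\<exists>j\<le>N. P j \<noteq> 0" "\<And>l. l < N * N \<Longrightarrow> fps_nth (\<Sum>j\<le>N. fps_of_poly (P j) * tm_fps ^ j) l = 0"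
    by (rule auxiliary_polynomials[of N]) (rule that)
  define G where "G n = (\<Sum>j\<le>n. fps_of_poly (P j) * tm_fps ^ j)" for n
  define H where "H n x = (\<Sum>j\<le>n. poly (P j) x * tm_series x ^ j)" for n x
  have term_radius: "1 \<le> fps_conv_radius (fps_of_poly (P j) * tm_fps ^ j)" for j
  proof -
    have "1 \<le> min (fps_conv_radius (fps_of_poly (P j))) (fps_conv_radius (tm_fps ^ j))"
      using order_trans[OF tm_fps_radius fps_conv_radius_power[of tm_fps j]] by simp
    also have "\<dots> \<le> fps_conv_radius (fps_of_poly (P j) * tm_fps ^ j)" by (rule fps_conv_radius_mult)
    finally show ?thesis .
  qed
  have G_radius: "1 \<le> fps_conv_radius (G n)" for n
  proof (induction n)
    case 0
    then show ?case using term_radius[of 0] by (simp add: G_def)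
  next
    case (Suc n)
    have "1 \<le> min (fps_conv_radius (G n)) (fps_conv_radius (fps_of_poly (P (Suc n)) * tm_fps ^ Suc n))"
      using Suc term_radius[of "Suc n"] by simp
    also have "\<dots> \<le> fps_conv_radius (G n + fps_of_poly (P (Suc n)) * tm_fps ^ Suc n)" by (rule fps_conv_radius_add)
    finally show ?case by (simp add: G_def)
  qed
  have in_radius: "ereal (norm x) < fps_conv_radius F" if "\<bar>x\<bar> < 1" "1 \<le> fps_conv_radius F" for F :: "real fps" and x :: real
    by (rule less_le_trans[OF _ that(2)]) (use that(1) in simp)
  have eval_term: "eval_fps (fps_of_poly (P j) * tm_fps ^ j) x = poly (P j) x * tm_series x ^ j" if x: "\<bar>x\<bar> < 1" for j x
  proof -
    have "1 \<le> fps_conv_radius (tm_fps ^ j)" by (rule order_trans[OF tm_fps_radius fps_conv_radius_power])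
    then show ?thesis
      using in_radius[OF x] in_radius[OF x tm_fps_radius]
      by (simp add: eval_fps_mult eval_fps_power eval_tm_fps)
  qed
  have eval_G: "eval_fps (G n) x = H n x" if x: "\<bar>x\<bar> < 1" for n x
  proof (induction n)
    case 0
    then show ?case using eval_term[OF x, of 0] by (simp add: G_def H_def)
  next
    case (Suc n)
    have "eval_fps (G (Suc n)) x = eval_fps (G n) x + eval_fps (fps_of_poly (P (Suc n)) * tm_fps ^ Suc n) x"
      using in_radius[OF x G_radius] in_radius[OF x term_radius] unfolding G_def sum.atMost_Suc
      by (intro eval_fps_add)
    then show ?case using Suc eval_term[OF x, of "Suc n"] by (simp add: H_def)
  qed
  have G0: "G N \<noteq> 0"
  proof
    assume "G N = 0"
    then have "H N x = 0" if "0 < x" "x < 1" for x using eval_G[of x N] that by simp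
    then have "\<forall>j\<le>N. P j = 0" using tm_series_transcendental[where N = N and a = P] by (simp add: H_def)
    then show False using P(3) by blast
  qed
  define s where "s = subdegree (G N)"
  have s: "N * N \<le> s" unfolding s_def using G0 P(4) by (intro subdegree_geI) (auto simp: G_def)
  define h where "h = eval_fps (fps_shift s (G N))"
  have h0: "h 0 \<noteq> 0" using G0 by (simp add: h_def s_def eval_fps_at_0)
  have H_eq: "H N x = x ^ s * h x" if "0 < x" "x < 1" for x
    using eval_fps_shift[of s "G N" x] in_radius[OF _ G_radius, of x N] eval_G[of x N] that
    by (simp add: h_def s_def)
  have "isCont h 0"
    unfolding h_def using in_radius[OF _ G_radius, of 0 N] by (intro continuous_eval_fps) simp
  then have "\<exists>\<delta>>0. \<forall>x. dist x 0 < \<delta> \<longrightarrow> dist (h x) (h 0) < \<bar>h 0\<bar>"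
    using h0 unfolding continuous_at_eps_delta by auto
  then obtain \<delta> where \<delta>: "\<delta> > 0" "\<And>x. \<bar>x\<bar> < \<delta> \<Longrightarrow> \<bar>h x - h 0\<bar> < \<bar>h 0\<bar>"
    by (auto simp: dist_real_def)
  define \<epsilon> where "\<epsilon> = min \<delta> 1"
  have small: "H N x \<noteq> 0 \<and> \<bar>H N x\<bar> \<le> (2 * \<bar>h 0\<bar>) * x ^ (N * N)" if x: "0 < x" "x < \<epsilon>" for x
  proof -
    have x1: "x < 1" "\<bar>x\<bar> < \<delta>" using x by (simp_all add: \<epsilon>_def)
    have hx: "h x \<noteq> 0" "\<bar>h x\<bar> \<le> 2 * \<bar>h 0\<bar>" using \<delta>(2)[OF x1(2)] by linarith+
    have "\<bar>H N x\<bar> = x ^ s * \<bar>h x\<bar>" using H_eq[OF x(1) x1(1)] x(1) by (simp add: abs_mult)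
    also have "\<dots> \<le> x ^ (N * N) * (2 * \<bar>h 0\<bar>)"
      using hx x x1 s by (intro mult_mono power_decreasing) auto
    finally show ?thesis using H_eq[OF x(1) x1(1)] hx x(1) by (simp add: mult.commute)
  qed
  show thesis
  proof (rule that[of P \<epsilon> "2 * \<bar>h 0\<bar>"])
    show "0 < \<epsilon>" using \<delta>(1) by (simp add: \<epsilon>_def)
  qed (use P small in \<open>auto simp: H_def\<close>)
qed

text \<open>
  Mahler's method: along the orbit of z under squaring the auxiliary function decays like the
  power N^2 of the point, whereas its value is, up to a factor, an integer polynomial in z
  whose degree is only of the order of N times the exponent.
\<close>

theorem KL_solution_transcendental:
  assumes x: "0 < z" "z < 1" and eq: "tm_series z = KL_rhs z"
  shows "\<not> algebraic z"
proof
  assume "algebraic z"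
  then obtain C1 C2 :: real and d :: nat where C: "0 < C1" "1 \<le> C2" "0 < d"
    and liou: "\<And>R D L. int_coeffs R \<Longrightarrow> degree R \<le> D \<Longrightarrow> plen R \<le> L \<Longrightarrow> 1 \<le> L \<Longrightarrow> poly R z \<noteq> 0 \<Longrightarrow>
      1 \<le> \<bar>poly R z\<bar> * C1 * C2 ^ D * L ^ d"
    by (rule liouville) (rule that)
  \<comment> \<open>The polynomial R below has degree at most 5 N 2^k, and its length contributes a factor 2^(k N d), which the
      factor (1/2)^d beats.\<close>
  have "0 < (1 / 2) ^ d / C2 ^ 5" using C by simp
  from order_tendstoD(2)[OF LIMSEQ_realpow_zero[of z] this] x
  obtain N0 where N0: "\<And>n. n \<ge> N0 \<Longrightarrow> z ^ n < (1 / 2) ^ d / C2 ^ 5" by (auto simp: eventually_sequentially)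
  define N where "N = Suc N0"
  have N: "z ^ N * C2 ^ 5 \<le> (1 / 2) ^ d" "0 < N" using N0[of N] C by (simp_all add: N_def field_simps)
  obtain P :: "nat \<Rightarrow> real poly" and C \<epsilon> :: real where P: "\<And>j. int_coeffs (P j)" "\<And>j. degree (P j) \<le> N"
    and \<epsilon>: "0 < \<epsilon>" and nonzero: "\<And>x. 0 < x \<Longrightarrow> x < \<epsilon> \<Longrightarrow> (\<Sum>j\<le>N. poly (P j) x * tm_series x ^ j) \<noteq> 0"
    and small: "\<And>x. 0 < x \<Longrightarrow> x < \<epsilon> \<Longrightarrow> \<bar>\<Sum>j\<le>N. poly (P j) x * tm_series x ^ j\<bar> \<le> C * x ^ (N * N)"
    by (rule auxiliary_function[of N]) (rule that)
  define W where "W = 1 + (\<Sum>j\<le>N. plen (P j))"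
  have W1: "1 \<le> W" by (simp add: W_def sum_nonneg plen_nonneg)
  define Q where "Q k = (\<Prod>j<k. 1 - monom 1 (2 ^ j) :: real poly)" for k
  have Q: "poly (Q k) z = tm_prod k z" "int_coeffs (Q k)" "degree (Q k) \<le> 2 ^ k" "plen (Q k) \<le> 2 ^ k" for k
  proof -
    show "poly (Q k) z = tm_prod k z" by (simp add: Q_def tm_prod_def poly_prod poly_monom)
    have step: "Q (Suc k) = Q k * (1 + monom (-1) (2 ^ k))" for k by (simp add: Q_def minus_monom[symmetric])
    have deg1: "degree (1 + monom (-1) (2 ^ k) :: real poly) \<le> 2 ^ k" for k
      by (intro degree_add_le degree_monom_le) simp
    have len1: "plen (1 + monom (-1) (2 ^ k)) \<le> 2" for k
      using plen_add[of 1 "monom (-1) (2 ^ k)"] by (simp add: plen_monom)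
    show "int_coeffs (Q k)"
      by (induction k) (auto simp: step Q_def[of 0] intro!: int_coeffs_mult int_coeffs_add int_coeffs_1 int_coeffs_monom)
    show "degree (Q k) \<le> 2 ^ k"
    proof (induction k)
      case (Suc k)
      have "degree (Q (Suc k)) \<le> degree (Q k) + degree (1 + monom (-1) (2 ^ k) :: real poly)"
        unfolding step by (rule degree_mult_le)
      then show ?case using Suc deg1[of k] by simp
    qed (simp add: Q_def)
    show "plen (Q k) \<le> 2 ^ k"
    proof (induction k)
      case (Suc k)
      have "plen (Q (Suc k)) \<le> plen (Q k) * plen (1 + monom (-1) (2 ^ k))"
        unfolding step by (rule plen_mult)
      also have "\<dots> \<le> 2 ^ k * 2" using Suc len1 plen_nonneg by (intro mult_mono) auto
      finally show ?case by simp
    qed (simp add: Q_def)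
  qed
  \<comment> \<open>R is the auxiliary polynomial at z^(2^k) with the denominators of the series cleared: by the functional
      equation the value of the series there is (3 z - 1)/E(z).\<close>
  define T where "T k j = (\<Sum>i\<le>N. monom (coeff (P j) i) (2 ^ k * i))" for k j
  define E where "E k = [:1, -1:] ^ 2 * Q k" for k
  define R where "R k = (\<Sum>j\<le>N. T k j * ([:-1, 3:] ^ j * E k ^ (N - j)))" for k
  have T: "poly (T k j) z = poly (P j) (z ^ 2 ^ k)" "int_coeffs (T k j)" "degree (T k j) \<le> N * 2 ^ k"
    "plen (T k j) \<le> plen (P j)" for k j
  proof -
    have "poly (P j) y = (\<Sum>i\<le>N. coeff (P j) i * y ^ i)" for y
      unfolding poly_altdef using P(2)[of j] by (intro sum.mono_neutral_left) (auto simp: coeff_eq_0)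
    then show "poly (T k j) z = poly (P j) (z ^ 2 ^ k)"
      by (simp add: T_def poly_sum poly_monom power_mult)
    show "int_coeffs (T k j)"
      unfolding T_def using P(1)[of j] by (intro int_coeffs_sum int_coeffs_monom) (simp add: int_coeffs_def)
    show "degree (T k j) \<le> N * 2 ^ k"
      unfolding T_def
    proof (rule degree_sum_le)
      fix i assume "i \<in> {..N}"
      then show "degree (monom (coeff (P j) i) (2 ^ k * i)) \<le> N * 2 ^ k"
        by (intro order_trans[OF degree_monom_le]) (simp add: mult.commute)
    qed simp
    have "plen (T k j) \<le> (\<Sum>i\<le>N. \<bar>coeff (P j) i\<bar>)"
      unfolding T_def using plen_sum[of "{..N}" "\<lambda>i. monom (coeff (P j) i) (2 ^ k * i)"] by (simp add: plen_monom)
    then show "plen (T k j) \<le> plen (P j)" using plen_eq[OF P(2), of j] by simp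
  qed
  have E: "poly (E k) z = (1 - z)\<^sup>2 * tm_prod k z" "int_coeffs (E k)" "degree (E k) \<le> 2 + 2 ^ k"
    "plen (E k) \<le> 4 * 2 ^ k" for k
  proof -
    show "poly (E k) z = (1 - z)\<^sup>2 * tm_prod k z" by (simp add: E_def Q poly_power)
    show "int_coeffs (E k)"
      unfolding E_def by (intro int_coeffs_mult int_coeffs_power int_coeffs_pCons int_coeffs_0 Q) simp_all
    have "degree ([:1, -1:] ^ 2 :: real poly) \<le> 2" using degree_power_le[of "[:1, -1:] :: real poly" 2] by simp
    then show "degree (E k) \<le> 2 + 2 ^ k"
      unfolding E_def by (intro order_trans[OF degree_mult_le] add_mono Q)
    have "plen ([:1, -1:] ^ 2) \<le> 4" using plen_power[of "[:1, -1:]" 2] by (simp add: plen_pCons)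
    then show "plen (E k) \<le> 4 * 2 ^ k"
      unfolding E_def by (intro order_trans[OF plen_mult] mult_mono Q plen_nonneg) auto
  qed
  have R_int: "int_coeffs (R k)" for k
    unfolding R_def
    by (intro int_coeffs_sum int_coeffs_mult int_coeffs_power int_coeffs_pCons int_coeffs_0 T E) simp_all
  have R_deg: "degree (R k) \<le> 5 * N * 2 ^ k" for k
    unfolding R_def
  proof (rule degree_sum_le)
    fix j assume j: "j \<in> {..N}"
    have "degree (T k j * ([:-1, 3:] ^ j * E k ^ (N - j))) \<le>
        degree (T k j) + (degree ([:-1, 3:] ^ j :: real poly) + degree (E k ^ (N - j)))"
      by (intro order_trans[OF degree_mult_le] add_left_mono degree_mult_le)
    also have "\<dots> \<le> N * 2 ^ k + (1 * j + (2 + 2 ^ k) * (N - j))"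
    proof (intro add_mono T(3))
      show "degree ([:-1, 3:] ^ j :: real poly) \<le> 1 * j"
        using degree_power_le[of "[:-1, 3:] :: real poly" j] by simp
      show "degree (E k ^ (N - j)) \<le> (2 + 2 ^ k) * (N - j)"
        by (rule order_trans[OF degree_power_le mult_le_mono1[OF E(3)]])
    qed
    also have "\<dots> \<le> N * 2 ^ k + (1 * N + (2 + 2 ^ k) * N)" using j by (intro add_mono mult_le_mono) auto
    also have "\<dots> \<le> 5 * N * 2 ^ k"
    proof -
      have "N * 1 \<le> N * 2 ^ k" by (intro mult_le_mono) auto
      moreover have "5 * N * 2 ^ k = 5 * (N * 2 ^ k)" "(2 + 2 ^ k) * N = 2 * N + N * 2 ^ k"
        by (simp_all add: algebra_simps)
      ultimately show ?thesis by linarith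
    qed
    finally show "degree (T k j * ([:-1, 3:] ^ j * E k ^ (N - j))) \<le> 5 * N * 2 ^ k" .
  qed simp
  have R_len: "plen (R k) \<le> W * (4 * 2 ^ k) ^ N" for k
  proof -
    have "plen (R k) \<le> (\<Sum>j\<le>N. plen (T k j * ([:-1, 3:] ^ j * E k ^ (N - j))))"
      unfolding R_def by (rule plen_sum) simp
    also have "\<dots> \<le> (\<Sum>j\<le>N. plen (P j) * (4 * 2 ^ k) ^ N)"
    proof (rule sum_mono)
      fix j assume j: "j \<in> {..N}"
      have a: "plen ([:-1, 3:] ^ j) \<le> (4 * 2 ^ k) ^ j"
      proof -
        have "plen ([:-1, 3:] ^ j) \<le> plen [:-1, 3:] ^ j" by (rule plen_power)
        also have "\<dots> \<le> (4 * 2 ^ k) ^ j" by (intro power_mono) (auto simp: plen_pCons)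
        finally show ?thesis .
      qed
      have b: "plen (E k ^ (N - j)) \<le> (4 * 2 ^ k) ^ (N - j)"
        by (rule order_trans[OF plen_power]) (intro power_mono E plen_nonneg)
      have "plen (T k j * ([:-1, 3:] ^ j * E k ^ (N - j))) \<le> plen (T k j) * plen ([:-1, 3:] ^ j * E k ^ (N - j))"
        by (rule plen_mult)
      also have "\<dots> \<le> plen (P j) * ((4 * 2 ^ k) ^ j * (4 * 2 ^ k) ^ (N - j))"
      proof (rule mult_mono[OF T(4)])
        show "plen ([:-1, 3:] ^ j * E k ^ (N - j)) \<le> (4 * 2 ^ k) ^ j * (4 * 2 ^ k) ^ (N - j)"
          by (rule order_trans[OF plen_mult]) (intro mult_mono a b plen_nonneg, simp)
      qed (simp_all add: plen_nonneg)
      also have "(4 * 2 ^ k) ^ j * (4 * 2 ^ k) ^ (N - j) = (4 * 2 ^ k :: real) ^ N"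
        unfolding power_add[symmetric] using j by simp
      finally show "plen (T k j * ([:-1, 3:] ^ j * E k ^ (N - j))) \<le> plen (P j) * (4 * 2 ^ k) ^ N" .
    qed
    also have "\<dots> \<le> W * (4 * 2 ^ k) ^ N"
      unfolding sum_distrib_right[symmetric] by (intro mult_right_mono) (simp_all add: W_def)
    finally show ?thesis .
  qed
  have R_val: "poly (R k) z = poly (E k) z ^ N * (\<Sum>j\<le>N. poly (P j) (z ^ 2 ^ k) * tm_series (z ^ 2 ^ k) ^ j)" for k
  proof -
    define e where "e = poly (E k) z"
    have "tm_series z = tm_prod k z * tm_series (z ^ 2 ^ k)" using x by (intro tm_series_prod) simp
    then have ey: "e * tm_series (z ^ 2 ^ k) = 3 * z - 1"
      using x eq by (simp add: e_def E KL_rhs_def field_simps)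
    have "(3 * z - 1) ^ j * e ^ (N - j) = e ^ N * tm_series (z ^ 2 ^ k) ^ j" if "j \<le> N" for j
    proof -
      have "(3 * z - 1) ^ j * e ^ (N - j) = tm_series (z ^ 2 ^ k) ^ j * (e ^ j * e ^ (N - j))"
        unfolding ey[symmetric] by (simp add: power_mult_distrib)
      also have "e ^ j * e ^ (N - j) = e ^ N" using that by (simp flip: power_add)
      finally show ?thesis by (simp add: mult.commute)
    qed
    then have "(\<Sum>j\<le>N. poly (T k j) z * ((3 * z - 1) ^ j * e ^ (N - j))) =
        (\<Sum>j\<le>N. e ^ N * (poly (P j) (z ^ 2 ^ k) * tm_series (z ^ 2 ^ k) ^ j))"
      by (intro sum.cong) (simp_all add: T mult_ac)
    then show ?thesis
      by (simp add: R_def poly_sum poly_power e_def[symmetric] sum_distrib_left algebra_simps)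
  qed
  have E01: "0 < poly (E k) z" "poly (E k) z \<le> 1" for k
  proof -
    show "0 < poly (E k) z" unfolding E using x tm_prod_pos[of z k] by simp
    have "tm_prod k z \<le> 1" unfolding tm_prod_def using x by (intro prod_le_1) (simp add: power_le_one)
    then show "poly (E k) z \<le> 1"
      unfolding E using x tm_prod_pos[of z k] by (intro mult_le_one) (simp_all add: power_le_one)
  qed
  define K where "K = \<bar>C\<bar> * C1 * (W * 4 ^ N) ^ d"
  have main: "1 \<le> K * (2 ^ k * (1 / 2) ^ 2 ^ k) ^ (N * d)" if k: "z ^ 2 ^ k < \<epsilon>" for k
  proof -
    define X :: nat where "X = 2 ^ k"
    have xk: "0 < z ^ 2 ^ k" using x by simp
    have "poly (R k) z \<noteq> 0" using R_val[of k] nonzero[OF xk k] E01[of k] by simp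
    moreover have "1 \<le> W * (4 * 2 ^ k) ^ N"
    proof -
      have "1 * 1 \<le> W * (4 * 2 ^ k) ^ N" using W1 by (intro mult_mono one_le_power) (auto intro: order_trans[of _ 4])
      then show ?thesis by simp
    qed
    ultimately have "1 \<le> \<bar>poly (R k) z\<bar> * C1 * C2 ^ (5 * N * 2 ^ k) * (W * (4 * 2 ^ k) ^ N) ^ d"
      by (intro liou R_int R_deg R_len)
    also have "\<dots> \<le> (\<bar>C\<bar> * (z ^ 2 ^ k) ^ (N * N)) * C1 * C2 ^ (5 * N * 2 ^ k) * (W * (4 * 2 ^ k) ^ N) ^ d"
    proof (intro mult_right_mono)
      have "\<bar>poly (R k) z\<bar> \<le> 1 * \<bar>\<Sum>j\<le>N. poly (P j) (z ^ 2 ^ k) * tm_series (z ^ 2 ^ k) ^ j\<bar>"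
        unfolding R_val abs_mult using E01[of k] by (intro mult_right_mono) (simp_all add: power_abs power_le_one)
      also have "\<dots> \<le> C * (z ^ 2 ^ k) ^ (N * N)" using small[OF xk k] by simp
      also have "\<dots> \<le> \<bar>C\<bar> * (z ^ 2 ^ k) ^ (N * N)" using x by (intro mult_right_mono) auto
      finally show "\<bar>poly (R k) z\<bar> \<le> \<bar>C\<bar> * (z ^ 2 ^ k) ^ (N * N)" .
    qed (use \<open>0 < C1\<close> \<open>1 \<le> C2\<close> W1 in auto)
    also have "\<dots> = K * ((z ^ N * C2 ^ 5) ^ (N * X) * (2 ^ k) ^ (N * d))"
      by (simp add: K_def X_def power_mult_distrib mult_ac flip: power_mult)
    also have "\<dots> \<le> K * (((1 / 2) ^ d) ^ (N * X) * (2 ^ k) ^ (N * d))"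
      using N(1) x \<open>0 < C1\<close> \<open>1 \<le> C2\<close> W1
      by (intro mult_left_mono mult_right_mono power_mono) (auto simp: K_def)
    also have "\<dots> = K * (2 ^ k * (1 / 2) ^ 2 ^ k) ^ (N * d)"
      by (simp add: X_def power_mult_distrib mult_ac flip: power_mult)
    finally show ?thesis .
  qed
  have "(\<lambda>n. real n * (1 / 2) ^ n) \<longlonglongrightarrow> 0" by (rule powser_times_n_limit_0) simp
  moreover have "filterlim (\<lambda>k. 2 ^ k :: nat) at_top sequentially"
    by (rule filterlim_subseq) (simp add: strict_mono_def)
  ultimately have "(\<lambda>k. real (2 ^ k) * (1 / 2) ^ 2 ^ k) \<longlonglongrightarrow> 0" by (rule filterlim_compose)
  then have "(\<lambda>k. K * (2 ^ k * (1 / 2) ^ 2 ^ k) ^ (N * d)) \<longlonglongrightarrow> K * 0 ^ (N * d)"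
    by (intro tendsto_intros) simp
  moreover have "0 < N * d" using N(2) \<open>0 < d\<close> by simp
  then have "K * 0 ^ (N * d) < 1" by (simp only: zero_power mult_zero_right zero_less_one)
  ultimately have "\<forall>\<^sub>F k in sequentially. K * (2 ^ k * (1 / 2) ^ 2 ^ k) ^ (N * d) < 1" by (rule order_tendstoD(2))
  moreover have "\<forall>\<^sub>F k in sequentially. z ^ 2 ^ k < \<epsilon>"
    using order_tendstoD(2)[OF pow_pow_tendsto \<epsilon>, of z] x by simp
  ultimately have "\<forall>\<^sub>F k in sequentially. False"
  proof eventually_elim
    case (elim k)
    then show ?case using main[of k] by linarith
  qed
  then show False by simp
qed


section \<open>Dimensions for translations with unique expansions\<close>

theorem theorem1p1:
  shows "\<exists>\<alpha>KL::real.
    \<alpha>KL \<in> {1/3<..<1/2} \<and> KL_equation \<alpha>KL \<and>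
    (\<forall>\<beta>\<in>{1/3<..<1/2}. KL_equation \<beta> \<longrightarrow> \<beta> = \<alpha>KL) \<and>
    \<not> algebraic \<alpha>KL \<and>
    \<bar>\<alpha>KL - 0.39433\<bar> < 0.000005 \<and>
    (\<forall>\<alpha>\<in>{\<alpha>KL<..<1/2}. \<exists>nstar::nat.
       dim_set \<alpha> =
         {0, ln 2 / (- ln \<alpha>)} \<union>
         {ln 2 / ln \<alpha> * (\<Sum>i=1..n. (- 1 / 2) ^ i) | n::nat. 1 \<le> n \<and> n \<le> nstar}) \<and>
    dim_set \<alpha>KL =
      {0, ln 2 / (- ln \<alpha>KL), ln 2 / (- 3 * ln \<alpha>KL)} \<union>
      {ln 2 / ln \<alpha>KL * (\<Sum>i=1..n. (- 1 / 2) ^ i) | n::nat. 1 \<le> n} \<and>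
    (\<forall>\<alpha>\<in>{1/3<..<\<alpha>KL}. \<exists>a b. a < b \<and> {a..b} \<subseteq> dim_set \<alpha>)"
proof -
  obtain a where a: "0.394325 < a" "a < 0.394335" "tm_series a = KL_rhs a"
    and below: "\<And>x. 1 / 3 < x \<Longrightarrow> x < a \<Longrightarrow> KL_rhs x < tm_series x"
    and above: "\<And>x. a < x \<Longrightarrow> x < 1 / 2 \<Longrightarrow> tm_series x < KL_rhs x"
    by (rule critical_base_exists) (rule that)
  have a_range: "1 / 3 < a" "a < 1 / 2" using a by simp_all
  have base: "overlap_base x" if "1 / 3 < x" "x < 1 / 2" for x
    using that by unfold_locales simp_all
  have quadratic: "x\<^sup>2 - 3 * x + 1 < 0" if "a \<le> x" "x < 1 / 2" for x
  proof -
    have "0 < (x - 39 / 100) * (261 / 100 - x)" using that a by (intro mult_pos_pos) simp_all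
    also have "\<dots> = 3 * x - x\<^sup>2 - 10179 / 10000" by (simp add: power2_eq_square field_simps)
    finally show ?thesis by linarith
  qed
  show ?thesis
  proof (rule exI[of _ a], intro conjI ballI impI)
    show "a \<in> {1/3<..<1/2}" using a_range by simp
    show "KL_equation a" using KL_equation_iff[of a] a a_range by simp
    show "\<not> algebraic a" using a a_range by (intro KL_solution_transcendental) simp_all
    show "\<bar>a - 0.39433\<bar> < 0.000005" using a unfolding abs_less_iff by simp
    fix b :: real assume b: "b \<in> {1/3<..<1/2}" "KL_equation b"
    then have "tm_series b = KL_rhs b" using KL_equation_iff[of b] by simp
    then show "b = a" using below[of b] above[of b] b(1) by (cases a b rule: linorder_cases) simp_all
  next
    fix x assume x: "x \<in> {a<..<1/2}"
    then interpret overlap_base x using a_range by (intro base) simp_all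
    have "hole < wval x tm" using above[of x] x by (simp add: hole_vs_wval_tm)
    moreover have "x\<^sup>2 - 3 * x + 1 < 0" using x by (intro quadratic) simp_all
    ultimately show "\<exists>nstar::nat. dim_set x = {0, ln 2 / (- ln x)} \<union>
         {ln 2 / ln x * (\<Sum>i=1..n. (- 1 / 2) ^ i) | n::nat. 1 \<le> n \<and> n \<le> nstar}"
      by (rule dim_set_finite)
  next
    interpret overlap_base a using a_range by (rule base)
    have "hole = wval a tm" using a by (simp add: hole_vs_wval_tm)
    moreover have "a\<^sup>2 - 3 * a + 1 < 0" using a_range by (intro quadratic) simp_all
    moreover have third: "ln 2 / (- ln a) / 3 = ln 2 / (- 3 * ln a)" by simp
    ultimately show "dim_set a = {0, ln 2 / (- ln a), ln 2 / (- 3 * ln a)} \<union>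
      {ln 2 / ln a * (\<Sum>i=1..n. (- 1 / 2) ^ i) | n::nat. 1 \<le> n}"
      using dim_set_critical unfolding third by blast
  next
    fix x assume x: "x \<in> {1/3<..<a}"
    then interpret overlap_base x using a_range by (intro base) simp_all
    have "wval x tm < hole" using below[of x] x by (simp add: hole_vs_wval_tm)
    then show "\<exists>l u. l < u \<and> {l..u} \<subseteq> dim_set x" by (rule dim_set_interval)
  qed
qed

end
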